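(* Let $\mathcal{A},\mathcal{A}'$ be two regular categories with degree functions $\delta,\delta'$ respectively, and let $F:\mathcal{A}\to\mathcal{A}'$ be a functor preserving the degree functions and pullbacks. Then the following statements hold: (1) There exists a functor $\overline{F}:\mathcal{T}^0(\mathcal{A},\delta)\to\mathcal{T}^0(\mathcal{A}',\delta')$ defined as follows. On objects: $\overline{F}([x]):=[F(x)]$ for $x\in\mathcal{A}$. On morphisms: for $x,y\in\mathcal{A}$ and a relation $r\subset x\times y$, $\overline{F}(\langle r\rangle):=\langle F(r)\rangle$, where $F(r)\subset F(x\times y)$ is viewed as a subobject of $F(x)\times F(y)$ via the natural monomorphism $F(x\times y)\to F(x)\times F(y)$. (2) There is a natural isomorphism $\Gamma_{\mathcal{A}'}\circ F\cong\overline{F}\circ\Gamma_{\mathcal{A}}$. (3) Assume that $F$ preserves the terminal objects, i.e. $F(\mathbf{1}_{\mathcal{A}})=\mathbf{1}_{\mathcal{A}'}$ (equivalently, $F$ preserves all finite limits which exist in $\mathcal{A}$). Then the functor $\overline{F}$ is symmetric monoidal.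
   Context: $\mathbb{K}$ is a fixed field; all categories considered are well-powered. Following Knop, a category $\mathcal{A}$ is called regular if: it has a terminal object $\mathbf{1}_{\mathcal{A}}$; all morphisms have images (epi-mono factorizations, unique up to isomorphism); the pullback $x\times_z y$ exists whenever $x\to z\leftarrow y$ can be completed to a commutative square by some $w\to x$, $w\to y$; for any epimorphism $x\twoheadrightarrow z$ and any $y\to z$ the pullback $x\times_z y$ exists; epimorphisms are preserved under pullbacks. A degree function on $\mathcal{A}$ is a map $\delta:Epi(\mathcal{A})\to\mathbb{K}$ on the epimorphisms of $\mathcal{A}$ with $\delta(\mathrm{Id}_x)=1$, $\delta(e'e)=\delta(e')\delta(e)$ for composable epimorphisms, and $\delta(e')=\delta(e)$ whenever $e'$ is a pullback of $e$. A relation between $x$ and $y$ is a subobject $r\subset x\times y$. For relations $r\subset x\times y$, $s\subset y\times z$, their product is the relation $r\star s:=\mathrm{im}(r\times_y s\to x\times z)$. The $\mathbb{K}$-linear category $\mathcal{T}^0(\mathcal{A},\delta)$ has objects $[x]$ for $x\in\mathcal{A}$; morphisms $[x]\to[y]$ are formal $\mathbb{K}$-linear combinations of symbols $\langle r\rangle$, $r\subset x\times y$ a relation; composition is $\langle s\rangle\circ\langle r\rangle:=\delta(e)\langle r\star s\rangle$ if $r\times_y s$ exists, where $e:r\times_y s\twoheadrightarrow r\star s$, and $\langle s\rangle\circ\langle r\rangle:=0$ otherwise. The symmetric monoidal structure is given by $[x]\otimes[y]:=[x\times y]$. The functor $\Gamma_{\mathcal{A}}:\mathcal{A}\to\mathcal{T}^0(\mathcal{A},\delta)$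 sends $x$ to $[x]$ and $f:x\to y$ to $\langle\Gamma f\rangle$, where $\Gamma f\subset x\times y$ is the graph of $f$. A functor $F:\mathcal{A}\to\mathcal{A}'$ preserves the degree functions $\delta,\delta'$ if $F$ preserves epimorphisms and $\delta'(F(e))=\delta(e)$ for every epimorphism $e$ in $\mathcal{A}$. If $F$ preserves pullbacks, then for all $x,y$ the natural map $F(x\times y)\to F(x)\times F(y)$ is a monomorphism. A symmetric monoidal functor is one equipped with natural isomorphisms $F(X)\otimes F(Y)\cong F(X\otimes Y)$ and $\mathbf{1}\cong F(\mathbf{1})$ satisfying the usual compatibilities, including with the braidings.
   Formalization: "Preserving pullbacks" also means: if F(x)→F(z)←F(y) has a pullback, so does x→z←y (else (1) fails, e.g. nonempty finite sets into finite sets); in (3) both categories are assumed to have all binary products, so that [x]⊗[y]=[x×y] is defined. *)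

theory Defs
  imports "HOL-Library.Poly_Mapping"
begin

section \<open>Categories, functors, natural isomorphisms\<close>

record ('o, 'm) cat =
  Ob :: "'o set"
  Ar :: "'m set"
  Dom :: "'m \<Rightarrow> 'o"
  Cod :: "'m \<Rightarrow> 'o"
  Idn :: "'o \<Rightarrow> 'm"
  Comp :: "'m \<Rightarrow> 'm \<Rightarrow> 'm"  (infixl "\<cdot>\<index>" 70)

text \<open>Composition is written in applicative order: \<open>g \<cdot> f\<close> is ``first \<open>f\<close>, then \<open>g\<close>''.\<close>

definition hom :: "('o, 'm, 'x) cat_scheme \<Rightarrow> 'o \<Rightarrow> 'o \<Rightarrow> 'm set" where
  "hom C x y = {f \<in> Ar C. Dom C f = x \<and> Cod C f = y}"

definition category :: "('o, 'm, 'x) cat_scheme \<Rightarrow> bool" where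
  "category C \<longleftrightarrow>
     (\<forall>f\<in>Ar C. Dom C f \<in> Ob C \<and> Cod C f \<in> Ob C) \<and>
     (\<forall>x\<in>Ob C. Idn C x \<in> hom C x x) \<and>
     (\<forall>f\<in>Ar C. \<forall>g\<in>Ar C. Cod C f = Dom C g \<longrightarrow> g \<cdot>\<^bsub>C\<^esub> f \<in> hom C (Dom C f) (Cod C g)) \<and>
     (\<forall>f\<in>Ar C. f \<cdot>\<^bsub>C\<^esub> Idn C (Dom C f) = f \<and> Idn C (Cod C f) \<cdot>\<^bsub>C\<^esub> f = f) \<and>
     (\<forall>f\<in>Ar C. \<forall>g\<in>Ar C. \<forall>h\<in>Ar C. Cod C f = Dom C g \<and> Cod C g = Dom C h \<longrightarrow>
        h \<cdot>\<^bsub>C\<^esub> (g \<cdot>\<^bsub>C\<^esub> f) = (h \<cdot>\<^bsub>C\<^esub> g) \<cdot>\<^bsub>C\<^esub> f)"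

definition mono_ar :: "('o, 'm, 'x) cat_scheme \<Rightarrow> 'm \<Rightarrow> bool" where
  "mono_ar C m \<longleftrightarrow> m \<in> Ar C \<and>
     (\<forall>f\<in>Ar C. \<forall>g\<in>Ar C. Dom C f = Dom C g \<and> Cod C f = Dom C m \<and> Cod C g = Dom C m \<and>
        m \<cdot>\<^bsub>C\<^esub> f = m \<cdot>\<^bsub>C\<^esub> g \<longrightarrow> f = g)"

definition epi_ar :: "('o, 'm, 'x) cat_scheme \<Rightarrow> 'm \<Rightarrow> bool" where
  "epi_ar C e \<longleftrightarrow> e \<in> Ar C \<and>
     (\<forall>f\<in>Ar C. \<forall>g\<in>Ar C. Cod C f = Cod C g \<and> Dom C f = Cod C e \<and> Dom C g = Cod C e \<and>
        f \<cdot>\<^bsub>C\<^esub> e = g \<cdot>\<^bsub>C\<^esub> e \<longrightarrow> f = g)"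

definition iso_ar :: "('o, 'm, 'x) cat_scheme \<Rightarrow> 'm \<Rightarrow> bool" where
  "iso_ar C f \<longleftrightarrow> f \<in> Ar C \<and>
     (\<exists>g \<in> hom C (Cod C f) (Dom C f).
        g \<cdot>\<^bsub>C\<^esub> f = Idn C (Dom C f) \<and> f \<cdot>\<^bsub>C\<^esub> g = Idn C (Cod C f))"

record ('o, 'm, 'p, 'n) ftor =
  FOb :: "'o \<Rightarrow> 'p"
  FAr :: "'m \<Rightarrow> 'n"

definition is_functor ::
  "('o, 'm, 'x) cat_scheme \<Rightarrow> ('p, 'n, 'y) cat_scheme \<Rightarrow> ('o, 'm, 'p, 'n) ftor \<Rightarrow> bool" where
  "is_functor C D F \<longleftrightarrow>
     (\<forall>x\<in>Ob C. FOb F x \<in> Ob D) \<and>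
     (\<forall>f\<in>Ar C. FAr F f \<in> hom D (FOb F (Dom C f)) (FOb F (Cod C f))) \<and>
     (\<forall>x\<in>Ob C. FAr F (Idn C x) = Idn D (FOb F x)) \<and>
     (\<forall>f\<in>Ar C. \<forall>g\<in>Ar C. Cod C f = Dom C g \<longrightarrow>
        FAr F (g \<cdot>\<^bsub>C\<^esub> f) = FAr F g \<cdot>\<^bsub>D\<^esub> FAr F f)"

definition ftor_comp ::
  "('p, 'n, 'q, 'r) ftor \<Rightarrow> ('o, 'm, 'p, 'n) ftor \<Rightarrow> ('o, 'm, 'q, 'r) ftor" where
  "ftor_comp G F = \<lparr>FOb = (\<lambda>x. FOb G (FOb F x)), FAr = (\<lambda>f. FAr G (FAr F f))\<rparr>"

definition natural_isomorphism ::
  "('o, 'm, 'x) cat_scheme \<Rightarrow> ('p, 'n, 'y) cat_scheme \<Rightarrow>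
   ('o, 'm, 'p, 'n) ftor \<Rightarrow> ('o, 'm, 'p, 'n) ftor \<Rightarrow> ('o \<Rightarrow> 'n) \<Rightarrow> bool" where
  "natural_isomorphism C D F G \<eta> \<longleftrightarrow>
     (\<forall>x\<in>Ob C. \<eta> x \<in> hom D (FOb F x) (FOb G x) \<and> iso_ar D (\<eta> x)) \<and>
     (\<forall>f\<in>Ar C. FAr G f \<cdot>\<^bsub>D\<^esub> \<eta> (Dom C f) = \<eta> (Cod C f) \<cdot>\<^bsub>D\<^esub> FAr F f)"

section \<open>Limits\<close>

definition terminal_ob :: "('o, 'm, 'x) cat_scheme \<Rightarrow> 'o \<Rightarrow> bool" where
  "terminal_ob C t \<longleftrightarrow> t \<in> Ob C \<and> (\<forall>x\<in>Ob C. \<exists>!f. f \<in> hom C x t)"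

definition comm_square :: "('o, 'm, 'x) cat_scheme \<Rightarrow> 'm \<Rightarrow> 'm \<Rightarrow> 'm \<Rightarrow> 'm \<Rightarrow> bool" where
  "comm_square C f g p q \<longleftrightarrow>
     f \<in> Ar C \<and> g \<in> Ar C \<and> p \<in> Ar C \<and> q \<in> Ar C \<and> Cod C f = Cod C g \<and> Dom C p = Dom C q \<and>
     Cod C p = Dom C f \<and> Cod C q = Dom C g \<and> f \<cdot>\<^bsub>C\<^esub> p = g \<cdot>\<^bsub>C\<^esub> q"

definition is_pullback :: "('o, 'm, 'x) cat_scheme \<Rightarrow> 'm \<Rightarrow> 'm \<Rightarrow> 'm \<Rightarrow> 'm \<Rightarrow> bool" where
  "is_pullback C f g p q \<longleftrightarrow> comm_square C f g p q \<and>
     (\<forall>p' q'. comm_square C f g p' q' \<longrightarrow>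
        (\<exists>!h. h \<in> hom C (Dom C p') (Dom C p) \<and> p \<cdot>\<^bsub>C\<^esub> h = p' \<and> q \<cdot>\<^bsub>C\<^esub> h = q'))"

definition has_pullback :: "('o, 'm, 'x) cat_scheme \<Rightarrow> 'm \<Rightarrow> 'm \<Rightarrow> bool" where
  "has_pullback C f g \<longleftrightarrow> (\<exists>p q. is_pullback C f g p q)"

definition is_product :: "('o, 'm, 'x) cat_scheme \<Rightarrow> 'o \<Rightarrow> 'o \<Rightarrow> 'm \<Rightarrow> 'm \<Rightarrow> bool" where
  "is_product C x y p q \<longleftrightarrow> p \<in> Ar C \<and> q \<in> Ar C \<and> Dom C p = Dom C q \<and> Cod C p = x \<and> Cod C q = y \<and>
     (\<forall>f\<in>Ar C. \<forall>g\<in>Ar C. Dom C f = Dom C g \<and> Cod C f = x \<and> Cod C g = y \<longrightarrow>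
        (\<exists>!h. h \<in> hom C (Dom C f) (Dom C p) \<and> p \<cdot>\<^bsub>C\<^esub> h = f \<and> q \<cdot>\<^bsub>C\<^esub> h = g))"

definition has_product :: "('o, 'm, 'x) cat_scheme \<Rightarrow> 'o \<Rightarrow> 'o \<Rightarrow> bool" where
  "has_product C x y \<longleftrightarrow> (\<exists>p q. is_product C x y p q)"

definition has_binary_products :: "('o, 'm, 'x) cat_scheme \<Rightarrow> bool" where
  "has_binary_products C \<longleftrightarrow> (\<forall>x\<in>Ob C. \<forall>y\<in>Ob C. has_product C x y)"

text \<open>A fixed choice of a terminal object and of products; the choice of the product is
  meaningful only if \<open>has_product C x y\<close>.\<close>

definition one_ob :: "('o, 'm, 'x) cat_scheme \<Rightarrow> 'o" where
  "one_ob C = (SOME t. terminal_ob C t)"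

definition projs :: "('o, 'm, 'x) cat_scheme \<Rightarrow> 'o \<Rightarrow> 'o \<Rightarrow> 'm \<times> 'm" where
  "projs C x y = (SOME pq. is_product C x y (fst pq) (snd pq))"

definition pr1 :: "('o, 'm, 'x) cat_scheme \<Rightarrow> 'o \<Rightarrow> 'o \<Rightarrow> 'm" where
  "pr1 C x y = fst (projs C x y)"

definition pr2 :: "('o, 'm, 'x) cat_scheme \<Rightarrow> 'o \<Rightarrow> 'o \<Rightarrow> 'm" where
  "pr2 C x y = snd (projs C x y)"

definition prod_ob :: "('o, 'm, 'x) cat_scheme \<Rightarrow> 'o \<Rightarrow> 'o \<Rightarrow> 'o" where
  "prod_ob C x y = Dom C (pr1 C x y)"

text \<open>\<open>pair C f g : w \<rightarrow> x \<times> y\<close> for \<open>f : w \<rightarrow> x\<close> and \<open>g : w \<rightarrow> y\<close>.\<close>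

definition pair :: "('o, 'm, 'x) cat_scheme \<Rightarrow> 'm \<Rightarrow> 'm \<Rightarrow> 'm" where
  "pair C f g = (THE h. h \<in> hom C (Dom C f) (prod_ob C (Cod C f) (Cod C g)) \<and>
     pr1 C (Cod C f) (Cod C g) \<cdot>\<^bsub>C\<^esub> h = f \<and> pr2 C (Cod C f) (Cod C g) \<cdot>\<^bsub>C\<^esub> h = g)"

text \<open>Limits of finite diagrams: the shape is a finite directed graph with vertex set \<open>V\<close>, edge set
  \<open>E\<close>, source and target maps \<open>s\<close> and \<open>t\<close>; \<open>X\<close> and \<open>u\<close> give the objects and arrows.\<close>

definition finite_diagram ::
  "('o, 'm, 'x) cat_scheme \<Rightarrow> nat set \<Rightarrow> nat set \<Rightarrow> (nat \<Rightarrow> nat) \<Rightarrow> (nat \<Rightarrow> nat) \<Rightarrow>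
   (nat \<Rightarrow> 'o) \<Rightarrow> (nat \<Rightarrow> 'm) \<Rightarrow> bool" where
  "finite_diagram C V E s t X u \<longleftrightarrow> finite V \<and> finite E \<and>
     (\<forall>v\<in>V. X v \<in> Ob C) \<and>
     (\<forall>e\<in>E. s e \<in> V \<and> t e \<in> V \<and> u e \<in> hom C (X (s e)) (X (t e)))"

definition is_cone ::
  "('o, 'm, 'x) cat_scheme \<Rightarrow> nat set \<Rightarrow> nat set \<Rightarrow> (nat \<Rightarrow> nat) \<Rightarrow> (nat \<Rightarrow> nat) \<Rightarrow>
   (nat \<Rightarrow> 'o) \<Rightarrow> (nat \<Rightarrow> 'm) \<Rightarrow> 'o \<Rightarrow> (nat \<Rightarrow> 'm) \<Rightarrow> bool" where
  "is_cone C V E s t X u l \<pi> \<longleftrightarrow> l \<in> Ob C \<and> (\<forall>v\<in>V. \<pi> v \<in> hom C l (X v)) \<and>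
     (\<forall>e\<in>E. u e \<cdot>\<^bsub>C\<^esub> \<pi> (s e) = \<pi> (t e))"

definition is_limit ::
  "('o, 'm, 'x) cat_scheme \<Rightarrow> nat set \<Rightarrow> nat set \<Rightarrow> (nat \<Rightarrow> nat) \<Rightarrow> (nat \<Rightarrow> nat) \<Rightarrow>
   (nat \<Rightarrow> 'o) \<Rightarrow> (nat \<Rightarrow> 'm) \<Rightarrow> 'o \<Rightarrow> (nat \<Rightarrow> 'm) \<Rightarrow> bool" where
  "is_limit C V E s t X u l \<pi> \<longleftrightarrow> is_cone C V E s t X u l \<pi> \<and>
     (\<forall>l' \<pi>'. is_cone C V E s t X u l' \<pi>' \<longrightarrow>
        (\<exists>!h. h \<in> hom C l' l \<and> (\<forall>v\<in>V. \<pi> v \<cdot>\<^bsub>C\<^esub> h = \<pi>' v)))"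

section \<open>Regular categories and degree functions\<close>

definition is_factorization :: "('o, 'm, 'x) cat_scheme \<Rightarrow> 'm \<Rightarrow> 'm \<Rightarrow> 'm \<Rightarrow> bool" where
  "is_factorization C f e m \<longleftrightarrow> epi_ar C e \<and> mono_ar C m \<and> Cod C e = Dom C m \<and> f = m \<cdot>\<^bsub>C\<^esub> e"

text \<open>Pullbacks are required only in the two situations listed; in particular binary products and
  general pullbacks may fail to exist. Well-poweredness needs no clause, since the arrows form a
  set (of elements of a type).\<close>

definition regular_category :: "('o, 'm, 'x) cat_scheme \<Rightarrow> bool" where
  "regular_category C \<longleftrightarrow> category C \<and>
     (\<exists>t. terminal_ob C t) \<and>
     (\<forall>f\<in>Ar C. \<exists>e m. is_factorization C f e m \<and>
        (\<forall>e' m'. is_factorization C f e' m' \<longrightarrow>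
           (\<exists>i. iso_ar C i \<and> i \<in> hom C (Dom C m) (Dom C m') \<and>
                i \<cdot>\<^bsub>C\<^esub> e = e' \<and> m' \<cdot>\<^bsub>C\<^esub> i = m))) \<and>
     (\<forall>f g p q. comm_square C f g p q \<longrightarrow> has_pullback C f g) \<and>
     (\<forall>e f. epi_ar C e \<and> f \<in> Ar C \<and> Cod C f = Cod C e \<longrightarrow> has_pullback C e f) \<and>
     (\<forall>e f p q. epi_ar C e \<and> is_pullback C e f p q \<longrightarrow> epi_ar C q)"

text \<open>In a pullback square \<open>is_pullback C e f p q\<close> the arrow \<open>q\<close> is the pullback of \<open>e\<close> along \<open>f\<close>.
  Only the values of \<open>\<delta>\<close> on epimorphisms matter.\<close>

definition degree_function :: "('o, 'm, 'x) cat_scheme \<Rightarrow> ('m \<Rightarrow> 'k::field) \<Rightarrow> bool" where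
  "degree_function C \<delta> \<longleftrightarrow>
     (\<forall>x\<in>Ob C. \<delta> (Idn C x) = 1) \<and>
     (\<forall>e e'. epi_ar C e \<and> epi_ar C e' \<and> Cod C e = Dom C e' \<longrightarrow> \<delta> (e' \<cdot>\<^bsub>C\<^esub> e) = \<delta> e' * \<delta> e) \<and>
     (\<forall>e f p q. epi_ar C e \<and> is_pullback C e f p q \<longrightarrow> \<delta> q = \<delta> e)"

section \<open>Preservation properties\<close>

definition preserves_degree ::
  "('o, 'm, 'x) cat_scheme \<Rightarrow> ('m \<Rightarrow> 'k) \<Rightarrow> ('p, 'n, 'y) cat_scheme \<Rightarrow> ('n \<Rightarrow> 'k) \<Rightarrow>
   ('o, 'm, 'p, 'n) ftor \<Rightarrow> bool" where
  "preserves_degree C \<delta> D \<delta>' F \<longleftrightarrow>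
     (\<forall>e. epi_ar C e \<longrightarrow> epi_ar D (FAr F e) \<and> \<delta>' (FAr F e) = \<delta> e)"

definition preserves_pullbacks ::
  "('o, 'm, 'x) cat_scheme \<Rightarrow> ('p, 'n, 'y) cat_scheme \<Rightarrow> ('o, 'm, 'p, 'n) ftor \<Rightarrow> bool" where
  "preserves_pullbacks C D F \<longleftrightarrow>
     (\<forall>f g p q. is_pullback C f g p q \<longrightarrow> is_pullback D (FAr F f) (FAr F g) (FAr F p) (FAr F q))"

text \<open>Since a regular category need not have all pullbacks, preservation of the existing ones does
  not exclude that \<open>x \<rightarrow> z \<leftarrow> y\<close> has no pullback while \<open>F x \<rightarrow> F z \<leftarrow> F y\<close> has one (for example,
  for the inclusion of nonempty finite sets into finite sets). The composition of relations is zero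
  in the first case and nonzero in the second, so such functors do not act on relations
  functorially. The following condition makes \<open>F (x \<times>\<^sub>z y) = F x \<times>\<^sub>F\<^sub>z F y\<close> an equation whose two
  sides are defined simultaneously; it holds automatically if \<open>C\<close> has all pullbacks.\<close>

definition reflects_existence_of_pullbacks ::
  "('o, 'm, 'x) cat_scheme \<Rightarrow> ('p, 'n, 'y) cat_scheme \<Rightarrow> ('o, 'm, 'p, 'n) ftor \<Rightarrow> bool" where
  "reflects_existence_of_pullbacks C D F \<longleftrightarrow>
     (\<forall>f\<in>Ar C. \<forall>g\<in>Ar C. Cod C f = Cod C g \<and> has_pullback D (FAr F f) (FAr F g) \<longrightarrow>
        has_pullback C f g)"

definition preserves_terminal ::
  "('o, 'm, 'x) cat_scheme \<Rightarrow> ('p, 'n, 'y) cat_scheme \<Rightarrow> ('o, 'm, 'p, 'n) ftor \<Rightarrow> bool" where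
  "preserves_terminal C D F \<longleftrightarrow> (\<forall>t. terminal_ob C t \<longrightarrow> terminal_ob D (FOb F t))"

definition preserves_finite_limits ::
  "('o, 'm, 'x) cat_scheme \<Rightarrow> ('p, 'n, 'y) cat_scheme \<Rightarrow> ('o, 'm, 'p, 'n) ftor \<Rightarrow> bool" where
  "preserves_finite_limits C D F \<longleftrightarrow>
     (\<forall>V E s t X u l \<pi>. finite_diagram C V E s t X u \<and> is_limit C V E s t X u l \<pi> \<longrightarrow>
        is_limit D V E s t (FOb F \<circ> X) (FAr F \<circ> u) (FOb F l) (FAr F \<circ> \<pi>))"

text \<open>The natural morphism \<open>F (x \<times> y) \<rightarrow> F x \<times> F y\<close>.\<close>

definition prod_comparison ::
  "('o, 'm, 'x) cat_scheme \<Rightarrow> ('p, 'n, 'y) cat_scheme \<Rightarrow> ('o, 'm, 'p, 'n) ftor \<Rightarrow>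
   'o \<Rightarrow> 'o \<Rightarrow> 'n" where
  "prod_comparison C D F x y = pair D (FAr F (pr1 C x y)) (FAr F (pr2 C x y))"

section \<open>Symmetric monoidal data and symmetric monoidal functors\<close>

record ('o, 'm) smcat = "('o, 'm) cat" +
  TensOb :: "'o \<Rightarrow> 'o \<Rightarrow> 'o"
  TensAr :: "'m \<Rightarrow> 'm \<Rightarrow> 'm"
  UnitOb :: "'o"
  Assoc :: "'o \<Rightarrow> 'o \<Rightarrow> 'o \<Rightarrow> 'm"
  LUnit :: "'o \<Rightarrow> 'm"
  RUnit :: "'o \<Rightarrow> 'm"
  Braid :: "'o \<Rightarrow> 'o \<Rightarrow> 'm"

text \<open>Orientations: \<open>Assoc x y z : (x \<otimes> y) \<otimes> z \<rightarrow> x \<otimes> (y \<otimes> z)\<close>, \<open>LUnit x : 1 \<otimes> x \<rightarrow> x\<close>,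
  \<open>RUnit x : x \<otimes> 1 \<rightarrow> x\<close>, \<open>Braid x y : x \<otimes> y \<rightarrow> y \<otimes> x\<close>; below
  \<open>\<phi> x y : F x \<otimes> F y \<rightarrow> F (x \<otimes> y)\<close> and \<open>\<epsilon> : 1 \<rightarrow> F 1\<close>.\<close>

definition symmetric_monoidal_functor ::
  "('o, 'm, 'x) smcat_scheme \<Rightarrow> ('p, 'n, 'y) smcat_scheme \<Rightarrow> ('o, 'm, 'p, 'n) ftor \<Rightarrow>
   ('o \<Rightarrow> 'o \<Rightarrow> 'n) \<Rightarrow> 'n \<Rightarrow> bool" where
  "symmetric_monoidal_functor C D F \<phi> \<epsilon> \<longleftrightarrow>
     is_functor C D F \<and>
     \<epsilon> \<in> hom D (UnitOb D) (FOb F (UnitOb C)) \<and> iso_ar D \<epsilon> \<and>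
     (\<forall>x\<in>Ob C. \<forall>y\<in>Ob C.
        \<phi> x y \<in> hom D (TensOb D (FOb F x) (FOb F y)) (FOb F (TensOb C x y)) \<and> iso_ar D (\<phi> x y)) \<and>
     (\<forall>f\<in>Ar C. \<forall>g\<in>Ar C.
        FAr F (TensAr C f g) \<cdot>\<^bsub>D\<^esub> \<phi> (Dom C f) (Dom C g) =
        \<phi> (Cod C f) (Cod C g) \<cdot>\<^bsub>D\<^esub> TensAr D (FAr F f) (FAr F g)) \<and>
     (\<forall>x\<in>Ob C. \<forall>y\<in>Ob C. \<forall>z\<in>Ob C.
        FAr F (Assoc C x y z) \<cdot>\<^bsub>D\<^esub>
          (\<phi> (TensOb C x y) z \<cdot>\<^bsub>D\<^esub> TensAr D (\<phi> x y) (Idn D (FOb F z))) =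
        \<phi> x (TensOb C y z) \<cdot>\<^bsub>D\<^esub>
          (TensAr D (Idn D (FOb F x)) (\<phi> y z) \<cdot>\<^bsub>D\<^esub> Assoc D (FOb F x) (FOb F y) (FOb F z))) \<and>
     (\<forall>x\<in>Ob C.
        FAr F (LUnit C x) \<cdot>\<^bsub>D\<^esub> (\<phi> (UnitOb C) x \<cdot>\<^bsub>D\<^esub> TensAr D \<epsilon> (Idn D (FOb F x))) =
        LUnit D (FOb F x)) \<and>
     (\<forall>x\<in>Ob C.
        FAr F (RUnit C x) \<cdot>\<^bsub>D\<^esub> (\<phi> x (UnitOb C) \<cdot>\<^bsub>D\<^esub> TensAr D (Idn D (FOb F x)) \<epsilon>) =
        RUnit D (FOb F x)) \<and>
     (\<forall>x\<in>Ob C. \<forall>y\<in>Ob C.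
        FAr F (Braid C x y) \<cdot>\<^bsub>D\<^esub> \<phi> x y = \<phi> y x \<cdot>\<^bsub>D\<^esub> Braid D (FOb F x) (FOb F y))"

section \<open>Subobjects and relations\<close>

text \<open>A subobject of \<open>z\<close> is an isomorphism class of monomorphisms into \<open>z\<close>, encoded as the set of
  its representatives.\<close>

definition sub_class :: "('o, 'm, 'x) cat_scheme \<Rightarrow> 'm \<Rightarrow> 'm set" where
  "sub_class C m = {m'. mono_ar C m' \<and> Cod C m' = Cod C m \<and>
     (\<exists>i. iso_ar C i \<and> i \<in> hom C (Dom C m') (Dom C m) \<and> m \<cdot>\<^bsub>C\<^esub> i = m')}"

definition subobjects :: "('o, 'm, 'x) cat_scheme \<Rightarrow> 'o \<Rightarrow> 'm set set" where
  "subobjects C z = {sub_class C m |m. mono_ar C m \<and> Cod C m = z}"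

definition sub_rep :: "'m set \<Rightarrow> 'm" where
  "sub_rep r = (SOME m. m \<in> r)"

text \<open>If \<open>x \<times> y\<close> does not exist there are no relations between \<open>x\<close> and \<open>y\<close>.\<close>

definition relations :: "('o, 'm, 'x) cat_scheme \<Rightarrow> 'o \<Rightarrow> 'o \<Rightarrow> 'm set set" where
  "relations C x y = (if has_product C x y then subobjects C (prod_ob C x y) else {})"

definition graph :: "('o, 'm, 'x) cat_scheme \<Rightarrow> 'm \<Rightarrow> 'm set" where
  "graph C f = sub_class C (pair C (Idn C (Dom C f)) f)"

section \<open>The category \<open>T0\<close>\<close>

text \<open>An arrow from \<open>[x]\<close> to \<open>[y]\<close> is a finitely supported function on the relations between \<open>x\<close>
  and \<open>y\<close>, tagged with its source and target.\<close>

type_synonym ('o, 'm, 'k) rel_ar = "'o \<times> 'o \<times> ('m set \<Rightarrow>\<^sub>0 'k)"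

definition src :: "('o, 'm, 'k::zero) rel_ar \<Rightarrow> 'o" where "src f = fst f"

definition tgt :: "('o, 'm, 'k::zero) rel_ar \<Rightarrow> 'o" where "tgt f = fst (snd f)"

definition coeffs :: "('o, 'm, 'k::zero) rel_ar \<Rightarrow> ('m set \<Rightarrow>\<^sub>0 'k)" where "coeffs f = snd (snd f)"

definition bracket :: "'o \<Rightarrow> 'o \<Rightarrow> 'm set \<Rightarrow> ('o, 'm, 'k::zero_neq_one) rel_ar" where
  "bracket x y r = (x, y, Poly_Mapping.single r 1)"

definition scale :: "'k \<Rightarrow> ('a \<Rightarrow>\<^sub>0 'k) \<Rightarrow> ('a \<Rightarrow>\<^sub>0 'k::field)" where
  "scale a c = Poly_Mapping.map ((*) a) c"

text \<open>Bilinear extension of a map given on basis elements.\<close>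

definition bilin ::
  "('a \<Rightarrow> 'b \<Rightarrow> ('c \<Rightarrow>\<^sub>0 'k)) \<Rightarrow> ('a \<Rightarrow>\<^sub>0 'k) \<Rightarrow> ('b \<Rightarrow>\<^sub>0 'k) \<Rightarrow> ('c \<Rightarrow>\<^sub>0 'k::field)" where
  "bilin B c d = (\<Sum>r\<in>Poly_Mapping.keys c. \<Sum>s\<in>Poly_Mapping.keys d.
     scale (Poly_Mapping.lookup c r * Poly_Mapping.lookup d s) (B r s))"

text \<open>The composite \<open>\<langle>s\<rangle> \<circ> \<langle>r\<rangle>\<close> for \<open>r \<subseteq> x \<times> y\<close> and \<open>s \<subseteq> y \<times> z\<close>: with \<open>(p, q)\<close> the projections of the
  pullback of \<open>r \<rightarrow> y \<leftarrow> s\<close>, the induced map from the pullback to \<open>x \<times> z\<close> is factored as an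
  epimorphism \<open>e\<close> followed by a monomorphism \<open>k\<close>. All choices are unique up to isomorphism, and a
  degree function is invariant under isomorphisms.\<close>

definition rel_comp ::
  "('o, 'm, 'x) cat_scheme \<Rightarrow> ('m \<Rightarrow> 'k::field) \<Rightarrow> 'o \<Rightarrow> 'o \<Rightarrow> 'o \<Rightarrow>
   'm set \<Rightarrow> 'm set \<Rightarrow> ('m set \<Rightarrow>\<^sub>0 'k)" where
  "rel_comp C \<delta> x y z r s =
     (let m = sub_rep r; n = sub_rep s;
          f = pr2 C x y \<cdot>\<^bsub>C\<^esub> m; g = pr1 C y z \<cdot>\<^bsub>C\<^esub> n
      in if has_pullback C f g
         then let (p, q) = (SOME (p, q). is_pullback C f g p q);
                  h = pair C (pr1 C x y \<cdot>\<^bsub>C\<^esub> m \<cdot>\<^bsub>C\<^esub> p) (pr2 C y z \<cdot>\<^bsub>C\<^esub> n \<cdot>\<^bsub>C\<^esub> q);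
                  (e, k) = (SOME (e, k). is_factorization C h e k)
              in Poly_Mapping.single (sub_class C k) (\<delta> e)
         else 0)"

text \<open>\<open>r \<times> r'\<close> for \<open>r \<subseteq> x \<times> y\<close> and \<open>r' \<subseteq> x' \<times> y'\<close>, as a relation between \<open>x \<times> x'\<close> and \<open>y \<times> y'\<close>.\<close>

definition rel_times ::
  "('o, 'm, 'x) cat_scheme \<Rightarrow> 'o \<Rightarrow> 'o \<Rightarrow> 'o \<Rightarrow> 'o \<Rightarrow> 'm set \<Rightarrow> 'm set \<Rightarrow> 'm set" where
  "rel_times C x y x' y' r r' =
     (let m = sub_rep r; m' = sub_rep r';
          p = pr1 C (Dom C m) (Dom C m'); p' = pr2 C (Dom C m) (Dom C m')
      in sub_class C
           (pair C (pair C (pr1 C x y \<cdot>\<^bsub>C\<^esub> m \<cdot>\<^bsub>C\<^esub> p) (pr1 C x' y' \<cdot>\<^bsub>C\<^esub> m' \<cdot>\<^bsub>C\<^esub> p'))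
                   (pair C (pr2 C x y \<cdot>\<^bsub>C\<^esub> m \<cdot>\<^bsub>C\<^esub> p) (pr2 C x' y' \<cdot>\<^bsub>C\<^esub> m' \<cdot>\<^bsub>C\<^esub> p'))))"

definition graph_ar :: "('o, 'm, 'x) cat_scheme \<Rightarrow> 'm \<Rightarrow> ('o, 'm, 'k::zero_neq_one) rel_ar" where
  "graph_ar C f = bracket (Dom C f) (Cod C f) (graph C f)"

text \<open>The object \<open>[x]\<close> is \<open>x\<close> itself. The structural isomorphisms are the graphs of those of the
  cartesian structure of \<open>C\<close>. The monoidal fields are meaningful only if \<open>C\<close> has binary products.\<close>

definition T0 ::
  "('o, 'm, 'x) cat_scheme \<Rightarrow> ('m \<Rightarrow> 'k::field) \<Rightarrow> ('o, ('o, 'm, 'k) rel_ar) smcat" where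
  "T0 C \<delta> = \<lparr>
     Ob = Ob C,
     Ar = {(x, y, c) |x y c. x \<in> Ob C \<and> y \<in> Ob C \<and> Poly_Mapping.keys c \<subseteq> relations C x y},
     Dom = src,
     Cod = tgt,
     Idn = (\<lambda>x. graph_ar C (Idn C x)),
     Comp = (\<lambda>g f. (src f, tgt g,
               bilin (rel_comp C \<delta> (src f) (tgt f) (tgt g)) (coeffs f) (coeffs g))),
     TensOb = prod_ob C,
     TensAr = (\<lambda>f g. (prod_ob C (src f) (src g), prod_ob C (tgt f) (tgt g),
               bilin (\<lambda>r s. Poly_Mapping.single
                          (rel_times C (src f) (tgt f) (src g) (tgt g) r s) 1)
                 (coeffs f) (coeffs g))),
     UnitOb = one_ob C,
     Assoc = (\<lambda>x y z. let w = prod_ob C x y;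
                          a = pr1 C x y \<cdot>\<^bsub>C\<^esub> pr1 C w z;
                          b = pr2 C x y \<cdot>\<^bsub>C\<^esub> pr1 C w z;
                          c = pr2 C w z
                      in graph_ar C (pair C a (pair C b c))),
     LUnit = (\<lambda>x. graph_ar C (pr2 C (one_ob C) x)),
     RUnit = (\<lambda>x. graph_ar C (pr1 C x (one_ob C))),
     Braid = (\<lambda>x y. graph_ar C (pair C (pr2 C x y) (pr1 C x y)))\<rparr>"

definition Gamma_ftor ::
  "('o, 'm, 'x) cat_scheme \<Rightarrow> ('o, 'm, 'o, ('o, 'm, 'k::zero_neq_one) rel_ar) ftor" where
  "Gamma_ftor C = \<lparr>FOb = (\<lambda>x. x), FAr = graph_ar C\<rparr>"

definition linear_on_homs ::
  "('o, 'm, 'x) cat_scheme \<Rightarrow> ('m \<Rightarrow> 'k::field) \<Rightarrow>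
   ('o, ('o, 'm, 'k) rel_ar, 'p, ('p, 'n, 'k) rel_ar) ftor \<Rightarrow> bool" where
  "linear_on_homs C \<delta> G \<longleftrightarrow>
     (\<forall>x\<in>Ob C. \<forall>y\<in>Ob C. \<forall>a b. \<forall>f \<in> hom (T0 C \<delta>) x y. \<forall>g \<in> hom (T0 C \<delta>) x y.
        coeffs (FAr G (x, y, scale a (coeffs f) + scale b (coeffs g))) =
        scale a (coeffs (FAr G f)) + scale b (coeffs (FAr G g)))"

end

theory Submission
  imports Defs
begin

text \<open>A relation between \<open>x\<close> and \<open>y\<close> is the class of a jointly monic span \<open>x \<leftarrow> w \<rightarrow> y\<close>. In terms of
  spans the product \<open>x \<times> y\<close> disappears: the composite of two relations is obtained from any pullback
  and any epi-mono factorization of the resulting span, and \<open>F\<close> acts by \<open>(a, b) \<mapsto> (F a, F b)\<close>. The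
  latter is again jointly monic because \<open>x \<times> y\<close> is a pullback over the terminal object, so that the
  comparison \<open>F (x \<times> y) \<rightarrow> F x \<times> F y\<close> is monic. Since \<open>F\<close> preserves pullbacks, factorizations and
  degrees, it is compatible with composition. If \<open>F\<close> preserves the terminal object, the comparison is
  invertible and the graph of its inverse is the monoidal structure; its coherence conditions live
  in \<open>A'\<close>, because composition and tensor product of graphs are computed on arrows.\<close>

section \<open>Linear extension\<close>

text \<open>Composition and tensor product rest on choices: representatives of subobjects, products,
  pullbacks, factorizations. \<open>F\<close> need not respect any of them, so the two sides of an
  equation cannot be compared directly. Each choice is first shown to matter only up to an
  isomorphism, which relations and degrees do not see.

  A second obstacle is that \<open>A\<close> need not have binary products. Regularity supplies a
  pullback as soon as some square completes the cospan; over the terminal object every span does so.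
  Hence the product of the two ends of a span exists, which is all that relations ask for, and in
  the same way a cone forces the construction of a limit to go through.

  Vanishing composites need an argument of their own: where no pullback exists in \<open>A\<close>,
  none may exist in \<open>A'\<close>, and this is what reflection of the existence of pullbacks
  provides.

  The monoidal part needs no general calculus of relations. All structure arrows are graphs, and
  composing with the graph of an isomorphism just adds it to, or removes it from, one leg of a
  span.\<close>

lemma lookup_scale [simp]: "Poly_Mapping.lookup (scale a c) k = a * Poly_Mapping.lookup c k"
  by (simp add: scale_def Poly_Mapping.map.rep_eq when_def)

lemma scale_simps [simp]:
  "scale 1 c = c" "scale 0 c = 0" "scale a 0 = 0" "scale a (scale b c) = scale (a * b) c"
  "scale a (Poly_Mapping.single r b) = Poly_Mapping.single r (a * b)"
  by (auto intro!: poly_mapping_eqI simp: lookup_single when_def)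

lemma scale_add: "scale a (c + d) = scale a c + scale a d"
  "scale (a + b) c = scale a c + scale b c"
  by (auto intro!: poly_mapping_eqI simp: lookup_add algebra_simps)

lemma scale_sum: "scale a (sum f S) = (\<Sum>i\<in>S. scale a (f i))"
  by (induction S rule: infinite_finite_induct) (auto simp: scale_add)

definition lin_ext :: "('a \<Rightarrow> ('b \<Rightarrow>\<^sub>0 'k)) \<Rightarrow> ('a \<Rightarrow>\<^sub>0 'k) \<Rightarrow> ('b \<Rightarrow>\<^sub>0 'k::field)" where
  "lin_ext f c = (\<Sum>r\<in>Poly_Mapping.keys c. scale (Poly_Mapping.lookup c r) (f r))"

text \<open>Supports shrink under cancellation and under scaling by 0. Summing over any finite
  superset adds only zero terms and lets sums over different supports be compared.\<close>

lemma lin_ext_superset: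
  assumes "finite S" "Poly_Mapping.keys c \<subseteq> S"
  shows "lin_ext f c = (\<Sum>r\<in>S. scale (Poly_Mapping.lookup c r) (f r))"
  unfolding lin_ext_def using assms by (intro sum.mono_neutral_left) (auto simp: in_keys_iff)

lemma lin_ext_add: "lin_ext f (c + d) = lin_ext f c + lin_ext f d"
proof -
  let ?S = "Poly_Mapping.keys c \<union> Poly_Mapping.keys d"
  have "Poly_Mapping.keys (c + d) \<subseteq> ?S" by (rule Poly_Mapping.keys_add)
  then show ?thesis
    by (simp add: lin_ext_superset[of ?S] lookup_add scale_add sum.distrib)
qed

lemma lin_ext_scale: "lin_ext f (scale a c) = scale a (lin_ext f c)"
proof -
  have "Poly_Mapping.keys (scale a c) \<subseteq> Poly_Mapping.keys c"
    by (auto simp: in_keys_iff)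
  then have "lin_ext f (scale a c) =
      (\<Sum>r\<in>Poly_Mapping.keys c. scale (Poly_Mapping.lookup (scale a c) r) (f r))"
    by (intro lin_ext_superset) auto
  then show ?thesis
    by (simp add: lin_ext_def scale_sum)
qed

lemma lin_ext_zero [simp]: "lin_ext f 0 = 0"
  by (simp add: lin_ext_def)

lemma lin_ext_sum: "lin_ext f (sum g S) = (\<Sum>i\<in>S. lin_ext f (g i))"
  by (induction S rule: infinite_finite_induct) (auto simp: lin_ext_add)

lemma lin_ext_single [simp]: "lin_ext f (Poly_Mapping.single r a) = scale a (f r)"
  by (cases "a = 0") (auto simp: lin_ext_def)

lemma lin_ext_lin_ext: "lin_ext g (lin_ext f c) = lin_ext (\<lambda>r. lin_ext g (f r)) c"
  by (simp add: lin_ext_def[of f] lin_ext_def[of "\<lambda>r. lin_ext g (f r)"] lin_ext_sum lin_ext_scale)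

lemma lin_ext_cong:
  "(\<And>r. r \<in> Poly_Mapping.keys c \<Longrightarrow> f r = g r) \<Longrightarrow> lin_ext f c = lin_ext g c"
  by (simp add: lin_ext_def)

text \<open>With \<open>bilin\<close> as two nested linear extensions, the rules for
  \<open>lin_ext\<close> serve composition and tensor product alike, and equations need only be
  checked on the relations in the supports.\<close>

lemma bilin_lin_ext: "bilin B c d = lin_ext (\<lambda>r. lin_ext (B r) d) c"
  by (simp add: bilin_def lin_ext_def scale_sum)

text \<open>\<open>g\<close> may identify basis elements whose coefficients then cancel, so only an
  inclusion holds. It keeps the image of an arrow supported on relations between the right
  objects.\<close>

lemma keys_lin_ext_single:
  "Poly_Mapping.keys (lin_ext (\<lambda>r. Poly_Mapping.single (g r) 1) c) \<subseteq> g ` Poly_Mapping.keys c"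
proof -
  have "Poly_Mapping.keys (\<Sum>r\<in>S. scale (a r) (Poly_Mapping.single (g r) 1)) \<subseteq> g ` S"
    for S and a :: "_ \<Rightarrow> 'k::field"
    using Poly_Mapping.keys_sum[of "\<lambda>r. scale (a r) (Poly_Mapping.single (g r) 1)" S]
    by (fastforce split: if_splits)
  then show ?thesis unfolding lin_ext_def .
qed

section \<open>Spans, pullbacks and products in a category\<close>

text \<open>Joint monicity stands for monicity of the arrow into the product and makes sense before
  any product is chosen, hence on both sides of \<open>F\<close>; \<open>mono_pair_iff\<close>
  connects the two notions.\<close>

definition jointly_mono :: "('o, 'm, 'x) cat_scheme \<Rightarrow> 'm \<Rightarrow> 'm \<Rightarrow> bool" where
  "jointly_mono C a b \<longleftrightarrow> a \<in> Ar C \<and> b \<in> Ar C \<and> Dom C a = Dom C b \<and>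
     (\<forall>f\<in>Ar C. \<forall>g\<in>Ar C. Dom C f = Dom C g \<and> Cod C f = Dom C a \<and> Cod C g = Dom C a \<and>
        a \<cdot>\<^bsub>C\<^esub> f = a \<cdot>\<^bsub>C\<^esub> g \<and> b \<cdot>\<^bsub>C\<^esub> f = b \<cdot>\<^bsub>C\<^esub> g \<longrightarrow> f = g)"

definition span_rel :: "('o, 'm, 'x) cat_scheme \<Rightarrow> 'm \<Rightarrow> 'm \<Rightarrow> 'm set" where
  "span_rel C a b = sub_class C (pair C a b)"

locale cat_loc =
  fixes C :: "('o, 'm, 'x) cat_scheme" (structure)
  assumes cat: "category C"
begin

lemma dom_ob [simp]: "f \<in> Ar C \<Longrightarrow> Dom C f \<in> Ob C"
  and cod_ob [simp]: "f \<in> Ar C \<Longrightarrow> Cod C f \<in> Ob C"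
  using cat unfolding category_def by blast+

lemma id_simps [simp]:
  assumes "x \<in> Ob C"
  shows "Idn C x \<in> Ar C" "Dom C (Idn C x) = x" "Cod C (Idn C x) = x"
  using cat assms unfolding category_def hom_def by blast+

lemma comp_simps [simp]:
  assumes "f \<in> Ar C" "g \<in> Ar C" "Cod C f = Dom C g"
  shows "g \<cdot> f \<in> Ar C" "Dom C (g \<cdot> f) = Dom C f" "Cod C (g \<cdot> f) = Cod C g"
  using cat assms unfolding category_def hom_def by blast+

lemma comp_id [simp]: "f \<in> Ar C \<Longrightarrow> Dom C f = x \<Longrightarrow> f \<cdot> Idn C x = f"
  and id_comp [simp]: "f \<in> Ar C \<Longrightarrow> Cod C f = x \<Longrightarrow> Idn C x \<cdot> f = f"
  using cat unfolding category_def by blast+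

lemma comp_assoc [simp]:
  "\<lbrakk>f \<in> Ar C; g \<in> Ar C; h \<in> Ar C; Cod C f = Dom C g; Cod C g = Dom C h\<rbrakk>
   \<Longrightarrow> (h \<cdot> g) \<cdot> f = h \<cdot> (g \<cdot> f)"
  using cat unfolding category_def by metis

text \<open>\<open>comp_assoc\<close> nests composites to the right, where a known composite
  \<open>u \<cdot> v\<close> no longer occurs as a subterm. This form applies such an equation in
  front of a further arrow.\<close>

lemma comp_eq_comp:
  assumes "u \<cdot> v = w" "u \<in> Ar C" "v \<in> Ar C" "h \<in> Ar C" "Cod C v = Dom C u" "Cod C h = Dom C v"
  shows "u \<cdot> (v \<cdot> h) = w \<cdot> h"
  using assms comp_assoc by metis

lemma isoE:
  assumes "iso_ar C f"
  obtains g where "f \<in> Ar C" "g \<in> Ar C" "Dom C g = Cod C f" "Cod C g = Dom C f"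
    "g \<cdot> f = Idn C (Dom C f)" "f \<cdot> g = Idn C (Cod C f)" "iso_ar C g"
  using assms unfolding iso_ar_def hom_def by fastforce

lemma isoI:
  "\<lbrakk>f \<in> Ar C; g \<in> Ar C; Dom C g = Cod C f; Cod C g = Dom C f;
    g \<cdot> f = Idn C (Dom C f); f \<cdot> g = Idn C (Cod C f)\<rbrakk> \<Longrightarrow> iso_ar C f"
  unfolding iso_ar_def hom_def by auto

lemma iso_in_Ar: "iso_ar C f \<Longrightarrow> f \<in> Ar C"
  by (simp add: iso_ar_def)

lemma iso_id: "x \<in> Ob C \<Longrightarrow> iso_ar C (Idn C x)"
  by (rule isoI[where g = "Idn C x"]) auto

lemma iso_comp:
  assumes "iso_ar C f" "iso_ar C g" "Cod C f = Dom C g"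
  shows "iso_ar C (g \<cdot> f)"
proof -
  from assms(1) obtain f' where f': "f \<in> Ar C" "f' \<in> Ar C" "Dom C f' = Cod C f"
    "Cod C f' = Dom C f" "f' \<cdot> f = Idn C (Dom C f)" "f \<cdot> f' = Idn C (Cod C f)"
    by (rule isoE)
  from assms(2) obtain g' where g': "g \<in> Ar C" "g' \<in> Ar C" "Dom C g' = Cod C g"
    "Cod C g' = Dom C g" "g' \<cdot> g = Idn C (Dom C g)" "g \<cdot> g' = Idn C (Cod C g)"
    by (rule isoE)
  show ?thesis
    by (rule isoI[where g = "f' \<cdot> g'"])
       (use f' g' assms(3) comp_eq_comp[OF g'(5)] comp_eq_comp[OF f'(6)] in simp_all)
qed

lemma monoD:
  "\<lbrakk>mono_ar C m; f \<in> Ar C; g \<in> Ar C; Dom C f = Dom C g; Cod C f = Dom C m; Cod C g = Dom C m;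
    m \<cdot> f = m \<cdot> g\<rbrakk> \<Longrightarrow> f = g"
  unfolding mono_ar_def by blast

lemma mono_in_Ar: "mono_ar C m \<Longrightarrow> m \<in> Ar C"
  by (simp add: mono_ar_def)

lemma epiD:
  "\<lbrakk>epi_ar C e; f \<in> Ar C; g \<in> Ar C; Cod C f = Cod C g; Dom C f = Cod C e; Dom C g = Cod C e;
    f \<cdot> e = g \<cdot> e\<rbrakk> \<Longrightarrow> f = g"
  unfolding epi_ar_def by blast

lemma epi_in_Ar: "epi_ar C e \<Longrightarrow> e \<in> Ar C"
  by (simp add: epi_ar_def)

lemma epi_comp:
  assumes "epi_ar C f" "epi_ar C g" "Cod C f = Dom C g"
  shows "epi_ar C (g \<cdot> f)"
  unfolding epi_ar_def
proof (intro conjI ballI impI)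
  show "g \<cdot> f \<in> Ar C" using assms by (simp add: epi_in_Ar)
  fix h k assume hk: "h \<in> Ar C" "k \<in> Ar C" and
    "Cod C h = Cod C k \<and> Dom C h = Cod C (g \<cdot> f) \<and> Dom C k = Cod C (g \<cdot> f) \<and> h \<cdot> (g \<cdot> f) = k \<cdot> (g \<cdot> f)"
  then have t: "Cod C h = Cod C k" "Dom C h = Cod C g" "Dom C k = Cod C g"
    and e: "h \<cdot> (g \<cdot> f) = k \<cdot> (g \<cdot> f)"
    using assms by (auto simp: epi_in_Ar)
  have "(h \<cdot> g) \<cdot> f = (k \<cdot> g) \<cdot> f"
    using e t hk assms by (simp add: epi_in_Ar)
  then show "h = k"
    using epiD[OF assms(1), of "h \<cdot> g" "k \<cdot> g"] epiD[OF assms(2), of h k] hk assms t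
    by (simp add: epi_in_Ar)
qed

lemma iso_mono:
  assumes "iso_ar C f" shows "mono_ar C f"
proof -
  from assms obtain f' where f': "f \<in> Ar C" "f' \<in> Ar C" "Dom C f' = Cod C f"
    "Cod C f' = Dom C f" "f' \<cdot> f = Idn C (Dom C f)" "f \<cdot> f' = Idn C (Cod C f)"
    by (rule isoE)
  show ?thesis unfolding mono_ar_def
    using f' comp_eq_comp[OF f'(5)] by (metis id_comp)
qed

lemma iso_epi:
  assumes "iso_ar C f" shows "epi_ar C f"
proof -
  from assms obtain f' where f': "f \<in> Ar C" "f' \<in> Ar C" "Dom C f' = Cod C f"
    "Cod C f' = Dom C f" "f' \<cdot> f = Idn C (Dom C f)" "f \<cdot> f' = Idn C (Cod C f)"
    by (rule isoE)
  show ?thesis unfolding epi_ar_def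
    using f' comp_assoc[of f' f] by (metis comp_id)
qed

section \<open>Jointly monic pairs of arrows\<close>

lemma jointly_monoD:
  "\<lbrakk>jointly_mono C a b; f \<in> Ar C; g \<in> Ar C; Dom C f = Dom C g; Cod C f = Dom C a; Cod C g = Dom C a;
    a \<cdot> f = a \<cdot> g; b \<cdot> f = b \<cdot> g\<rbrakk> \<Longrightarrow> f = g"
  unfolding jointly_mono_def by blast

lemma jointly_mono_ar:
  assumes "jointly_mono C a b"
  shows "a \<in> Ar C" "b \<in> Ar C" "Dom C a = Dom C b"
  using assms unfolding jointly_mono_def by blast+

lemma jointly_monoI:
  assumes "a \<in> Ar C" "b \<in> Ar C" "Dom C a = Dom C b"
    and "\<And>f g. \<lbrakk>f \<in> Ar C; g \<in> Ar C; Dom C f = Dom C g; Cod C f = Dom C a; Cod C g = Dom C a;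
        a \<cdot> f = a \<cdot> g; b \<cdot> f = b \<cdot> g\<rbrakk> \<Longrightarrow> f = g"
  shows "jointly_mono C a b"
  using assms unfolding jointly_mono_def by blast

lemma jointly_mono_comp:
  assumes "jointly_mono C a b" "mono_ar C i" "Cod C i = Dom C a"
  shows "jointly_mono C (a \<cdot> i) (b \<cdot> i)"
proof (rule jointly_monoI)
  note [simp] = jointly_mono_ar[OF assms(1)] mono_in_Ar[OF assms(2)] assms(3)
  show "a \<cdot> i \<in> Ar C" "b \<cdot> i \<in> Ar C" "Dom C (a \<cdot> i) = Dom C (b \<cdot> i)" by auto
  fix f g assume [simp]: "f \<in> Ar C" "g \<in> Ar C" and d: "Dom C f = Dom C g" "Cod C f = Dom C (a \<cdot> i)"
    "Cod C g = Dom C (a \<cdot> i)" "(a \<cdot> i) \<cdot> f = (a \<cdot> i) \<cdot> g" "(b \<cdot> i) \<cdot> f = (b \<cdot> i) \<cdot> g"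
  then have "i \<cdot> f = i \<cdot> g"
    by - (rule jointly_monoD[OF assms(1)], auto)
  then show "f = g" using d by - (rule monoD[OF assms(2)], auto)
qed

lemma jointly_mono_mono_right:
  assumes "jointly_mono C a b" "mono_ar C f" "Dom C f = Cod C b"
  shows "jointly_mono C a (f \<cdot> b)"
proof (rule jointly_monoI)
  note [simp] = jointly_mono_ar[OF assms(1)] mono_in_Ar[OF assms(2)] assms(3)
  show "a \<in> Ar C" "f \<cdot> b \<in> Ar C" "Dom C a = Dom C (f \<cdot> b)" by auto
  fix h k assume [simp]: "h \<in> Ar C" "k \<in> Ar C" and d: "Dom C h = Dom C k" "Cod C h = Dom C a"
    "Cod C k = Dom C a" "a \<cdot> h = a \<cdot> k" "(f \<cdot> b) \<cdot> h = (f \<cdot> b) \<cdot> k"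
  then have "b \<cdot> h = b \<cdot> k" by - (rule monoD[OF assms(2)], auto)
  then show "h = k" using d by - (rule jointly_monoD[OF assms(1)], auto)
qed

lemma jointly_mono_mono_left:
  assumes "mono_ar C a" "b \<in> Ar C" "Dom C a = Dom C b"
  shows "jointly_mono C a b"
proof (rule jointly_monoI)
  fix f g assume "f \<in> Ar C" "g \<in> Ar C" "Dom C f = Dom C g" "Cod C f = Dom C a" "Cod C g = Dom C a"
    "a \<cdot> f = a \<cdot> g"
  then show "f = g" by - (rule monoD[OF assms(1)], auto)
qed (use assms mono_in_Ar in auto)

lemma jointly_mono_cancel_left:
  assumes "jointly_mono C (f \<cdot> u) b" "f \<in> Ar C" "u \<in> Ar C" "Cod C u = Dom C f"
  shows "jointly_mono C u b"
proof (rule jointly_monoI)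
  show "u \<in> Ar C" "b \<in> Ar C" "Dom C u = Dom C b"
    using jointly_mono_ar[OF assms(1)] assms by auto
  then show "h = k" if "h \<in> Ar C" "k \<in> Ar C" "Dom C h = Dom C k" "Cod C h = Dom C u"
    "Cod C k = Dom C u" "u \<cdot> h = u \<cdot> k" "b \<cdot> h = b \<cdot> k" for h k
    using that assms by - (rule jointly_monoD[OF assms(1)], auto)
qed

section \<open>Pullbacks\<close>

lemma pullback_comm:
  assumes "is_pullback C f g p q"
  shows "f \<in> Ar C" "g \<in> Ar C" "p \<in> Ar C" "q \<in> Ar C" "Cod C f = Cod C g" "Dom C p = Dom C q"
    "Cod C p = Dom C f" "Cod C q = Dom C g" "f \<cdot> p = g \<cdot> q"
  using assms unfolding is_pullback_def comm_square_def by blast+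

text \<open>Uniqueness of the mediating arrow is joint monicity of the projections, so existence
  alone remains to be shown for each competing square.\<close>

lemma pullbackI:
  assumes "f \<in> Ar C" "g \<in> Ar C" "p \<in> Ar C" "q \<in> Ar C" "Cod C f = Cod C g" "Dom C p = Dom C q"
    "Cod C p = Dom C f" "Cod C q = Dom C g" "f \<cdot> p = g \<cdot> q"
    and "jointly_mono C p q"
    and "\<And>a b. \<lbrakk>a \<in> Ar C; b \<in> Ar C; Dom C a = Dom C b; Cod C a = Dom C f; Cod C b = Dom C g;
        f \<cdot> a = g \<cdot> b\<rbrakk>
      \<Longrightarrow> \<exists>h. h \<in> Ar C \<and> Dom C h = Dom C a \<and> Cod C h = Dom C p \<and> p \<cdot> h = a \<and> q \<cdot> h = b"
  shows "is_pullback C f g p q"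
  unfolding is_pullback_def
proof (intro conjI allI impI)
  show "comm_square C f g p q" using assms unfolding comm_square_def by blast
  fix a b assume "comm_square C f g a b"
  then obtain h where h: "h \<in> Ar C" "Dom C h = Dom C a" "Cod C h = Dom C p" "p \<cdot> h = a" "q \<cdot> h = b"
    using assms(11)[of a b] unfolding comm_square_def by blast
  then show "\<exists>!h. h \<in> hom C (Dom C a) (Dom C p) \<and> p \<cdot> h = a \<and> q \<cdot> h = b"
    by (intro ex1I[of _ h]) (auto simp: hom_def, rule jointly_monoD[OF assms(10)], auto)
qed

lemma pullbackE:
  assumes "is_pullback C f g p q" "a \<in> Ar C" "b \<in> Ar C" "Dom C a = Dom C b" "Cod C a = Dom C f"
    "Cod C b = Dom C g" "f \<cdot> a = g \<cdot> b"
  obtains h where "h \<in> Ar C" "Dom C h = Dom C a" "Cod C h = Dom C p" "p \<cdot> h = a" "q \<cdot> h = b"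
proof -
  have "comm_square C f g a b"
    using assms pullback_comm[OF assms(1)] unfolding comm_square_def by blast
  then show thesis using assms(1) that unfolding is_pullback_def hom_def by blast
qed

lemma pullback_jointly_mono:
  assumes "is_pullback C f g p q" shows "jointly_mono C p q"
proof (rule jointly_monoI)
  note c[simp] = pullback_comm[OF assms]
  show "p \<in> Ar C" "q \<in> Ar C" "Dom C p = Dom C q" by auto
  fix h k assume hk: "h \<in> Ar C" "k \<in> Ar C" "Dom C h = Dom C k" "Cod C h = Dom C p"
    "Cod C k = Dom C p" "p \<cdot> h = p \<cdot> k" "q \<cdot> h = q \<cdot> k"
  have "f \<cdot> (p \<cdot> h) = g \<cdot> (q \<cdot> h)"
    using hk comp_eq_comp[OF c(9), of h] by simp
  then have "comm_square C f g (p \<cdot> h) (q \<cdot> h)"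
    unfolding comm_square_def using hk by simp
  then have "\<exists>!j. j \<in> hom C (Dom C (p \<cdot> h)) (Dom C p) \<and> p \<cdot> j = p \<cdot> h \<and> q \<cdot> j = q \<cdot> h"
    using assms unfolding is_pullback_def by blast
  moreover have "h \<in> hom C (Dom C (p \<cdot> h)) (Dom C p)" "k \<in> hom C (Dom C (p \<cdot> h)) (Dom C p)"
    using hk by (auto simp: hom_def)
  ultimately show "h = k" using hk by metis
qed

lemma jointly_mono_sym: "jointly_mono C a b \<Longrightarrow> jointly_mono C b a"
  unfolding jointly_mono_def by metis

lemma pullback_sym:
  assumes pb: "is_pullback C f g p q" shows "is_pullback C g f q p"
proof (rule pullbackI)
  note [simp] = pullback_comm[OF pb]
  show "jointly_mono C q p"
    by (rule jointly_mono_sym[OF pullback_jointly_mono[OF pb]])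
  fix a b assume "a \<in> Ar C" "b \<in> Ar C" "Dom C a = Dom C b" "Cod C a = Dom C g" "Cod C b = Dom C f"
    "g \<cdot> a = f \<cdot> b"
  then obtain h where "h \<in> Ar C" "Dom C h = Dom C b" "Cod C h = Dom C p" "p \<cdot> h = b" "q \<cdot> h = a"
    by - (rule pullbackE[OF pb, of b a], auto)
  then show "\<exists>h. h \<in> Ar C \<and> Dom C h = Dom C a \<and> Cod C h = Dom C q \<and> q \<cdot> h = a \<and> p \<cdot> h = b"
    using \<open>Dom C a = Dom C b\<close> by (intro exI[of _ h]) auto
qed (use pullback_comm[OF pb] in auto)

lemma pullback_iso_apex:
  assumes "is_pullback C f g p q" "is_pullback C f g p' q'"
  obtains t where "iso_ar C t" "Dom C t = Dom C p'" "Cod C t = Dom C p" "p \<cdot> t = p'" "q \<cdot> t = q'"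
proof -
  note [simp] = pullback_comm[OF assms(1)] pullback_comm[OF assms(2)]
  obtain t where t: "t \<in> Ar C" "Dom C t = Dom C p'" "Cod C t = Dom C p" "p \<cdot> t = p'" "q \<cdot> t = q'"
    by (rule pullbackE[OF assms(1), of p' q']) auto
  obtain s where s: "s \<in> Ar C" "Dom C s = Dom C p" "Cod C s = Dom C p'" "p' \<cdot> s = p" "q' \<cdot> s = q"
    by (rule pullbackE[OF assms(2), of p q]) auto
  have "s \<cdot> t = Idn C (Dom C p')"
    by (rule jointly_monoD[OF pullback_jointly_mono[OF assms(2)]])
       (use t s comp_eq_comp[OF s(4)] comp_eq_comp[OF s(5)] in simp_all)
  moreover have "t \<cdot> s = Idn C (Dom C p)"
    by (rule jointly_monoD[OF pullback_jointly_mono[OF assms(1)]])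
       (use t s comp_eq_comp[OF t(4)] comp_eq_comp[OF t(5)] in simp_all)
  ultimately have "iso_ar C t" using t s by (intro isoI[where g = s]) auto
  then show thesis using that t by blast
qed

text \<open>\<open>sub_rep\<close> returns a representative that differs from a given span by an
  isomorphism of the apex. Absorbing such isomorphisms \<open>i\<close> and \<open>j\<close> into
  the projections turns a pullback of the chosen legs into one of the given legs.\<close>

lemma pullback_iso_legs:
  assumes "iso_ar C i" "iso_ar C j" "Cod C i = Dom C f" "Cod C j = Dom C g" "f \<in> Ar C" "g \<in> Ar C"
    and pb: "is_pullback C (f \<cdot> i) (g \<cdot> j) p q"
  shows "is_pullback C f g (i \<cdot> p) (j \<cdot> q)"
proof -
  have [simp]: "i \<in> Ar C" "j \<in> Ar C" using assms iso_in_Ar by auto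
  note c = pullback_comm[OF pb]
  note [simp] = assms(3-6)
  obtain i' where i': "i' \<in> Ar C" "Dom C i' = Cod C i"
    "Cod C i' = Dom C i" "i \<cdot> i' = Idn C (Cod C i)"
    using assms(1) by (rule isoE)
  obtain j' where j': "j' \<in> Ar C" "Dom C j' = Cod C j"
    "Cod C j' = Dom C j" "j \<cdot> j' = Idn C (Cod C j)"
    using assms(2) by (rule isoE)
  show ?thesis
  proof (rule pullbackI)
    show "jointly_mono C (i \<cdot> p) (j \<cdot> q)"
    proof (rule jointly_monoI)
      fix h k assume hk: "h \<in> Ar C" "k \<in> Ar C" "Dom C h = Dom C k" "Cod C h = Dom C (i \<cdot> p)"
        "Cod C k = Dom C (i \<cdot> p)" "(i \<cdot> p) \<cdot> h = (i \<cdot> p) \<cdot> k" "(j \<cdot> q) \<cdot> h = (j \<cdot> q) \<cdot> k"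
      have "p \<cdot> h = p \<cdot> k" "q \<cdot> h = q \<cdot> k"
        using monoD[OF iso_mono[OF assms(1)], of "p \<cdot> h" "p \<cdot> k"]
          monoD[OF iso_mono[OF assms(2)], of "q \<cdot> h" "q \<cdot> k"] hk c by simp_all
      then show "h = k" using hk c by - (rule jointly_monoD[OF pullback_jointly_mono[OF pb]], auto)
    qed (use c in auto)
    fix a b assume ab: "a \<in> Ar C" "b \<in> Ar C" "Dom C a = Dom C b" "Cod C a = Dom C f"
      "Cod C b = Dom C g" "f \<cdot> a = g \<cdot> b"
    obtain h where h: "h \<in> Ar C" "Dom C h = Dom C (i' \<cdot> a)" "Cod C h = Dom C p"
      "p \<cdot> h = i' \<cdot> a" "q \<cdot> h = j' \<cdot> b"
      by (rule pullbackE[OF pb, of "i' \<cdot> a" "j' \<cdot> b"])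
         (use ab c i' j' comp_eq_comp[OF i'(4)] comp_eq_comp[OF j'(4)] in simp_all)
    show "\<exists>h. h \<in> Ar C \<and> Dom C h = Dom C a \<and> Cod C h = Dom C (i \<cdot> p) \<and> (i \<cdot> p) \<cdot> h = a \<and> (j \<cdot> q) \<cdot> h = b"
      by (rule exI[of _ h])
         (use h c ab i' j' comp_eq_comp[OF i'(4)] comp_eq_comp[OF j'(4)] in simp)
  qed (use c in auto)
qed

lemma has_pullback_iso_legs:
  assumes "iso_ar C i" "iso_ar C j" "Cod C i = Dom C f" "Cod C j = Dom C g" "f \<in> Ar C" "g \<in> Ar C"
  shows "has_pullback C (f \<cdot> i) (g \<cdot> j) \<longleftrightarrow> has_pullback C f g"
proof
  assume "has_pullback C (f \<cdot> i) (g \<cdot> j)"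
  then show "has_pullback C f g"
    using pullback_iso_legs[OF assms] unfolding has_pullback_def by blast
next
  assume "has_pullback C f g"
  then obtain p q where pq: "is_pullback C f g p q" unfolding has_pullback_def by blast
  note [simp] = assms(3-6) iso_in_Ar[OF assms(1)] iso_in_Ar[OF assms(2)]
  obtain i' where i': "i' \<in> Ar C" "Dom C i' = Cod C i"
    "Cod C i' = Dom C i" "i \<cdot> i' = Idn C (Cod C i)" "iso_ar C i'"
    using assms(1) by (rule isoE)
  obtain j' where j': "j' \<in> Ar C" "Dom C j' = Cod C j"
    "Cod C j' = Dom C j" "j \<cdot> j' = Idn C (Cod C j)" "iso_ar C j'"
    using assms(2) by (rule isoE)
  \<comment> \<open>For the converse, \<open>pullback_iso_legs\<close> is applied to the legs
    \<open>f \<cdot> i\<close> and \<open>g \<cdot> j\<close> with the inverse isomorphisms.\<close>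
  have "f = (f \<cdot> i) \<cdot> i'" "g = (g \<cdot> j) \<cdot> j'"
    using i' j' by simp_all
  then have "is_pullback C ((f \<cdot> i) \<cdot> i') ((g \<cdot> j) \<cdot> j') p q"
    using pq by simp
  then show "has_pullback C (f \<cdot> i) (g \<cdot> j)"
    unfolding has_pullback_def
    using pullback_iso_legs[of i' j' "f \<cdot> i" "g \<cdot> j" p q] i' j' by auto
qed

text \<open>A competitor \<open>(a, b)\<close> satisfies
  \<open>f \<cdot> a = f \<cdot> (u \<cdot> b)\<close>; cancelling \<open>f\<close> gives
  \<open>a = u \<cdot> b\<close>, so \<open>b\<close> itself mediates. The square computes
  composition with a graph on the left; for \<open>u\<close> an identity it is the trivial kernel
  pair of a monomorphism.\<close>

lemma pullback_along_mono:
  assumes "mono_ar C f" "u \<in> Ar C" "Cod C u = Dom C f"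
  shows "is_pullback C f (f \<cdot> u) u (Idn C (Dom C u))"
proof (rule pullbackI)
  note [simp] = mono_in_Ar[OF assms(1)] assms(2,3)
  show "jointly_mono C u (Idn C (Dom C u))"
    by (rule jointly_monoI) auto
  fix a b assume ab: "a \<in> Ar C" "b \<in> Ar C" "Dom C a = Dom C b" "Cod C a = Dom C f"
    "Cod C b = Dom C (f \<cdot> u)" "f \<cdot> a = (f \<cdot> u) \<cdot> b"
  have "a = u \<cdot> b" by (rule monoD[OF assms(1)]) (use ab in auto)
  then show "\<exists>h. h \<in> Ar C \<and> Dom C h = Dom C a \<and> Cod C h = Dom C u \<and> u \<cdot> h = a
      \<and> Idn C (Dom C u) \<cdot> h = b"
    using ab by (intro exI[of _ b]) auto
qed (use assms mono_in_Ar in auto)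

text \<open>Expressed by a pullback square, monicity becomes visible to a functor that is known to
  preserve pullbacks.\<close>

lemma mono_iff_pullback:
  assumes "m \<in> Ar C"
  shows "mono_ar C m \<longleftrightarrow> is_pullback C m m (Idn C (Dom C m)) (Idn C (Dom C m))"
proof
  assume "mono_ar C m"
  then show "is_pullback C m m (Idn C (Dom C m)) (Idn C (Dom C m))"
    using pullback_along_mono[of m "Idn C (Dom C m)"] assms by simp
next
  assume pb: "is_pullback C m m (Idn C (Dom C m)) (Idn C (Dom C m))"
  show "mono_ar C m" unfolding mono_ar_def
  proof (intro conjI ballI impI)
    fix f g assume fg: "f \<in> Ar C" "g \<in> Ar C"
      "Dom C f = Dom C g \<and> Cod C f = Dom C m \<and> Cod C g = Dom C m \<and> m \<cdot> f = m \<cdot> g"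
    show "f = g"
      by (rule pullbackE[OF pb, of f g]) (use fg assms in auto)
  qed (fact assms)
qed

lemma pullback_along_id:
  assumes "b \<in> Ar C"
  shows "is_pullback C b (Idn C (Cod C b)) (Idn C (Dom C b)) b"
  using pullback_sym[OF pullback_along_mono[of "Idn C (Cod C b)" b]] assms
  by (simp add: iso_mono iso_id)

section \<open>Terminal objects and binary products\<close>

lemma terminal_arrow:
  assumes "terminal_ob C t" "x \<in> Ob C"
  obtains u where "u \<in> Ar C" "Dom C u = x" "Cod C u = t"
  using assms unfolding terminal_ob_def hom_def by blast

lemma terminal_unique:
  assumes "terminal_ob C t" "f \<in> Ar C" "g \<in> Ar C" "Cod C f = t" "Cod C g = t" "Dom C f = Dom C g"
  shows "f = g"
proof -
  have "\<exists>!h. h \<in> hom C (Dom C f) t"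
    using assms(1,2) unfolding terminal_ob_def by simp
  moreover have "f \<in> hom C (Dom C f) t" "g \<in> hom C (Dom C f) t"
    using assms by (auto simp: hom_def)
  ultimately show ?thesis by blast
qed

text \<open>Over a terminal object every square commutes, so the two universal properties become the
  same formula. Products thus inherit existence from the regularity axioms and good behaviour under
  \<open>F\<close> from pullbacks.\<close>

lemma product_iff_pullback:
  assumes "terminal_ob C t" "u \<in> Ar C" "v \<in> Ar C" "Cod C u = t" "Cod C v = t"
  shows "is_product C (Dom C u) (Dom C v) p q \<longleftrightarrow> is_pullback C u v p q"
proof -
  have *: "comm_square C u v p q \<longleftrightarrow>
     p \<in> Ar C \<and> q \<in> Ar C \<and> Dom C p = Dom C q \<and> Cod C p = Dom C u \<and> Cod C q = Dom C v" for p q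
    unfolding comm_square_def using assms terminal_unique[OF assms(1), of "u \<cdot> p" "v \<cdot> q"] by auto
  show ?thesis
    unfolding is_product_def is_pullback_def * Ball_def
    by (simp only: imp_conjL imp_conjR conj_assoc all_simps)
qed

lemma product_jointly_mono:
  assumes "is_product C x y p q" shows "jointly_mono C p q"
proof (rule jointly_monoI)
  note c = assms[unfolded is_product_def]
  show "p \<in> Ar C" "q \<in> Ar C" "Dom C p = Dom C q" using c by auto
  fix h k assume hk: "h \<in> Ar C" "k \<in> Ar C" "Dom C h = Dom C k" "Cod C h = Dom C p"
    "Cod C k = Dom C p" "p \<cdot> h = p \<cdot> k" "q \<cdot> h = q \<cdot> k"
  have "\<exists>!j. j \<in> hom C (Dom C (p \<cdot> h)) (Dom C p) \<and> p \<cdot> j = p \<cdot> h \<and> q \<cdot> j = q \<cdot> h"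
  proof -
    have "p \<cdot> h \<in> Ar C" "q \<cdot> h \<in> Ar C" "Dom C (p \<cdot> h) = Dom C (q \<cdot> h)" "Cod C (p \<cdot> h) = x"
      "Cod C (q \<cdot> h) = y"
      using c hk by auto
    then show ?thesis using c by blast
  qed
  moreover have "h \<in> hom C (Dom C (p \<cdot> h)) (Dom C p)" "k \<in> hom C (Dom C (p \<cdot> h)) (Dom C p)"
    using hk c by (auto simp: hom_def)
  ultimately show "h = k" using hk by metis
qed

lemma productE:
  assumes "is_product C x y p q" "a \<in> Ar C" "b \<in> Ar C" "Dom C a = Dom C b" "Cod C a = x" "Cod C b = y"
  obtains h where "h \<in> Ar C" "Dom C h = Dom C a" "Cod C h = Dom C p" "p \<cdot> h = a" "q \<cdot> h = b"
  using assms unfolding is_product_def hom_def by blast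

lemma product_ar:
  assumes "is_product C x y p q"
  shows "p \<in> Ar C" "q \<in> Ar C" "Dom C p = Dom C q" "Cod C p = x" "Cod C q = y"
  using assms unfolding is_product_def by blast+

lemma productI:
  assumes "jointly_mono C p q"
    and "\<And>a b. \<lbrakk>a \<in> Ar C; b \<in> Ar C; Dom C a = Dom C b; Cod C a = Cod C p; Cod C b = Cod C q\<rbrakk>
      \<Longrightarrow> \<exists>h. h \<in> Ar C \<and> Dom C h = Dom C a \<and> Cod C h = Dom C p \<and> p \<cdot> h = a \<and> q \<cdot> h = b"
  shows "is_product C (Cod C p) (Cod C q) p q"
  unfolding is_product_def
proof (intro conjI ballI impI)
  show "p \<in> Ar C" "q \<in> Ar C" "Dom C p = Dom C q" "Cod C p = Cod C p" "Cod C q = Cod C q"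
    using jointly_mono_ar[OF assms(1)] by auto
  fix a b assume ab: "a \<in> Ar C" "b \<in> Ar C" "Dom C a = Dom C b \<and> Cod C a = Cod C p \<and> Cod C b = Cod C q"
  then obtain h where h: "h \<in> Ar C" "Dom C h = Dom C a" "Cod C h = Dom C p" "p \<cdot> h = a" "q \<cdot> h = b"
    using assms(2)[of a b] by blast
  then show "\<exists>!h. h \<in> hom C (Dom C a) (Dom C p) \<and> p \<cdot> h = a \<and> q \<cdot> h = b"
    by (intro ex1I[of _ h]) (auto simp: hom_def, rule jointly_monoD[OF assms(1)], auto)
qed

lemma product_iso_apex:
  assumes "is_product C x y p q" "is_product C x y p' q'"
  obtains t where "iso_ar C t" "Dom C t = Dom C p'" "Cod C t = Dom C p" "p \<cdot> t = p'" "q \<cdot> t = q'"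
proof -
  note [simp] = product_ar[OF assms(1)] product_ar[OF assms(2)]
  obtain t where t: "t \<in> Ar C" "Dom C t = Dom C p'" "Cod C t = Dom C p" "p \<cdot> t = p'" "q \<cdot> t = q'"
    by (rule productE[OF assms(1), of p' q']) auto
  obtain s where s: "s \<in> Ar C" "Dom C s = Dom C p" "Cod C s = Dom C p'" "p' \<cdot> s = p" "q' \<cdot> s = q"
    by (rule productE[OF assms(2), of p q]) auto
  have "s \<cdot> t = Idn C (Dom C p')"
    by (rule jointly_monoD[OF product_jointly_mono[OF assms(2)]])
       (use t s comp_eq_comp[OF s(4)] comp_eq_comp[OF s(5)] in simp_all)
  moreover have "t \<cdot> s = Idn C (Dom C p)"
    by (rule jointly_monoD[OF product_jointly_mono[OF assms(1)]])
       (use t s comp_eq_comp[OF t(4)] comp_eq_comp[OF t(5)] in simp_all)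
  ultimately have "iso_ar C t" using t s by (intro isoI[where g = s]) auto
  then show thesis using that t by blast
qed

text \<open>\<open>rel_times\<close> forms the product of the apexes of chosen representatives,
  which are only isomorphic to the apexes of the given spans; this bridges the gap.\<close>

lemma product_iso_factors:
  assumes "is_product C x y p q" "iso_ar C i" "iso_ar C j" "Dom C i = x" "Dom C j = y"
  shows "is_product C (Cod C i) (Cod C j) (i \<cdot> p) (j \<cdot> q)"
proof -
  note [simp] = product_ar[OF assms(1)] iso_in_Ar[OF assms(2)] iso_in_Ar[OF assms(3)] assms(4,5)
  obtain i' where i': "i' \<in> Ar C" "Dom C i' = Cod C i"
    "Cod C i' = Dom C i" "i \<cdot> i' = Idn C (Cod C i)"
    using assms(2) by (rule isoE)
  obtain j' where j': "j' \<in> Ar C" "Dom C j' = Cod C j"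
    "Cod C j' = Dom C j" "j \<cdot> j' = Idn C (Cod C j)"
    using assms(3) by (rule isoE)
  have "is_product C (Cod C (i \<cdot> p)) (Cod C (j \<cdot> q)) (i \<cdot> p) (j \<cdot> q)"
  proof (rule productI)
    show "jointly_mono C (i \<cdot> p) (j \<cdot> q)"
    proof (rule jointly_monoI)
      fix h k assume hk: "h \<in> Ar C" "k \<in> Ar C" "Dom C h = Dom C k" "Cod C h = Dom C (i \<cdot> p)"
        "Cod C k = Dom C (i \<cdot> p)" "(i \<cdot> p) \<cdot> h = (i \<cdot> p) \<cdot> k" "(j \<cdot> q) \<cdot> h = (j \<cdot> q) \<cdot> k"
      have "p \<cdot> h = p \<cdot> k" "q \<cdot> h = q \<cdot> k"
        using monoD[OF iso_mono[OF assms(2)], of "p \<cdot> h" "p \<cdot> k"]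
          monoD[OF iso_mono[OF assms(3)], of "q \<cdot> h" "q \<cdot> k"] hk by simp_all
      then show "h = k" using hk by - (rule jointly_monoD[OF product_jointly_mono[OF assms(1)]], auto)
    qed auto
    fix a b assume ab: "a \<in> Ar C" "b \<in> Ar C" "Dom C a = Dom C b" "Cod C a = Cod C (i \<cdot> p)"
      "Cod C b = Cod C (j \<cdot> q)"
    obtain h where h: "h \<in> Ar C" "Dom C h = Dom C (i' \<cdot> a)" "Cod C h = Dom C p"
      "p \<cdot> h = i' \<cdot> a" "q \<cdot> h = j' \<cdot> b"
      by (rule productE[OF assms(1), of "i' \<cdot> a" "j' \<cdot> b"]) (use ab i' j' in auto)
    show "\<exists>h. h \<in> Ar C \<and> Dom C h = Dom C a \<and> Cod C h = Dom C (i \<cdot> p) \<and> (i \<cdot> p) \<cdot> h = a \<and> (j \<cdot> q) \<cdot> h = b"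
      by (rule exI[of _ h])
         (use h ab i' j' comp_eq_comp[OF i'(4)] comp_eq_comp[OF j'(4)] in simp)
  qed
  then show ?thesis by simp
qed

end

section \<open>Regular categories\<close>

locale regular_cat =
  fixes C :: "('o, 'm, 'x) cat_scheme" (structure)
  assumes regular: "regular_category C"
begin

sublocale cat_loc C
  using regular by unfold_locales (simp add: regular_category_def)

lemma terminal_one: "terminal_ob C (one_ob C)"
  using regular unfolding regular_category_def one_ob_def by (metis someI_ex)

lemma square_has_pullback:
  assumes "f \<in> Ar C" "g \<in> Ar C" "p \<in> Ar C" "q \<in> Ar C" "Cod C f = Cod C g" "Dom C p = Dom C q"
    "Cod C p = Dom C f" "Cod C q = Dom C g" "f \<cdot> p = g \<cdot> q"
  shows "has_pullback C f g"
  using regular assms unfolding regular_category_def comm_square_def by blast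

lemma factorization_exists:
  assumes "f \<in> Ar C"
  obtains e m where "epi_ar C e" "mono_ar C m" "Cod C e = Dom C m" "f = m \<cdot> e"
  using regular assms unfolding regular_category_def is_factorization_def by blast

text \<open>The axiom compares one distinguished factorization \<open>(e0, m0)\<close> with all
  others. Two arbitrary ones are compared through it, by inverting the comparison \<open>i\<close>
  with the first and following it by the comparison \<open>j\<close> with the second.\<close>

lemma factorization_unique:
  assumes "is_factorization C f e m" "is_factorization C f e' m'"
  obtains i where "iso_ar C i" "Dom C i = Dom C m" "Cod C i = Dom C m'" "i \<cdot> e = e'" "m' \<cdot> i = m"
proof -
  have ar: "e \<in> Ar C" "m \<in> Ar C" "Cod C e = Dom C m" "f = m \<cdot> e"
    "e' \<in> Ar C" "m' \<in> Ar C" "Cod C e' = Dom C m'"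
    using assms epi_in_Ar mono_in_Ar unfolding is_factorization_def by auto
  then have "f \<in> Ar C" by simp
  then have "\<exists>e0 m0. is_factorization C f e0 m0 \<and>
        (\<forall>e' m'. is_factorization C f e' m' \<longrightarrow>
           (\<exists>i. iso_ar C i \<and> i \<in> hom C (Dom C m0) (Dom C m') \<and> i \<cdot> e0 = e' \<and> m' \<cdot> i = m0))"
    using regular unfolding regular_category_def by blast
  then obtain e0 m0 where 0: "is_factorization C f e0 m0"
    and uniq: "\<And>e' m'. is_factorization C f e' m' \<Longrightarrow>
           \<exists>i. iso_ar C i \<and> i \<in> hom C (Dom C m0) (Dom C m') \<and> i \<cdot> e0 = e' \<and> m' \<cdot> i = m0"
    by blast
  have 0: "e0 \<in> Ar C" "m0 \<in> Ar C" "Cod C e0 = Dom C m0"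
    using 0 epi_in_Ar mono_in_Ar unfolding is_factorization_def by auto
  obtain i where i: "iso_ar C i" "i \<in> hom C (Dom C m0) (Dom C m)" "i \<cdot> e0 = e" "m \<cdot> i = m0"
    using uniq[OF assms(1)] by blast
  obtain j where j: "iso_ar C j" "j \<in> hom C (Dom C m0) (Dom C m')" "j \<cdot> e0 = e'" "m' \<cdot> j = m0"
    using uniq[OF assms(2)] by blast
  have ij: "i \<in> Ar C" "Dom C i = Dom C m0" "Cod C i = Dom C m" "j \<in> Ar C" "Dom C j = Dom C m0"
    "Cod C j = Dom C m'"
    using i j by (auto simp: hom_def)
  obtain i' where i': "i' \<in> Ar C" "Dom C i' = Cod C i" "Cod C i' = Dom C i"
    "i' \<cdot> i = Idn C (Dom C i)" "i \<cdot> i' = Idn C (Cod C i)" "iso_ar C i'"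
    using i(1) by (rule isoE)
  show thesis
  proof (rule that)
    show "iso_ar C (j \<cdot> i')" using i' ij j by (intro iso_comp) auto
    show "Dom C (j \<cdot> i') = Dom C m" "Cod C (j \<cdot> i') = Dom C m'" using i' ij by auto
    have "i' \<cdot> e = e0" using comp_eq_comp[OF i'(4), of e0] i i' ij 0 by simp
    then show "(j \<cdot> i') \<cdot> e = e'" using i' ij ar j by simp
    have "m0 \<cdot> i' = m" using comp_eq_comp[OF i(4), of i'] i' ij ar by simp
    then show "m' \<cdot> (j \<cdot> i') = m" using i' ij ar j comp_eq_comp[OF j(4), of i'] by simp
  qed
qed

section \<open>Chosen products and pairing\<close>

lemma product_pr: "has_product C x y \<Longrightarrow> is_product C x y (pr1 C x y) (pr2 C x y)"
  unfolding has_product_def pr1_def pr2_def projs_def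
  using someI_ex[of "\<lambda>pq. is_product C x y (fst pq) (snd pq)"] by auto

lemma pr_simps [simp]:
  assumes "has_product C x y"
  shows "pr1 C x y \<in> Ar C" "Dom C (pr1 C x y) = prod_ob C x y" "Cod C (pr1 C x y) = x"
    "pr2 C x y \<in> Ar C" "Dom C (pr2 C x y) = prod_ob C x y" "Cod C (pr2 C x y) = y"
    "prod_ob C x y \<in> Ob C"
  using product_ar[OF product_pr[OF assms]] dom_ob[of "pr1 C x y"] by (auto simp: prod_ob_def)

text \<open>The span completes the cospan of its ends over the terminal object to a commuting
  square, so regularity provides the pullback, which is the product.\<close>

lemma span_product:
  assumes "a \<in> Ar C" "b \<in> Ar C" "Dom C a = Dom C b" shows "has_product C (Cod C a) (Cod C b)"
proof -
  obtain u where u: "u \<in> Ar C" "Dom C u = Cod C a" "Cod C u = one_ob C"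
    using terminal_arrow[OF terminal_one] assms cod_ob by metis
  obtain v where v: "v \<in> Ar C" "Dom C v = Cod C b" "Cod C v = one_ob C"
    using terminal_arrow[OF terminal_one] assms cod_ob by metis
  have "has_pullback C u v"
    by (rule square_has_pullback[of u v a b])
       (use u v assms in \<open>auto intro: terminal_unique[OF terminal_one]\<close>)
  then show ?thesis
    unfolding has_pullback_def has_product_def
    using product_iff_pullback[OF terminal_one, of u v] u v by auto
qed

lemma span_product' [simp]:
  assumes "a \<in> Ar C" "b \<in> Ar C" "Dom C a = Dom C b" "Cod C a = x" "Cod C b = y"
  shows "has_product C x y"
  using span_product assms by auto

text \<open>The domain is rewritten to that of the second leg, in the same direction as in
  \<open>jointly_mono_ar\<close>, so that both can act together as simplification rules.\<close>

lemma pair_simps [simp]: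
  assumes "a \<in> Ar C" "b \<in> Ar C" "Dom C a = Dom C b"
  shows "pair C a b \<in> Ar C" "Dom C (pair C a b) = Dom C b"
    "Cod C (pair C a b) = prod_ob C (Cod C a) (Cod C b)"
    and "Cod C a = x \<Longrightarrow> Cod C b = y \<Longrightarrow> pr1 C x y \<cdot> pair C a b = a"
    and "Cod C a = x \<Longrightarrow> Cod C b = y \<Longrightarrow> pr2 C x y \<cdot> pair C a b = b"
proof -
  have "\<exists>!h. h \<in> hom C (Dom C a) (prod_ob C (Cod C a) (Cod C b)) \<and>
     pr1 C (Cod C a) (Cod C b) \<cdot> h = a \<and> pr2 C (Cod C a) (Cod C b) \<cdot> h = b"
    using product_pr[OF span_product[OF assms]] assms unfolding is_product_def prod_ob_def by auto
  from theI'[OF this, folded pair_def] show "pair C a b \<in> Ar C" "Dom C (pair C a b) = Dom C b"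
    "Cod C (pair C a b) = prod_ob C (Cod C a) (Cod C b)"
    "Cod C a = x \<Longrightarrow> Cod C b = y \<Longrightarrow> pr1 C x y \<cdot> pair C a b = a"
    "Cod C a = x \<Longrightarrow> Cod C b = y \<Longrightarrow> pr2 C x y \<cdot> pair C a b = b"
    using assms by (auto simp: hom_def)
qed

lemma pr_eqI:
  assumes "has_product C x y" "f \<in> Ar C" "g \<in> Ar C" "Dom C f = Dom C g" "Cod C f = prod_ob C x y"
    "Cod C g = prod_ob C x y" "pr1 C x y \<cdot> f = pr1 C x y \<cdot> g" "pr2 C x y \<cdot> f = pr2 C x y \<cdot> g"
  shows "f = g"
  by (rule jointly_monoD[OF product_jointly_mono[OF product_pr[OF assms(1)]]]) (use assms in auto)

lemma pair_eqI:
  assumes "a \<in> Ar C" "b \<in> Ar C" "Dom C a = Dom C b" "Cod C a = x" "Cod C b = y" "h \<in> Ar C"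
    "Dom C h = Dom C b" "Cod C h = prod_ob C x y" "pr1 C x y \<cdot> h = a" "pr2 C x y \<cdot> h = b"
  shows "pair C a b = h"
  by (rule pr_eqI[of x y]) (use assms in \<open>simp_all add: span_product'[of a b]\<close>)

lemma pair_comp [simp]:
  assumes "a \<in> Ar C" "b \<in> Ar C" "Dom C a = Dom C b" "h \<in> Ar C" "Cod C h = Dom C b"
  shows "pair C a b \<cdot> h = pair C (a \<cdot> h) (b \<cdot> h)"
proof -
  have "pr1 C (Cod C a) (Cod C b) \<cdot> (pair C a b \<cdot> h) = a \<cdot> h"
    by (rule comp_eq_comp) (use assms in \<open>simp_all add: span_product\<close>)
  moreover have "pr2 C (Cod C a) (Cod C b) \<cdot> (pair C a b \<cdot> h) = b \<cdot> h"
    by (rule comp_eq_comp) (use assms in \<open>simp_all add: span_product\<close>)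
  ultimately show ?thesis
    using assms by (intro pair_eqI[symmetric]) auto
qed

lemma pair_eta:
  assumes "has_product C x y" "m \<in> Ar C" "Cod C m = prod_ob C x y"
  shows "pair C (pr1 C x y \<cdot> m) (pr2 C x y \<cdot> m) = m"
  using assms by (intro pair_eqI) auto

lemma pair_pr [simp]:
  assumes "has_product C x y"
  shows "pair C (pr1 C x y) (pr2 C x y) = Idn C (prod_ob C x y)"
  using assms by (intro pair_eqI) auto

text \<open>Arrows into a product are separated by the two projections, so cancelling the pairing
  amounts to cancelling both legs at once.\<close>

lemma mono_pair_iff:
  assumes "a \<in> Ar C" "b \<in> Ar C" "Dom C a = Dom C b"
  shows "mono_ar C (pair C a b) \<longleftrightarrow> jointly_mono C a b"
proof
  assume m: "mono_ar C (pair C a b)"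
  show "jointly_mono C a b"
    by (rule jointly_monoI, use assms in simp_all, rule monoD[OF m]) (use assms in simp_all)
next
  assume j: "jointly_mono C a b"
  show "mono_ar C (pair C a b)" unfolding mono_ar_def
  proof (intro conjI ballI impI)
    fix f g assume [simp]: "f \<in> Ar C" "g \<in> Ar C"
      and "Dom C f = Dom C g \<and> Cod C f = Dom C (pair C a b) \<and> Cod C g = Dom C (pair C a b)
        \<and> pair C a b \<cdot> f = pair C a b \<cdot> g"
    then have [simp]: "Dom C f = Dom C g" "Cod C f = Dom C b" "Cod C g = Dom C b"
      and e: "pair C (a \<cdot> f) (b \<cdot> f) = pair C (a \<cdot> g) (b \<cdot> g)"
      using assms by auto
    have "a \<cdot> f = pr1 C (Cod C a) (Cod C b) \<cdot> pair C (a \<cdot> f) (b \<cdot> f)"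
      "b \<cdot> f = pr2 C (Cod C a) (Cod C b) \<cdot> pair C (a \<cdot> f) (b \<cdot> f)"
      using assms by simp_all
    then have "a \<cdot> f = a \<cdot> g" "b \<cdot> f = b \<cdot> g"
      unfolding e using assms by simp_all
    then show "f = g" by - (rule jointly_monoD[OF j], use assms in auto)
  qed (use assms in simp)
qed

section \<open>Relations as jointly monic spans\<close>

text \<open>Composing with \<open>u\<close> or with its inverse exchanges the isomorphisms that
  witness membership in the two classes.\<close>

lemma sub_class_iso:
  assumes "mono_ar C m" "iso_ar C u" "Cod C u = Dom C m"
  shows "sub_class C (m \<cdot> u) = sub_class C m"
proof -
  obtain v where v: "u \<in> Ar C" "v \<in> Ar C" "Dom C v = Cod C u" "Cod C v = Dom C u"
    "v \<cdot> u = Idn C (Dom C u)" "u \<cdot> v = Idn C (Cod C u)" "iso_ar C v"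
    using assms(2) by (rule isoE)
  note [simp] = v(1-4) mono_in_Ar[OF assms(1)] assms(3)
  have "\<exists>j. iso_ar C j \<and> j \<in> hom C (Dom C n) (Dom C m) \<and> m \<cdot> j = n"
    if i: "iso_ar C i" "i \<in> hom C (Dom C n) (Dom C (m \<cdot> u))" "(m \<cdot> u) \<cdot> i = n" for i n
    using i v assms(2) by (intro exI[of _ "u \<cdot> i"]) (auto simp: hom_def intro: iso_comp)
  moreover have "\<exists>j. iso_ar C j \<and> j \<in> hom C (Dom C n) (Dom C (m \<cdot> u)) \<and> (m \<cdot> u) \<cdot> j = n"
    if i: "iso_ar C i" "i \<in> hom C (Dom C n) (Dom C m)" "m \<cdot> i = n" for i n
    using i v comp_eq_comp[OF v(6), of i]
    by (intro exI[of _ "v \<cdot> i"]) (auto simp: hom_def intro!: iso_comp)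
  ultimately have "(\<exists>i. iso_ar C i \<and> i \<in> hom C (Dom C n) (Dom C (m \<cdot> u)) \<and> (m \<cdot> u) \<cdot> i = n) \<longleftrightarrow>
      (\<exists>i. iso_ar C i \<and> i \<in> hom C (Dom C n) (Dom C m) \<and> m \<cdot> i = n)" for n
    by metis
  moreover have "Cod C (m \<cdot> u) = Cod C m" by simp
  ultimately show ?thesis
    unfolding sub_class_def by (simp only:)
qed

text \<open>All that is known about a chosen representative is that it differs from \<open>m\<close>
  by an isomorphism. Every independence argument about relations starts here.\<close>

lemma sub_rep_sub_class:
  assumes "mono_ar C m"
  obtains i where "iso_ar C i" "Cod C i = Dom C m" "sub_rep (sub_class C m) = m \<cdot> i"
proof -
  have "m \<in> sub_class C m"
    unfolding sub_class_def using assms mono_in_Ar[OF assms]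
    by (auto simp: hom_def intro!: exI[of _ "Idn C (Dom C m)"] iso_id)
  then have "sub_rep (sub_class C m) \<in> sub_class C m"
    unfolding sub_rep_def by (rule someI)
  moreover have "\<exists>i. iso_ar C i \<and> i \<in> hom C (Dom C n) (Dom C m) \<and> m \<cdot> i = n"
    if "n \<in> sub_class C m" for n
    using that by (simp add: sub_class_def)
  ultimately obtain i where "iso_ar C i" "i \<in> hom C (Dom C (sub_rep (sub_class C m))) (Dom C m)"
    "m \<cdot> i = sub_rep (sub_class C m)"
    by meson
  then show thesis
    by (intro that[of i]) (simp_all add: hom_def)
qed

lemma span_rel_iso:
  assumes "jointly_mono C a b" "iso_ar C i" "Cod C i = Dom C b"
  shows "span_rel C (a \<cdot> i) (b \<cdot> i) = span_rel C a b"
proof -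
  note [simp] = jointly_mono_ar[OF assms(1)] iso_in_Ar[OF assms(2)]
  have "sub_class C (pair C a b \<cdot> i) = sub_class C (pair C a b)"
    by (rule sub_class_iso) (use assms mono_pair_iff in simp_all)
  then show ?thesis
    unfolding span_rel_def using assms(3) by simp
qed

lemma sub_rep_span_rel:
  assumes "jointly_mono C a b"
  obtains i where "iso_ar C i" "i \<in> Ar C" "Cod C i = Dom C b"
    "sub_rep (span_rel C a b) = pair C (a \<cdot> i) (b \<cdot> i)"
proof -
  note [simp] = jointly_mono_ar[OF assms(1)]
  have "mono_ar C (pair C a b)" using assms mono_pair_iff by simp
  then obtain i where i: "iso_ar C i" "Cod C i = Dom C (pair C a b)"
    "sub_rep (sub_class C (pair C a b)) = pair C a b \<cdot> i"
    by (rule sub_rep_sub_class)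
  then show thesis using that[of i] iso_in_Ar[OF i(1)] by (simp add: span_rel_def)
qed

lemma mono_span:
  assumes "has_product C x y" "mono_ar C m" "Cod C m = prod_ob C x y"
  obtains a b where "jointly_mono C a b" "Cod C a = x" "Cod C b = y" "m = pair C a b"
proof -
  let ?a = "pr1 C x y \<cdot> m" and ?b = "pr2 C x y \<cdot> m"
  have [simp]: "m \<in> Ar C" using assms mono_in_Ar by blast
  have e: "pair C ?a ?b = m" using assms by (intro pair_eta) auto
  have "jointly_mono C ?a ?b"
    using mono_pair_iff[of ?a ?b] e assms by simp
  then show thesis using that[of ?a ?b] e assms by simp
qed

text \<open>The case distinction in \<open>relations\<close> disappears because a span forces the
  product of its ends to exist; conversely a monomorphism into the product is the pairing of its two
  coordinates.\<close>

lemma relations_iff: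
  "r \<in> relations C x y \<longleftrightarrow>
     (\<exists>a b. jointly_mono C a b \<and> Cod C a = x \<and> Cod C b = y \<and> r = span_rel C a b)"
proof
  assume "r \<in> relations C x y"
  then obtain m where h: "has_product C x y" and m: "mono_ar C m" "Cod C m = prod_ob C x y"
    "r = sub_class C m"
    unfolding relations_def subobjects_def by (auto split: if_splits)
  show "\<exists>a b. jointly_mono C a b \<and> Cod C a = x \<and> Cod C b = y \<and> r = span_rel C a b"
    using mono_span[OF h m(1,2)] m(3) unfolding span_rel_def by metis
next
  assume "\<exists>a b. jointly_mono C a b \<and> Cod C a = x \<and> Cod C b = y \<and> r = span_rel C a b"
  then obtain a b where ab: "jointly_mono C a b" "Cod C a = x" "Cod C b = y" "r = span_rel C a b"
    by blast
  then have "mono_ar C (pair C a b)" "has_product C x y" "Cod C (pair C a b) = prod_ob C x y"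
    using jointly_mono_ar[OF ab(1)] span_product[of a b] by (auto simp: mono_pair_iff)
  then show "r \<in> relations C x y"
    using ab(4) unfolding relations_def subobjects_def span_rel_def by auto
qed

lemma relationsE:
  assumes "r \<in> relations C x y"
  obtains a b where "jointly_mono C a b" "Cod C a = x" "Cod C b = y" "r = span_rel C a b"
  using assms[unfolded relations_iff] by (elim exE conjE) (rule that)

lemma graph_span_rel: "graph C f = span_rel C (Idn C (Dom C f)) f"
  by (simp add: graph_def span_rel_def)

lemma jointly_mono_graph: "f \<in> Ar C \<Longrightarrow> jointly_mono C (Idn C (Dom C f)) f"
  by (intro jointly_mono_mono_left iso_mono iso_id) auto

lemma graph_in_relations: "f \<in> Ar C \<Longrightarrow> graph C f \<in> relations C (Dom C f) (Cod C f)"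
  unfolding relations_iff graph_span_rel
  by (rule exI[of _ "Idn C (Dom C f)"], rule exI[of _ f]) (simp add: jointly_mono_graph)

end

section \<open>Degree functions; composition and product of relations computed on spans\<close>

locale regular_cat_degree = regular_cat C for C :: "('o, 'm, 'x) cat_scheme" (structure) +
  fixes \<delta> :: "'m \<Rightarrow> 'k::field"
  assumes degree: "degree_function C \<delta>"
begin

lemma degree_comp:
  "epi_ar C e \<Longrightarrow> epi_ar C e' \<Longrightarrow> Cod C e = Dom C e' \<Longrightarrow> \<delta> (e' \<cdot> e) = \<delta> e' * \<delta> e"
  using degree unfolding degree_function_def by blast

lemma degree_id: "x \<in> Ob C \<Longrightarrow> \<delta> (Idn C x) = 1"
  using degree unfolding degree_function_def by blast

lemma degree_iso:
  assumes "iso_ar C u" shows "\<delta> u = 1"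
proof -
  obtain v where v: "u \<in> Ar C" "v \<in> Ar C" "Dom C v = Cod C u" "Cod C v = Dom C u"
    "v \<cdot> u = Idn C (Dom C u)" "u \<cdot> v = Idn C (Cod C u)" "iso_ar C v"
    using assms(1) by (rule isoE)
  \<comment> \<open>an isomorphism is a pullback of an identity\<close>
  have "is_pullback C (Idn C (Dom C u)) v (Idn C (Dom C u)) u"
  proof (rule pullbackI)
    show "jointly_mono C (Idn C (Dom C u)) u" using v by (simp add: jointly_mono_graph)
    fix a b assume "a \<in> Ar C" "b \<in> Ar C" "Dom C a = Dom C b" "Cod C a = Dom C (Idn C (Dom C u))"
      "Cod C b = Dom C v" "Idn C (Dom C u) \<cdot> a = v \<cdot> b"
    then show "\<exists>h. h \<in> Ar C \<and> Dom C h = Dom C a \<and> Cod C h = Dom C (Idn C (Dom C u)) \<and>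
       Idn C (Dom C u) \<cdot> h = a \<and> u \<cdot> h = b"
      using v comp_eq_comp[OF v(6), of b] by (intro exI[of _ a]) simp
  qed (use v in simp_all)
  then have "\<delta> u = \<delta> (Idn C (Dom C u))"
    using degree iso_epi[OF iso_id, of "Dom C u"] v unfolding degree_function_def by auto
  then show ?thesis using degree_id v by simp
qed

text \<open>The choices made by \<open>rel_comp\<close> differ from the given data by isomorphisms:
  \<open>i\<close> and \<open>j\<close> for the representatives, \<open>t\<close> for the pullback,
  \<open>u\<close> for the factorization. The class of the image absorbs \<open>u\<close>, and the
  degree is unchanged since isomorphisms have degree 1.\<close>

lemma rel_comp_span_rel:
  assumes ab: "jointly_mono C a b" and cd: "jointly_mono C c d" and pb: "is_pullback C b c p q"
    and kl: "jointly_mono C k l" and e: "epi_ar C e" "Cod C e = Dom C k"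
    and ke: "k \<cdot> e = a \<cdot> p" "l \<cdot> e = d \<cdot> q"
  shows "rel_comp C \<delta> (Cod C a) (Cod C b) (Cod C d) (span_rel C a b) (span_rel C c d) =
    Poly_Mapping.single (span_rel C k l) (\<delta> e)"
proof -
  note [simp] = jointly_mono_ar[OF ab] jointly_mono_ar[OF cd] jointly_mono_ar[OF kl]
    epi_in_Ar[OF e(1)] e(2)
  note pq[simp] = pullback_comm[OF pb]
  obtain i where i: "iso_ar C i" and [simp]: "i \<in> Ar C" "Cod C i = Dom C b"
    and m: "sub_rep (span_rel C a b) = pair C (a \<cdot> i) (b \<cdot> i)"
    using sub_rep_span_rel[OF ab] by blast
  obtain j where j: "iso_ar C j" and [simp]: "j \<in> Ar C" "Cod C j = Dom C d"
    and n: "sub_rep (span_rel C c d) = pair C (c \<cdot> j) (d \<cdot> j)"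
    using sub_rep_span_rel[OF cd] by blast
  have "has_pullback C b c" using pb unfolding has_pullback_def by blast
  then have hp: "has_pullback C (b \<cdot> i) (c \<cdot> j)"
    using has_pullback_iso_legs[OF i j, of b c] by simp
  obtain p1 q1 where pq1: "(SOME (p, q). is_pullback C (b \<cdot> i) (c \<cdot> j) p q) = (p1, q1)"
    by fastforce
  have pb1: "is_pullback C (b \<cdot> i) (c \<cdot> j) p1 q1"
    using someI_ex[of "\<lambda>(p, q). is_pullback C (b \<cdot> i) (c \<cdot> j) p q"] hp pq1
    unfolding has_pullback_def by auto
  note [simp] = pullback_comm(3,4,6-8)[OF pb1]
  \<comment> \<open>With \<open>i\<close> and \<open>j\<close> moved into the projections, the
    chosen pullback is one of the original legs, hence isomorphic to the given one.\<close>
  have "is_pullback C b c (i \<cdot> p1) (j \<cdot> q1)"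
    by (rule pullback_iso_legs[OF i j]) (use pb1 in simp_all)
  from pullback_iso_apex[OF pb this] obtain t where t: "iso_ar C t" "Dom C t = Dom C (i \<cdot> p1)"
    "Cod C t = Dom C p" "p \<cdot> t = i \<cdot> p1" "q \<cdot> t = j \<cdot> q1" by blast
  note [simp] = iso_in_Ar[OF t(1)] t(2,3)
  let ?h = "pair C (a \<cdot> (i \<cdot> p1)) (d \<cdot> (j \<cdot> q1))"
  have [simp]: "Dom C e = Dom C p"
    using arg_cong[OF ke(1), of "Dom C"] by simp
  have "a \<cdot> (i \<cdot> p1) = k \<cdot> (e \<cdot> t)" "d \<cdot> (j \<cdot> q1) = l \<cdot> (e \<cdot> t)"
    using comp_eq_comp[OF ke(1), of t] comp_eq_comp[OF ke(2), of t] by (simp_all add: t)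
  then have "?h = pair C k l \<cdot> (e \<cdot> t)" by simp
  \<comment> \<open>Reparametrised by \<open>t\<close>, the given data factor the very arrow whose
    factorization \<open>rel_comp\<close> chooses, so uniqueness of factorizations applies.\<close>
  then have fac: "is_factorization C ?h (e \<cdot> t) (pair C k l)"
    unfolding is_factorization_def using e kl t by (simp add: mono_pair_iff epi_comp iso_epi)
  obtain e1 m1 where em1: "(SOME (e, k). is_factorization C ?h e k) = (e1, m1)"
    by fastforce
  have fac1: "is_factorization C ?h e1 m1"
    using someI_ex[of "\<lambda>(e, k). is_factorization C ?h e k"] fac em1 by auto
  obtain u where u: "iso_ar C u" "Dom C u = Dom C m1" "Cod C u = Dom C (pair C k l)"
    "u \<cdot> e1 = e \<cdot> t" "pair C k l \<cdot> u = m1"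
    by (rule factorization_unique[OF fac1 fac])
  have "sub_class C m1 = span_rel C k l"
    unfolding span_rel_def
    using sub_class_iso[of "pair C k l" u] u kl by (simp add: mono_pair_iff)
  moreover have "\<delta> e1 = \<delta> e"
  proof -
    have "epi_ar C e1" "Cod C e1 = Dom C u" using fac1 u unfolding is_factorization_def by auto
    then have "\<delta> (u \<cdot> e1) = \<delta> e1"
      using degree_comp[of e1 u] u by (simp add: iso_epi degree_iso)
    moreover have "\<delta> (e \<cdot> t) = \<delta> e"
      using degree_comp[of t e] t e by (simp add: iso_epi degree_iso)
    ultimately show ?thesis using u by simp
  qed
  moreover have "pr2 C (Cod C a) (Cod C b) \<cdot> pair C (a \<cdot> i) (b \<cdot> i) = b \<cdot> i"
    "pr1 C (Cod C b) (Cod C d) \<cdot> pair C (c \<cdot> j) (d \<cdot> j) = c \<cdot> j"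
    "pr1 C (Cod C a) (Cod C b) \<cdot> pair C (a \<cdot> i) (b \<cdot> i) \<cdot> p1 = a \<cdot> (i \<cdot> p1)"
    "pr2 C (Cod C b) (Cod C d) \<cdot> pair C (c \<cdot> j) (d \<cdot> j) \<cdot> q1 = d \<cdot> (j \<cdot> q1)"
    by simp_all
  ultimately show ?thesis
    unfolding rel_comp_def m n Let_def using hp pq1 em1 by simp
qed

text \<open>By \<open>has_pullback_iso_legs\<close> the existence of the pullback does not depend on
  the representatives, so the test inside \<open>rel_comp\<close> may be made on the given
  legs.\<close>

lemma rel_comp_eq_0:
  assumes ab: "jointly_mono C a b" and cd: "jointly_mono C c d" and "Cod C b = Cod C c"
    and "\<not> has_pullback C b c"
  shows "rel_comp C \<delta> (Cod C a) (Cod C b) (Cod C d) (span_rel C a b) (span_rel C c d) = 0"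
proof -
  note [simp] = jointly_mono_ar[OF ab] jointly_mono_ar[OF cd] assms(3)
  obtain i where i: "iso_ar C i" and [simp]: "i \<in> Ar C" "Cod C i = Dom C b"
    and m: "sub_rep (span_rel C a b) = pair C (a \<cdot> i) (b \<cdot> i)"
    using sub_rep_span_rel[OF ab] by blast
  obtain j where j: "iso_ar C j" and [simp]: "j \<in> Ar C" "Cod C j = Dom C d"
    and n: "sub_rep (span_rel C c d) = pair C (c \<cdot> j) (d \<cdot> j)"
    using sub_rep_span_rel[OF cd] by blast
  have "pr2 C (Cod C a) (Cod C b) \<cdot> pair C (a \<cdot> i) (b \<cdot> i) = b \<cdot> i"
    "pr1 C (Cod C b) (Cod C d) \<cdot> pair C (c \<cdot> j) (d \<cdot> j) = c \<cdot> j" by simp_all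
  moreover have "\<not> has_pullback C (b \<cdot> i) (c \<cdot> j)"
    using has_pullback_iso_legs[OF i j, of b c] assms(4) by simp
  ultimately show ?thesis
    unfolding rel_comp_def m n Let_def by simp
qed

text \<open>The left leg of a graph is an identity, so the pullback is trivial and the composite
  span is \<open>(a, f \<cdot> b)\<close>. As this is already jointly monic, its epi part is an
  identity and no degree factor appears.\<close>

lemma rel_comp_graph_right:
  assumes ab: "jointly_mono C a b" and f: "f \<in> Ar C" "Dom C f = Cod C b"
    and afb: "jointly_mono C a (f \<cdot> b)"
  shows "rel_comp C \<delta> (Cod C a) (Cod C b) (Cod C f) (span_rel C a b) (graph C f) =
    Poly_Mapping.single (span_rel C a (f \<cdot> b)) 1"
proof -
  note [simp] = jointly_mono_ar[OF ab]
  have pb: "is_pullback C b (Idn C (Dom C f)) (Idn C (Dom C b)) b"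
    using pullback_along_id[of b] f by simp
  have "rel_comp C \<delta> (Cod C a) (Cod C b) (Cod C f) (span_rel C a b) (span_rel C (Idn C (Dom C f)) f) =
    Poly_Mapping.single (span_rel C a (f \<cdot> b)) (\<delta> (Idn C (Dom C b)))"
    by (rule rel_comp_span_rel[OF ab jointly_mono_graph[OF f(1)] pb afb])
       (use f in \<open>simp_all add: iso_epi iso_id\<close>)
  then show ?thesis by (simp add: graph_span_rel degree_id)
qed

text \<open>Pulling \<open>f \<cdot> u\<close> back along the monomorphism \<open>f\<close> returns
  \<open>u\<close>, so the graph of \<open>f\<close> strips \<open>f\<close> from the left leg; the
  epi part is again an identity.\<close>

lemma rel_comp_graph_left:
  assumes f: "mono_ar C f" and u: "u \<in> Ar C" "Cod C u = Dom C f" and ab: "jointly_mono C (f \<cdot> u) b"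
  shows "rel_comp C \<delta> (Dom C f) (Cod C f) (Cod C b) (graph C f) (span_rel C (f \<cdot> u) b) =
    Poly_Mapping.single (span_rel C u b) 1"
proof -
  note f'[simp] = mono_in_Ar[OF f] u
  note [simp] = jointly_mono_ar[OF ab, simplified]
  have "rel_comp C \<delta> (Cod C (Idn C (Dom C f))) (Cod C f) (Cod C b)
      (span_rel C (Idn C (Dom C f)) f) (span_rel C (f \<cdot> u) b) =
    Poly_Mapping.single (span_rel C u b) (\<delta> (Idn C (Dom C u)))"
    by (rule rel_comp_span_rel[OF jointly_mono_graph[OF f'(1)] ab pullback_along_mono[OF f u]])
       (use jointly_mono_cancel_left[OF ab] in \<open>simp_all add: iso_epi iso_id\<close>)
  then show ?thesis by (simp add: graph_span_rel degree_id)
qed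

text \<open>\<open>rel_times\<close> takes the chosen product of chosen apexes; \<open>i\<close> and
  \<open>j\<close> turn it into a product of the given apexes, and \<open>t\<close> compares that
  with \<open>(p, q)\<close>. For joint monicity both pairings are split into coordinates, which
  regroup into the legs of the two original spans.\<close>

lemma rel_times_span_rel:
  assumes ab: "jointly_mono C a b" and cd: "jointly_mono C c d"
    and P: "is_product C (Dom C b) (Dom C d) p q"
  shows "rel_times C (Cod C a) (Cod C b) (Cod C c) (Cod C d) (span_rel C a b) (span_rel C c d) =
      span_rel C (pair C (a \<cdot> p) (c \<cdot> q)) (pair C (b \<cdot> p) (d \<cdot> q))"
    and "jointly_mono C (pair C (a \<cdot> p) (c \<cdot> q)) (pair C (b \<cdot> p) (d \<cdot> q))"
proof -
  note [simp] = jointly_mono_ar[OF ab] jointly_mono_ar[OF cd] product_ar[OF P]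
  show jm: "jointly_mono C (pair C (a \<cdot> p) (c \<cdot> q)) (pair C (b \<cdot> p) (d \<cdot> q))" (is "jointly_mono C ?k ?l")
  proof (rule jointly_monoI)
    fix f g assume [simp]: "f \<in> Ar C" "g \<in> Ar C" "Dom C f = Dom C g"
      and "Cod C f = Dom C ?k" "Cod C g = Dom C ?k" and kl: "?k \<cdot> f = ?k \<cdot> g" "?l \<cdot> f = ?l \<cdot> g"
    then have [simp]: "Cod C f = Dom C q" "Cod C g = Dom C q" by auto
    have "a \<cdot> (p \<cdot> f) = pr1 C (Cod C a) (Cod C c) \<cdot> (?k \<cdot> f)" "c \<cdot> (q \<cdot> f) = pr2 C (Cod C a) (Cod C c) \<cdot> (?k \<cdot> f)"
       "b \<cdot> (p \<cdot> f) = pr1 C (Cod C b) (Cod C d) \<cdot> (?l \<cdot> f)" "d \<cdot> (q \<cdot> f) = pr2 C (Cod C b) (Cod C d) \<cdot> (?l \<cdot> f)"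
      by simp_all
    then have eq: "a \<cdot> (p \<cdot> f) = a \<cdot> (p \<cdot> g)" "c \<cdot> (q \<cdot> f) = c \<cdot> (q \<cdot> g)"
       "b \<cdot> (p \<cdot> f) = b \<cdot> (p \<cdot> g)" "d \<cdot> (q \<cdot> f) = d \<cdot> (q \<cdot> g)"
      unfolding kl by simp_all
    have "p \<cdot> f = p \<cdot> g" by (rule jointly_monoD[OF ab]) (use eq in simp_all)
    moreover have "q \<cdot> f = q \<cdot> g" by (rule jointly_monoD[OF cd]) (use eq in simp_all)
    ultimately show "f = g" by - (rule jointly_monoD[OF product_jointly_mono[OF P]], simp_all)
  qed simp_all
  obtain i where i: "iso_ar C i" and [simp]: "i \<in> Ar C" "Cod C i = Dom C b"
    and m: "sub_rep (span_rel C a b) = pair C (a \<cdot> i) (b \<cdot> i)"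
    using sub_rep_span_rel[OF ab] by blast
  obtain j where j: "iso_ar C j" and [simp]: "j \<in> Ar C" "Cod C j = Dom C d"
    and n: "sub_rep (span_rel C c d) = pair C (c \<cdot> j) (d \<cdot> j)"
    using sub_rep_span_rel[OF cd] by blast
  \<comment> \<open>The inverses exhibit a span with ends \<open>Dom C i\<close> and
    \<open>Dom C j\<close>, so that the product used by \<open>rel_times\<close> exists.\<close>
  obtain i' where i': "i' \<in> Ar C" "Dom C i' = Cod C i" "Cod C i' = Dom C i"
    using i by (rule isoE)
  obtain j' where j': "j' \<in> Ar C" "Dom C j' = Cod C j" "Cod C j' = Dom C j"
    using j by (rule isoE)
  have hp[simp]: "has_product C (Dom C i) (Dom C j)"
    using span_product[of "i' \<cdot> p" "j' \<cdot> q"] i' j' by simp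
  have "is_product C (Dom C b) (Dom C d) (i \<cdot> pr1 C (Dom C i) (Dom C j)) (j \<cdot> pr2 C (Dom C i) (Dom C j))"
    using product_iso_factors[OF product_pr[OF hp] i j] by simp
  from product_iso_apex[OF P this] obtain t where t: "iso_ar C t"
    "Dom C t = Dom C (i \<cdot> pr1 C (Dom C i) (Dom C j))" "Cod C t = Dom C p"
    "p \<cdot> t = i \<cdot> pr1 C (Dom C i) (Dom C j)" "q \<cdot> t = j \<cdot> pr2 C (Dom C i) (Dom C j)" by blast
  have "span_rel C (?k \<cdot> t) (?l \<cdot> t) = span_rel C ?k ?l"
    by (rule span_rel_iso[OF jm t(1)]) (use t in simp)
  moreover have "?k \<cdot> t = pair C (a \<cdot> (i \<cdot> pr1 C (Dom C i) (Dom C j))) (c \<cdot> (j \<cdot> pr2 C (Dom C i) (Dom C j)))"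
    "?l \<cdot> t = pair C (b \<cdot> (i \<cdot> pr1 C (Dom C i) (Dom C j))) (d \<cdot> (j \<cdot> pr2 C (Dom C i) (Dom C j)))"
    using t iso_in_Ar[OF t(1)] by simp_all
  ultimately show "rel_times C (Cod C a) (Cod C b) (Cod C c) (Cod C d) (span_rel C a b) (span_rel C c d) =
      span_rel C ?k ?l"
    unfolding rel_times_def m n Let_def by (simp add: span_rel_def)
qed

end

section \<open>Functors between regular categories\<close>

lemma rel_ar_simps [simp]:
  "src (x, y, c) = x" "tgt (x, y, c) = y" "coeffs (x, y, c) = c"
  "src (bracket x y r) = x" "tgt (bracket x y r) = y"
  "coeffs (bracket x y r) = Poly_Mapping.single r 1"
  by (simp_all add: src_def tgt_def coeffs_def bracket_def)

lemma T0_simps [simp]: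
  "Ob (T0 C \<delta>) = Ob C" "Dom (T0 C \<delta>) = src" "Cod (T0 C \<delta>) = tgt"
  "Idn (T0 C \<delta>) x = graph_ar C (Idn C x)" "TensOb (T0 C \<delta>) = prod_ob C" "UnitOb (T0 C \<delta>) = one_ob C"
  by (simp_all add: T0_def)

lemma T0_Ar: "f \<in> Ar (T0 C \<delta>) \<longleftrightarrow>
    src f \<in> Ob C \<and> tgt f \<in> Ob C \<and> Poly_Mapping.keys (coeffs f) \<subseteq> relations C (src f) (tgt f)"
  by (cases f) (simp add: T0_def)

lemma T0_comp: "g \<cdot>\<^bsub>T0 C \<delta>\<^esub> f = (src f, tgt g,
    bilin (rel_comp C \<delta> (src f) (tgt f) (tgt g)) (coeffs f) (coeffs g))"
  by (simp add: T0_def)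

lemma T0_TensAr: "TensAr (T0 C \<delta>) f g = (prod_ob C (src f) (src g), prod_ob C (tgt f) (tgt g),
    bilin (\<lambda>r s. Poly_Mapping.single (rel_times C (src f) (tgt f) (src g) (tgt g) r s) 1)
      (coeffs f) (coeffs g))"
  by (simp add: T0_def)

section \<open>Composition and tensor product of graphs\<close>

context regular_cat_degree
begin

lemma graph_ar_simps [simp]:
  "src (graph_ar C f :: ('o, 'm, 'k) rel_ar) = Dom C f"
  "tgt (graph_ar C f :: ('o, 'm, 'k) rel_ar) = Cod C f"
  "coeffs (graph_ar C f :: ('o, 'm, 'k) rel_ar) = Poly_Mapping.single (graph C f) 1"
  by (simp_all add: graph_ar_def)

lemma graph_ar_Ar [simp]: "f \<in> Ar C \<Longrightarrow> graph_ar C f \<in> Ar (T0 C \<delta>)"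
  by (simp add: T0_Ar graph_in_relations)

text \<open>The span with legs identity and \<open>g \<cdot> f\<close> is jointly monic because of
  the identity, so no proper image is taken and no degree factor arises.\<close>

lemma graph_ar_comp [simp]:
  assumes "f \<in> Ar C" "g \<in> Ar C" "Cod C f = Dom C g"
  shows "graph_ar C g \<cdot>\<^bsub>T0 C \<delta>\<^esub> graph_ar C f = graph_ar C (g \<cdot> f)"
proof -
  have "rel_comp C \<delta> (Cod C (Idn C (Dom C f))) (Cod C f) (Cod C g)
      (span_rel C (Idn C (Dom C f)) f) (graph C g) =
    Poly_Mapping.single (span_rel C (Idn C (Dom C f)) (g \<cdot> f)) 1"
    by (rule rel_comp_graph_right)
       (use assms jointly_mono_graph[of f] jointly_mono_graph[of "g \<cdot> f"] in simp_all)
  then show ?thesis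
    using assms by (simp add: T0_comp bilin_lin_ext graph_ar_def bracket_def graph_span_rel)
qed

lemma graph_ar_iso:
  assumes "iso_ar C f" shows "iso_ar (T0 C \<delta>) (graph_ar C f)"
proof -
  obtain g where g: "f \<in> Ar C" "g \<in> Ar C" "Dom C g = Cod C f" "Cod C g = Dom C f"
    "g \<cdot> f = Idn C (Dom C f)" "f \<cdot> g = Idn C (Cod C f)"
    using assms by (rule isoE)
  then show ?thesis
    unfolding iso_ar_def by (intro conjI bexI[of _ "graph_ar C g"]) (simp_all add: hom_def)
qed

text \<open>Both left legs are identities, so the left leg of the product relation is the pairing of
  the projections, an identity by \<open>pair_pr\<close>. The product relation is therefore again a
  graph.\<close>

lemma graph_ar_tensor [simp]:
  assumes "f \<in> Ar C" "g \<in> Ar C" "has_product C (Dom C f) (Dom C g)"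
  shows "TensAr (T0 C \<delta>) (graph_ar C f) (graph_ar C g) =
    graph_ar C (pair C (f \<cdot> pr1 C (Dom C f) (Dom C g)) (g \<cdot> pr2 C (Dom C f) (Dom C g)))"
  using rel_times_span_rel(1)[OF jointly_mono_graph[OF assms(1)] jointly_mono_graph[OF assms(2)]
      product_pr[OF assms(3)]] assms
  by (simp add: T0_TensAr bilin_lin_ext graph_ar_def bracket_def graph_span_rel)

end

section \<open>The action of a functor on relations\<close>

definition rel_map :: "('o, 'm, 'x) cat_scheme \<Rightarrow> ('p, 'n, 'y) cat_scheme \<Rightarrow> ('o, 'm, 'p, 'n) ftor \<Rightarrow>
    'o \<Rightarrow> 'o \<Rightarrow> 'm set \<Rightarrow> 'n set" where
  "rel_map A A' F x y r = sub_class A' (prod_comparison A A' F x y \<cdot>\<^bsub>A'\<^esub> FAr F (sub_rep r))"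

definition T0_ftor :: "('o, 'm, 'x) cat_scheme \<Rightarrow> ('p, 'n, 'y) cat_scheme \<Rightarrow> ('o, 'm, 'p, 'n) ftor \<Rightarrow>
    ('o, ('o, 'm, 'k) rel_ar, 'p, ('p, 'n, 'k::field) rel_ar) ftor" where
  "T0_ftor A A' F = \<lparr>FOb = FOb F, FAr = (\<lambda>f. (FOb F (src f), FOb F (tgt f),
     lin_ext (\<lambda>r. Poly_Mapping.single (rel_map A A' F (src f) (tgt f) r) 1) (coeffs f)))\<rparr>"

lemma FOb_T0_ftor [simp]: "FOb (T0_ftor A A' F) = FOb F"
  by (simp add: T0_ftor_def)

lemma FAr_T0_ftor: "FAr (T0_ftor A A' F) f = (FOb F (src f), FOb F (tgt f),
     lin_ext (\<lambda>r. Poly_Mapping.single (rel_map A A' F (src f) (tgt f) r) 1) (coeffs f))"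
  by (simp add: T0_ftor_def)

locale regular_functor = A: regular_cat_degree A \<delta> + A': regular_cat_degree A' \<delta>'
  for A :: "('o, 'm, 'x) cat_scheme" and \<delta> :: "'m \<Rightarrow> 'k::field"
    and A' :: "('p, 'n, 'y) cat_scheme" and \<delta>' :: "'n \<Rightarrow> 'k" +
  fixes F :: "('o, 'm, 'p, 'n) ftor"
  assumes F_functor: "is_functor A A' F"
    and degree_preserved: "preserves_degree A \<delta> A' \<delta>' F"
    and pullbacks: "preserves_pullbacks A A' F"
    and pullbacks_reflected: "reflects_existence_of_pullbacks A A' F"
begin

lemma F_ob [simp]: "x \<in> Ob A \<Longrightarrow> FOb F x \<in> Ob A'"
  and F_id [simp]: "x \<in> Ob A \<Longrightarrow> FAr F (Idn A x) = Idn A' (FOb F x)"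
  using F_functor unfolding is_functor_def by blast+

lemma F_ar [simp]:
  assumes "f \<in> Ar A"
  shows "FAr F f \<in> Ar A'" "Dom A' (FAr F f) = FOb F (Dom A f)" "Cod A' (FAr F f) = FOb F (Cod A f)"
  using F_functor assms unfolding is_functor_def hom_def by blast+

lemma F_comp [simp]:
  "\<lbrakk>f \<in> Ar A; g \<in> Ar A; Cod A f = Dom A g\<rbrakk> \<Longrightarrow> FAr F (g \<cdot>\<^bsub>A\<^esub> f) = FAr F g \<cdot>\<^bsub>A'\<^esub> FAr F f"
  using F_functor unfolding is_functor_def by blast

lemma F_comp_eq:
  assumes "u \<cdot>\<^bsub>A\<^esub> v = w" "u \<in> Ar A" "v \<in> Ar A" "Cod A v = Dom A u"
  shows "FAr F u \<cdot>\<^bsub>A'\<^esub> FAr F v = FAr F w"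
  using assms F_comp by metis

lemma F_epi: "epi_ar A e \<Longrightarrow> epi_ar A' (FAr F e)" "epi_ar A e \<Longrightarrow> \<delta>' (FAr F e) = \<delta> e"
  using degree_preserved unfolding preserves_degree_def by blast+

lemma F_pullback: "is_pullback A f g p q \<Longrightarrow> is_pullback A' (FAr F f) (FAr F g) (FAr F p) (FAr F q)"
  using pullbacks unfolding preserves_pullbacks_def by blast

text \<open>One direction is the reflection hypothesis, the other is preservation. Together they
  match the zero and nonzero cases of \<open>rel_comp\<close> in the two categories.\<close>

lemma F_has_pullback:
  assumes "f \<in> Ar A" "g \<in> Ar A" "Cod A f = Cod A g"
  shows "has_pullback A' (FAr F f) (FAr F g) \<longleftrightarrow> has_pullback A f g"
  using assms pullbacks_reflected F_pullback
  unfolding has_pullback_def reflects_existence_of_pullbacks_def by blast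

lemma F_iso:
  assumes "iso_ar A f" shows "iso_ar A' (FAr F f)"
proof -
  obtain g where "f \<in> Ar A" "g \<in> Ar A" "Dom A g = Cod A f" "Cod A g = Dom A f"
    "g \<cdot>\<^bsub>A\<^esub> f = Idn A (Dom A f)" "f \<cdot>\<^bsub>A\<^esub> g = Idn A (Cod A f)"
    using assms by (rule A.isoE)
  then show ?thesis by (intro A'.isoI[of _ "FAr F g"]) (simp_all add: F_comp_eq)
qed

lemma F_mono:
  assumes "mono_ar A m" shows "mono_ar A' (FAr F m)"
proof -
  have m: "m \<in> Ar A" using assms A.mono_in_Ar by blast
  then have "is_pullback A m m (Idn A (Dom A m)) (Idn A (Dom A m))"
    using assms A.mono_iff_pullback by blast
  from F_pullback[OF this] show ?thesis
    using A'.mono_iff_pullback[of "FAr F m"] m by simp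
qed

text \<open>The projections of \<open>x \<times> y\<close> form a pullback over the terminal object, although \<open>F\<close>
  need not preserve the latter.\<close>

lemma F_projections_jointly_mono:
  assumes "is_product A x y p q" shows "jointly_mono A' (FAr F p) (FAr F q)"
proof -
  note [simp] = A.product_ar[OF assms]
  obtain u where u: "u \<in> Ar A" "Dom A u = x" "Cod A u = one_ob A"
    using A.terminal_arrow[OF A.terminal_one, of x] A.cod_ob[of p] by auto
  obtain v where v: "v \<in> Ar A" "Dom A v = y" "Cod A v = one_ob A"
    using A.terminal_arrow[OF A.terminal_one, of y] A.cod_ob[of q] by auto
  have "is_pullback A u v p q"
    using A.product_iff_pullback[OF A.terminal_one, of u v p q] u v assms by simp
  then show ?thesis
    using A'.pullback_jointly_mono F_pullback by blast
qed

text \<open>The pairing goes to a monomorphism and the projections go to a jointly monic pair; their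
  composites are the images of the legs. The argument takes place over the image of the product and
  needs no product in \<open>A'\<close>.\<close>

lemma F_jointly_mono:
  assumes "jointly_mono A a b" shows "jointly_mono A' (FAr F a) (FAr F b)"
proof -
  note [simp] = A.jointly_mono_ar[OF assms]
  let ?p = "pr1 A (Cod A a) (Cod A b)" and ?q = "pr2 A (Cod A a) (Cod A b)"
  have hp: "has_product A (Cod A a) (Cod A b)" by (rule A.span_product) simp_all
  have "jointly_mono A' (FAr F ?p \<cdot>\<^bsub>A'\<^esub> FAr F (pair A a b)) (FAr F ?q \<cdot>\<^bsub>A'\<^esub> FAr F (pair A a b))"
    using assms hp A.mono_pair_iff
    by (intro A'.jointly_mono_comp F_projections_jointly_mono[OF A.product_pr] F_mono) simp_all
  moreover have "FAr F ?p \<cdot>\<^bsub>A'\<^esub> FAr F (pair A a b) = FAr F a"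
    "FAr F ?q \<cdot>\<^bsub>A'\<^esub> FAr F (pair A a b) = FAr F b"
    using hp by (auto intro!: F_comp_eq)
  ultimately show ?thesis by simp
qed

lemma F_pr_pair [simp]:
  assumes "a \<in> Ar A" "b \<in> Ar A" "Dom A a = Dom A b" "Cod A a = x" "Cod A b = y"
  shows "FAr F (pr1 A x y) \<cdot>\<^bsub>A'\<^esub> FAr F (pair A a b) = FAr F a"
    "FAr F (pr2 A x y) \<cdot>\<^bsub>A'\<^esub> FAr F (pair A a b) = FAr F b"
  using assms A.span_product[of a b] by (auto intro!: F_comp_eq)

lemma comparison_pair:
  assumes "a \<in> Ar A" "b \<in> Ar A" "Dom A a = Dom A b" "Cod A a = x" "Cod A b = y"
  shows "prod_comparison A A' F x y \<cdot>\<^bsub>A'\<^esub> FAr F (pair A a b) = pair A' (FAr F a) (FAr F b)"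
  using assms A.span_product'[of a b] unfolding prod_comparison_def by simp

text \<open>The chosen representative differs by an isomorphism \<open>i\<close>, whose image is an
  isomorphism, so the class is unaffected. The comparison arrow drops out by
  \<open>comparison_pair\<close>.\<close>

lemma rel_map_span_rel:
  assumes "jointly_mono A a b"
  shows "rel_map A A' F (Cod A a) (Cod A b) (span_rel A a b) = span_rel A' (FAr F a) (FAr F b)"
proof -
  note [simp] = A.jointly_mono_ar[OF assms]
  obtain i where i: "iso_ar A i" and [simp]: "i \<in> Ar A" "Cod A i = Dom A b"
    and m: "sub_rep (span_rel A a b) = pair A (a \<cdot>\<^bsub>A\<^esub> i) (b \<cdot>\<^bsub>A\<^esub> i)"
    using A.sub_rep_span_rel[OF assms] by blast
  have "rel_map A A' F (Cod A a) (Cod A b) (span_rel A a b) =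
      span_rel A' (FAr F (a \<cdot>\<^bsub>A\<^esub> i)) (FAr F (b \<cdot>\<^bsub>A\<^esub> i))"
    unfolding rel_map_def m by (subst comparison_pair) (simp_all add: span_rel_def)
  also have "\<dots> = span_rel A' (FAr F a) (FAr F b)"
    using A'.span_rel_iso[OF F_jointly_mono[OF assms] F_iso[OF i]] by simp
  finally show ?thesis .
qed

lemma rel_map_relations:
  assumes "r \<in> relations A x y" shows "rel_map A A' F x y r \<in> relations A' (FOb F x) (FOb F y)"
proof -
  obtain a b where ab: "jointly_mono A a b" "Cod A a = x" "Cod A b = y" "r = span_rel A a b"
    using assms(1) by (rule A.relationsE)
  then show ?thesis
    using rel_map_span_rel[OF ab(1)] F_jointly_mono[OF ab(1)] A.jointly_mono_ar[OF ab(1)]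
    unfolding A'.relations_iff
    by - (rule exI[of _ "FAr F a"], rule exI[of _ "FAr F b"], simp)
qed

text \<open>Pullback, factorization and degree found in \<open>A\<close> are carried to admissible
  data in \<open>A'\<close>, and \<open>rel_comp_span_rel\<close> accepts any such data. Where the
  pullback is missing, it is missing on both sides and both composites vanish.\<close>

lemma rel_map_rel_comp:
  assumes "r \<in> relations A x y" "s \<in> relations A y z"
  shows "lin_ext (\<lambda>r. Poly_Mapping.single (rel_map A A' F x z r) 1) (rel_comp A \<delta> x y z r s) =
    rel_comp A' \<delta>' (FOb F x) (FOb F y) (FOb F z) (rel_map A A' F x y r) (rel_map A A' F y z s)"
proof -
  obtain a b where ab: "jointly_mono A a b" "Cod A a = x" "Cod A b = y" "r = span_rel A a b"
    using assms(1) by (rule A.relationsE)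
  obtain c d where cd: "jointly_mono A c d" "Cod A c = y" "Cod A d = z" "s = span_rel A c d"
    using assms(2) by (rule A.relationsE)
  note [simp] = A.jointly_mono_ar[OF ab(1)] A.jointly_mono_ar[OF cd(1)]
  have maps: "rel_map A A' F x y r = span_rel A' (FAr F a) (FAr F b)"
    "rel_map A A' F y z s = span_rel A' (FAr F c) (FAr F d)"
    using rel_map_span_rel[OF ab(1)] rel_map_span_rel[OF cd(1)] ab cd by simp_all
  note F_ab = F_jointly_mono[OF ab(1)] and F_cd = F_jointly_mono[OF cd(1)]
  show ?thesis
  proof (cases "has_pullback A b c")
    case True
    then obtain p q where pb: "is_pullback A b c p q" unfolding has_pullback_def by blast
    note [simp] = A.pullback_comm(3,4,6-8)[OF pb]
    let ?h = "pair A (a \<cdot>\<^bsub>A\<^esub> p) (d \<cdot>\<^bsub>A\<^esub> q)"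
    have "?h \<in> Ar A" by simp
    then obtain e m where e: "epi_ar A e" and m: "mono_ar A m" and em: "Cod A e = Dom A m"
      "?h = m \<cdot>\<^bsub>A\<^esub> e" by (rule A.factorization_exists)
    have [simp]: "e \<in> Ar A" "m \<in> Ar A" using e m A.epi_in_Ar A.mono_in_Ar by auto
    have hp: "has_product A x z" using A.span_product[of "a \<cdot>\<^bsub>A\<^esub> p" "d \<cdot>\<^bsub>A\<^esub> q"] ab cd by simp
    \<comment> \<open>The mono part of the image is split into two legs \<open>k\<close> and
      \<open>l\<close>, because the formulas for composition and for the action of \<open>F\<close>
      are stated for spans.\<close>
    have "Cod A m = prod_ob A x z" using arg_cong[OF em(2), of "Cod A"] em(1) ab cd by simp
    then obtain k l where kl: "jointly_mono A k l" "Cod A k = x" "Cod A l = z" "m = pair A k l"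
      by (rule A.mono_span[OF hp m])
    note [simp] = A.jointly_mono_ar[OF kl(1)]
    have [simp]: "Cod A e = Dom A l" using em kl by simp
    have eq: "?h = pair A (k \<cdot>\<^bsub>A\<^esub> e) (l \<cdot>\<^bsub>A\<^esub> e)" using em kl by simp
    have ke: "k \<cdot>\<^bsub>A\<^esub> e = a \<cdot>\<^bsub>A\<^esub> p"
      using arg_cong[OF eq, of "\<lambda>h. pr1 A x z \<cdot>\<^bsub>A\<^esub> h"] ab cd kl by simp
    have le: "l \<cdot>\<^bsub>A\<^esub> e = d \<cdot>\<^bsub>A\<^esub> q"
      using arg_cong[OF eq, of "\<lambda>h. pr2 A x z \<cdot>\<^bsub>A\<^esub> h"] ab cd kl by simp
    have "rel_comp A \<delta> x y z r s = Poly_Mapping.single (span_rel A k l) (\<delta> e)"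
      using A.rel_comp_span_rel[OF ab(1) cd(1) pb kl(1) e _ ke le] ab cd by simp
    moreover have "rel_comp A' \<delta>' (Cod A' (FAr F a)) (Cod A' (FAr F b)) (Cod A' (FAr F d))
        (span_rel A' (FAr F a) (FAr F b)) (span_rel A' (FAr F c) (FAr F d)) =
        Poly_Mapping.single (span_rel A' (FAr F k) (FAr F l)) (\<delta>' (FAr F e))"
      by (rule A'.rel_comp_span_rel[OF F_ab F_cd F_pullback[OF pb] F_jointly_mono[OF kl(1)] F_epi(1)[OF e]])
         (use F_comp_eq[OF ke] F_comp_eq[OF le] in simp_all)
    ultimately show ?thesis
      using maps ab cd kl rel_map_span_rel[OF kl(1)] by (simp add: F_epi(2)[OF e])
  next
    case False
    then have "\<not> has_pullback A' (FAr F b) (FAr F c)"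
      using F_has_pullback[of b c] ab cd by simp
    then show ?thesis
      using A.rel_comp_eq_0[OF ab(1) cd(1) _ False] A'.rel_comp_eq_0[OF F_ab F_cd] maps ab cd by simp
  qed
qed

section \<open>The induced functor and its relation to graphs\<close>

abbreviation "Fbar \<equiv> T0_ftor A A' F :: ('o, ('o, 'm, 'k) rel_ar, 'p, ('p, 'n, 'k) rel_ar) ftor"

lemma Fbar_graph_ar [simp]:
  assumes "f \<in> Ar A" shows "FAr Fbar (graph_ar A f) = graph_ar A' (FAr F f)"
  using rel_map_span_rel[OF A.jointly_mono_graph[OF assms]] assms
  by (simp add: FAr_T0_ftor A.graph_span_rel A'.graph_span_rel graph_ar_def bracket_def)

text \<open>Once both composites are nested linear extensions, the claim is
  \<open>rel_map_rel_comp\<close> for the relations occurring in \<open>f\<close> and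
  \<open>g\<close>.\<close>

lemma Fbar_comp:
  assumes f: "f \<in> Ar (T0 A \<delta>)" and g: "g \<in> Ar (T0 A \<delta>)" and fg: "tgt f = src g"
  shows "FAr Fbar (g \<cdot>\<^bsub>T0 A \<delta>\<^esub> f) = FAr Fbar g \<cdot>\<^bsub>T0 A' \<delta>'\<^esub> FAr Fbar f"
proof -
  have "lin_ext (\<lambda>r. lin_ext (\<lambda>s. lin_ext (\<lambda>r. Poly_Mapping.single (rel_map A A' F (src f) (tgt g) r) 1)
          (rel_comp A \<delta> (src f) (src g) (tgt g) r s)) (coeffs g)) (coeffs f) =
    lin_ext (\<lambda>r. lin_ext (\<lambda>s. rel_comp A' \<delta>' (FOb F (src f)) (FOb F (src g)) (FOb F (tgt g))
          (rel_map A A' F (src f) (src g) r) (rel_map A A' F (src g) (tgt g) s)) (coeffs g)) (coeffs f)"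
    by (intro lin_ext_cong rel_map_rel_comp) (use f g fg in \<open>auto simp: T0_Ar\<close>)
  then show ?thesis
    by (simp add: FAr_T0_ftor T0_comp bilin_lin_ext lin_ext_lin_ext fg)
qed

lemma Fbar_functor: "is_functor (T0 A \<delta>) (T0 A' \<delta>') Fbar"
  unfolding is_functor_def
proof (intro conjI ballI impI)
  fix f assume f: "f \<in> Ar (T0 A \<delta>)"
  have "Poly_Mapping.keys (coeffs (FAr Fbar f)) \<subseteq>
      rel_map A A' F (src f) (tgt f) ` Poly_Mapping.keys (coeffs f)"
    by (simp add: FAr_T0_ftor keys_lin_ext_single)
  then have "Poly_Mapping.keys (coeffs (FAr Fbar f)) \<subseteq>
      relations A' (FOb F (src f)) (FOb F (tgt f))"
    using f rel_map_relations by (fastforce simp: T0_Ar)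
  then show "FAr Fbar f \<in> hom (T0 A' \<delta>') (FOb Fbar (Dom (T0 A \<delta>) f)) (FOb Fbar (Cod (T0 A \<delta>) f))"
    using f by (simp add: T0_Ar hom_def FAr_T0_ftor)
qed (auto simp: Fbar_comp)

lemma Fbar_linear: "linear_on_homs A \<delta> Fbar"
  unfolding linear_on_homs_def hom_def
  by (auto simp: FAr_T0_ftor lin_ext_add lin_ext_scale)

lemma Fbar_bracket:
  assumes "has_product A x y" "mono_ar A m" "Cod A m = prod_ob A x y"
  shows "mono_ar A' (prod_comparison A A' F x y \<cdot>\<^bsub>A'\<^esub> FAr F m)"
    and "FAr Fbar (bracket x y (sub_class A m)) =
      bracket (FOb F x) (FOb F y) (sub_class A' (prod_comparison A A' F x y \<cdot>\<^bsub>A'\<^esub> FAr F m))"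
proof -
  obtain a b where ab: "jointly_mono A a b" "Cod A a = x" "Cod A b = y" "m = pair A a b"
    by (rule A.mono_span[OF assms])
  note [simp] = A.jointly_mono_ar[OF ab(1)] F_jointly_mono[OF ab(1)]
  have eq: "prod_comparison A A' F x y \<cdot>\<^bsub>A'\<^esub> FAr F m = pair A' (FAr F a) (FAr F b)"
    using comparison_pair[of a b x y] ab by simp
  show "mono_ar A' (prod_comparison A A' F x y \<cdot>\<^bsub>A'\<^esub> FAr F m)"
    unfolding eq by (simp add: A'.mono_pair_iff)
  show "FAr Fbar (bracket x y (sub_class A m)) =
      bracket (FOb F x) (FOb F y) (sub_class A' (prod_comparison A A' F x y \<cdot>\<^bsub>A'\<^esub> FAr F m))"
    using rel_map_span_rel[OF ab(1)] ab unfolding eq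
    by (simp add: FAr_T0_ftor bracket_def span_rel_def)
qed

text \<open>By \<open>Fbar_graph_ar\<close> both functors send an arrow to the graph of its image,
  so they agree strictly and the components can be identities.\<close>

lemma Gamma_naturality:
  "natural_isomorphism A (T0 A' \<delta>') (ftor_comp (Gamma_ftor A') F) (ftor_comp Fbar (Gamma_ftor A))
     (\<lambda>x. graph_ar A' (Idn A' (FOb F x)))"
  unfolding natural_isomorphism_def ftor_comp_def Gamma_ftor_def
  by (auto simp: hom_def A'.graph_ar_iso A'.iso_id)

end

section \<open>Finite limits\<close>

context cat_loc
begin

lemma limit_empty: "is_limit C {} {} s t X u l \<pi> \<longleftrightarrow> terminal_ob C l"
  by (simp add: is_limit_def is_cone_def terminal_ob_def Ball_def)

lemma coneD:
  assumes "is_cone C V E s t X u l \<pi>"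
  shows "l \<in> Ob C"
    and "v \<in> V \<Longrightarrow> \<pi> v \<in> Ar C" "v \<in> V \<Longrightarrow> Dom C (\<pi> v) = l" "v \<in> V \<Longrightarrow> Cod C (\<pi> v) = X v"
    and "e \<in> E \<Longrightarrow> u e \<cdot> \<pi> (s e) = \<pi> (t e)"
  using assms unfolding is_cone_def hom_def by auto

lemma diagramD:
  assumes "finite_diagram C V E s t X u"
  shows "v \<in> V \<Longrightarrow> X v \<in> Ob C"
    and "e \<in> E \<Longrightarrow> u e \<in> Ar C" "e \<in> E \<Longrightarrow> Dom C (u e) = X (s e)" "e \<in> E \<Longrightarrow> Cod C (u e) = X (t e)"
    and "e \<in> E \<Longrightarrow> s e \<in> V" "e \<in> E \<Longrightarrow> t e \<in> V"
  using assms unfolding finite_diagram_def hom_def by auto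

lemma cone_comp:
  assumes "finite_diagram C V E s t X u" "is_cone C V E s t X u l \<pi>" "h \<in> Ar C" "Cod C h = l"
    and "\<And>v. v \<in> V \<Longrightarrow> \<pi>' v = \<pi> v \<cdot> h"
  shows "is_cone C V E s t X u (Dom C h) \<pi>'"
proof -
  note [simp] = coneD[OF assms(2)] diagramD[OF assms(1)] assms(3-5)
  have "u e \<cdot> \<pi>' (s e) = \<pi>' (t e)" if "e \<in> E" for e
    using that comp_eq_comp[OF coneD(5)[OF assms(2) that], of h] by simp
  then show ?thesis
    unfolding is_cone_def by (simp add: hom_def)
qed

lemma limit_cone: "is_limit C V E s t X u l \<pi> \<Longrightarrow> is_cone C V E s t X u l \<pi>"
  by (simp add: is_limit_def)

lemma limitE:
  assumes "is_limit C V E s t X u l \<pi>" "is_cone C V E s t X u l' \<pi>'"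
  obtains h where "h \<in> Ar C" "Dom C h = l'" "Cod C h = l" "\<And>v. v \<in> V \<Longrightarrow> \<pi> v \<cdot> h = \<pi>' v"
proof -
  obtain h where "h \<in> hom C l' l" "\<forall>v\<in>V. \<pi> v \<cdot> h = \<pi>' v"
    using assms unfolding is_limit_def by blast
  then show thesis by (intro that[of h]) (simp_all add: hom_def)
qed

lemma limit_arrow_eqI:
  assumes "finite_diagram C V E s t X u" "is_limit C V E s t X u l \<pi>"
    and "f \<in> Ar C" "g \<in> Ar C" "Dom C f = Dom C g" "Cod C f = l" "Cod C g = l"
    and "\<And>v. v \<in> V \<Longrightarrow> \<pi> v \<cdot> f = \<pi> v \<cdot> g"
  shows "f = g"
proof -
  have "is_cone C V E s t X u (Dom C f) (\<lambda>v. \<pi> v \<cdot> f)"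
    by (rule cone_comp[OF assms(1) limit_cone[OF assms(2)]]) (use assms in auto)
  then have "\<exists>!h. h \<in> hom C (Dom C f) l \<and> (\<forall>v\<in>V. \<pi> v \<cdot> h = \<pi> v \<cdot> f)"
    using assms(2) unfolding is_limit_def by blast
  moreover have "f \<in> hom C (Dom C f) l" "g \<in> hom C (Dom C f) l"
    using assms by (auto simp: hom_def)
  ultimately show ?thesis using assms(8) by metis
qed

lemma limitI:
  assumes "is_cone C V E s t X u l \<pi>"
    and "\<And>f g. \<lbrakk>f \<in> Ar C; g \<in> Ar C; Dom C f = Dom C g; Cod C f = l; Cod C g = l;
        \<And>v. v \<in> V \<Longrightarrow> \<pi> v \<cdot> f = \<pi> v \<cdot> g\<rbrakk> \<Longrightarrow> f = g"
    and "\<And>l' \<pi>'. is_cone C V E s t X u l' \<pi>' \<Longrightarrow>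
        \<exists>h. h \<in> Ar C \<and> Dom C h = l' \<and> Cod C h = l \<and> (\<forall>v\<in>V. \<pi> v \<cdot> h = \<pi>' v)"
  shows "is_limit C V E s t X u l \<pi>"
  unfolding is_limit_def
proof (intro conjI allI impI)
  fix l' \<pi>' assume "is_cone C V E s t X u l' \<pi>'"
  then obtain h where h: "h \<in> Ar C" "Dom C h = l'" "Cod C h = l" "\<And>v. v \<in> V \<Longrightarrow> \<pi> v \<cdot> h = \<pi>' v"
    using assms(3) by blast
  show "\<exists>!h. h \<in> hom C l' l \<and> (\<forall>v\<in>V. \<pi> v \<cdot> h = \<pi>' v)"
  proof (rule ex1I[of _ h])
    show "h \<in> hom C l' l \<and> (\<forall>v\<in>V. \<pi> v \<cdot> h = \<pi>' v)" using h by (simp add: hom_def)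
    fix k assume "k \<in> hom C l' l \<and> (\<forall>v\<in>V. \<pi> v \<cdot> k = \<pi>' v)"
    then show "k = h" using h by - (rule assms(2), simp_all add: hom_def)
  qed
qed (fact assms(1))

lemma limit_iso_apex:
  assumes d: "finite_diagram C V E s t X u" and l: "is_limit C V E s t X u l \<pi>"
    and l': "is_limit C V E s t X u l' \<pi>'"
  obtains h where "iso_ar C h" "Dom C h = l'" "Cod C h = l" "\<And>v. v \<in> V \<Longrightarrow> \<pi> v \<cdot> h = \<pi>' v"
proof -
  note [simp] = coneD[OF limit_cone[OF l]] coneD[OF limit_cone[OF l']]
  obtain h where h: "h \<in> Ar C" "Dom C h = l'" "Cod C h = l" "\<And>v. v \<in> V \<Longrightarrow> \<pi> v \<cdot> h = \<pi>' v"
    using limitE[OF l limit_cone[OF l']] by blast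
  obtain k where k: "k \<in> Ar C" "Dom C k = l" "Cod C k = l'" "\<And>v. v \<in> V \<Longrightarrow> \<pi>' v \<cdot> k = \<pi> v"
    using limitE[OF l' limit_cone[OF l]] by blast
  have "h \<cdot> k = Idn C l"
    by (rule limit_arrow_eqI[OF d l]) (use h k comp_eq_comp[OF h(4)] in simp_all)
  moreover have "k \<cdot> h = Idn C l'"
    by (rule limit_arrow_eqI[OF d l']) (use h k comp_eq_comp[OF k(4)] in simp_all)
  ultimately have "iso_ar C h" using h k by (intro isoI[where g = k]) simp_all
  then show thesis using that h by blast
qed

lemma limit_iso:
  assumes d: "finite_diagram C V E s t X u" and l: "is_limit C V E s t X u l \<pi>"
    and h: "iso_ar C h" "Cod C h = l" "\<And>v. v \<in> V \<Longrightarrow> \<pi>' v = \<pi> v \<cdot> h"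
  shows "is_limit C V E s t X u (Dom C h) \<pi>'"
proof (rule limitI)
  note [simp] = coneD[OF limit_cone[OF l]] iso_in_Ar[OF h(1)] h(2,3)
  obtain k where k: "k \<in> Ar C" "Dom C k = Cod C h" "Cod C k = Dom C h" "h \<cdot> k = Idn C (Cod C h)"
    using h(1) by (rule isoE)
  show "is_cone C V E s t X u (Dom C h) \<pi>'"
    by (rule cone_comp[OF d limit_cone[OF l]]) simp_all
  fix f g assume fg[simp]: "f \<in> Ar C" "g \<in> Ar C" "Dom C f = Dom C g" "Cod C f = Dom C h" "Cod C g = Dom C h"
    and eq: "\<And>v. v \<in> V \<Longrightarrow> \<pi>' v \<cdot> f = \<pi>' v \<cdot> g"
  have "h \<cdot> f = h \<cdot> g"
    by (rule limit_arrow_eqI[OF d l]) (use eq in simp_all)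
  then show "f = g" by - (rule monoD[OF iso_mono[OF h(1)]], simp_all)
next
  note [simp] = coneD[OF limit_cone[OF l]] iso_in_Ar[OF h(1)] h(2,3)
  obtain k where k: "k \<in> Ar C" "Dom C k = Cod C h" "Cod C k = Dom C h" "h \<cdot> k = Idn C (Cod C h)"
    using h(1) by (rule isoE)
  fix l' \<rho> assume "is_cone C V E s t X u l' \<rho>"
  then obtain j where j: "j \<in> Ar C" "Dom C j = l'" "Cod C j = l" "\<And>v. v \<in> V \<Longrightarrow> \<pi> v \<cdot> j = \<rho> v"
    using limitE[OF l] by blast
  then show "\<exists>j. j \<in> Ar C \<and> Dom C j = l' \<and> Cod C j = Dom C h \<and> (\<forall>v\<in>V. \<pi>' v \<cdot> j = \<rho> v)"
    using k comp_eq_comp[OF k(4), of j] by (intro exI[of _ "k \<cdot> j"]) simp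
qed

text \<open>Without edges, a cone over the larger diagram is a cone over the old one together with
  an arrow to the new object; the product with \<open>l\<close> classifies such pairs.\<close>

lemma limit_insert_vertex:
  assumes d: "finite_diagram C V {} s t X u" and l: "is_limit C V {} s t X u l \<pi>"
    and P: "is_product C l (X v) p q" and v: "v \<notin> V"
    and \<pi>': "\<pi>' v = q" "\<And>w. w \<in> V \<Longrightarrow> \<pi>' w = \<pi> w \<cdot> p"
  shows "is_limit C (insert v V) {} s t X u (Dom C p) \<pi>'"
proof (rule limitI)
  note cone = limit_cone[OF l]
  note [simp] = coneD[OF cone] product_ar[OF P] \<pi>'
  show "is_cone C (insert v V) {} s t X u (Dom C p) \<pi>'"
    unfolding is_cone_def hom_def using dom_ob[of q] by simp
  fix f g assume fg[simp]: "f \<in> Ar C" "g \<in> Ar C" "Dom C f = Dom C g" "Cod C f = Dom C p" "Cod C g = Dom C p"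
    and eq: "\<And>w. w \<in> insert v V \<Longrightarrow> \<pi>' w \<cdot> f = \<pi>' w \<cdot> g"
  have "\<pi> w \<cdot> (p \<cdot> f) = \<pi> w \<cdot> (p \<cdot> g)" if "w \<in> V" for w using eq[of w] that by simp
  then have "p \<cdot> f = p \<cdot> g"
    by - (rule limit_arrow_eqI[OF d l], simp_all)
  then show "f = g" using eq[of v] by - (rule jointly_monoD[OF product_jointly_mono[OF P]], simp_all)
next
  note cone = limit_cone[OF l]
  note [simp] = coneD[OF cone] product_ar[OF P] \<pi>'
  fix l' \<rho> assume c: "is_cone C (insert v V) {} s t X u l' \<rho>"
  then have "is_cone C V {} s t X u l' \<rho>" unfolding is_cone_def by blast
  then obtain j where j: "j \<in> Ar C" "Dom C j = l'" "Cod C j = l" "\<And>v. v \<in> V \<Longrightarrow> \<pi> v \<cdot> j = \<rho> v"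
    using limitE[OF l] by blast
  obtain h where h: "h \<in> Ar C" "Dom C h = Dom C j" "Cod C h = Dom C p" "p \<cdot> h = j" "q \<cdot> h = \<rho> v"
    by (rule productE[OF P, of j "\<rho> v"]) (use j coneD(2-4)[OF c, of v] in simp_all)
  show "\<exists>j. j \<in> Ar C \<and> Dom C j = l' \<and> Cod C j = Dom C p \<and> (\<forall>w\<in>insert v V. \<pi>' w \<cdot> j = \<rho> w)"
    by (rule exI[of _ h]) (use h j in simp)
qed

text \<open>The equalizer of \<open>f\<close> and \<open>g\<close> is the pullback of the two sections \<open>(1, f)\<close> and \<open>(1, g)\<close>.\<close>

lemma limit_insert_edge:
  assumes d: "finite_diagram C V (insert e E) s t X u" and l: "is_limit C V E s t X u l \<pi>"
    and P: "is_product C l (X (t e)) P Q"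
    and i: "i \<in> Ar C" "Dom C i = l" "Cod C i = Dom C P" "P \<cdot> i = Idn C l" "Q \<cdot> i = u e \<cdot> \<pi> (s e)"
    and j: "j \<in> Ar C" "Dom C j = l" "Cod C j = Dom C P" "P \<cdot> j = Idn C l" "Q \<cdot> j = \<pi> (t e)"
    and pb: "is_pullback C i j m n"
    and \<pi>': "\<And>v. v \<in> V \<Longrightarrow> \<pi>' v = \<pi> v \<cdot> m"
  shows "is_limit C V (insert e E) s t X u (Dom C m) \<pi>'"
proof -
  have d0: "finite_diagram C V E s t X u" using d unfolding finite_diagram_def by auto
  note cone = limit_cone[OF l]
  note [simp] = coneD[OF cone] product_ar[OF P] diagramD[OF d] i(1-3) j(1-3)
  note m = pullback_comm[OF pb]
  note [simp] = m(3,4,6-8)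
  \<comment> \<open>\<open>P\<close> retracts both sections, so projecting the pullback square by
    \<open>P\<close> identifies its two legs.\<close>
  have mn: "m = n"
    using comp_eq_comp[OF i(4), of m] comp_eq_comp[OF j(4), of n] m(9) by simp
  \<comment> \<open>Projecting the same square by \<open>Q\<close> yields the equation of the new
    edge.\<close>
  have eq: "u e \<cdot> (\<pi> (s e) \<cdot> m) = \<pi> (t e) \<cdot> m"
    using comp_eq_comp[OF i(5), of m] comp_eq_comp[OF j(5), of n] m(9) mn by simp
  show ?thesis
  proof (rule limitI)
    have "is_cone C V E s t X u (Dom C m) \<pi>'"
      by (rule cone_comp[OF d0 cone]) (simp_all add: \<pi>')
    then show "is_cone C V (insert e E) s t X u (Dom C m) \<pi>'"
      unfolding is_cone_def using eq \<pi>' by simp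
    fix f g assume [simp]: "f \<in> Ar C" "g \<in> Ar C" "Dom C f = Dom C g" "Cod C f = Dom C m" "Cod C g = Dom C m"
      and fg: "\<And>w. w \<in> V \<Longrightarrow> \<pi>' w \<cdot> f = \<pi>' w \<cdot> g"
    have "\<pi> w \<cdot> (m \<cdot> f) = \<pi> w \<cdot> (m \<cdot> g)" if "w \<in> V" for w using fg[of w] that \<pi>' by simp
    then have "m \<cdot> f = m \<cdot> g"
      by - (rule limit_arrow_eqI[OF d0 l], simp_all)
    then show "f = g" using mn by - (rule jointly_monoD[OF pullback_jointly_mono[OF pb]], simp_all)
  next
    fix l' \<rho> assume c: "is_cone C V (insert e E) s t X u l' \<rho>"
    then have "is_cone C V E s t X u l' \<rho>" unfolding is_cone_def by blast
    then obtain k where k: "k \<in> Ar C" "Dom C k = l'" "Cod C k = l" "\<And>v. v \<in> V \<Longrightarrow> \<pi> v \<cdot> k = \<rho> v"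
      using limitE[OF l] by blast
    \<comment> \<open>The cone satisfies the equation of \<open>e\<close>, so the two sections agree
      on \<open>k\<close>, and \<open>k\<close> taken twice competes with the pullback.\<close>
    have "i \<cdot> k = j \<cdot> k"
    proof (rule jointly_monoD[OF product_jointly_mono[OF P]])
      show "P \<cdot> (i \<cdot> k) = P \<cdot> (j \<cdot> k)"
        using comp_eq_comp[OF i(4), of k] comp_eq_comp[OF j(4), of k] k by simp
      show "Q \<cdot> (i \<cdot> k) = Q \<cdot> (j \<cdot> k)"
        using comp_eq_comp[OF i(5), of k] comp_eq_comp[OF j(5), of k] k coneD(5)[OF c, of e] by simp
    qed (use k in simp_all)
    then obtain h where h: "h \<in> Ar C" "Dom C h = Dom C k" "Cod C h = Dom C m" "m \<cdot> h = k"
      by - (rule pullbackE[OF pb, of k k], use k in auto)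
    show "\<exists>h. h \<in> Ar C \<and> Dom C h = l' \<and> Cod C h = Dom C m \<and> (\<forall>v\<in>V. \<pi>' v \<cdot> h = \<rho> v)"
      by (rule exI[of _ h]) (use h k \<pi>' in simp)
  qed
qed

end

section \<open>Preservation of finite limits\<close>

context regular_functor
begin

text \<open>A terminal object is the limit of the empty diagram; the families of objects and arrows
  supplied for it are placeholders.\<close>

lemma preserves_terminal_if_finite_limits:
  assumes "preserves_finite_limits A A' F" shows "preserves_terminal A A' F"
  unfolding preserves_terminal_def
proof (intro allI impI)
  fix l assume "terminal_ob A l"
  then have "is_limit A {} {} (\<lambda>v. v) (\<lambda>v. v) (\<lambda>_. l) (\<lambda>_. Idn A l) l (\<lambda>_. Idn A l)"
    by (simp add: A.limit_empty)
  then have "is_limit A' {} {} (\<lambda>v. v) (\<lambda>v. v) (FOb F \<circ> (\<lambda>_. l)) (FAr F \<circ> (\<lambda>_. Idn A l))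
      (FOb F l) (FAr F \<circ> (\<lambda>_. Idn A l))"
    using assms unfolding preserves_finite_limits_def by (simp add: finite_diagram_def)
  then show "terminal_ob A' (FOb F l)"
    by (simp add: A'.limit_empty)
qed

text \<open>The square exhibiting the product over \<open>one_ob A\<close> stays a pullback, and the
  image of \<open>one_ob A\<close> is terminal, so the image square exhibits a product
  again.\<close>

lemma F_product:
  assumes "preserves_terminal A A' F" "is_product A x y p q"
  shows "is_product A' (FOb F x) (FOb F y) (FAr F p) (FAr F q)"
proof -
  note [simp] = A.product_ar[OF assms(2)]
  obtain u where u: "u \<in> Ar A" "Dom A u = x" "Cod A u = one_ob A"
    using A.terminal_arrow[OF A.terminal_one, of x] A.cod_ob[of p] by auto
  obtain v where v: "v \<in> Ar A" "Dom A v = y" "Cod A v = one_ob A"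
    using A.terminal_arrow[OF A.terminal_one, of y] A.cod_ob[of q] by auto
  have "is_pullback A u v p q"
    using A.product_iff_pullback[OF A.terminal_one, of u v p q] u v assms by simp
  from F_pullback[OF this] show ?thesis
    using A'.product_iff_pullback[of "FOb F (one_ob A)" "FAr F u" "FAr F v" "FAr F p" "FAr F q"]
      assms(1) A.terminal_one u v unfolding preserves_terminal_def by simp
qed

lemma F_diagram:
  "finite_diagram A V E s t X u \<Longrightarrow> finite_diagram A' V E s t (FOb F \<circ> X) (FAr F \<circ> u)"
  unfolding finite_diagram_def hom_def by auto

text \<open>A cone suffices for the existence of all the products and pullbacks from which the limit
  is built, although \<open>A\<close> need not have finite limits.\<close>

lemma limit_exists_and_preserved:
  assumes pt: "preserves_terminal A A' F" and "finite E" "finite_diagram A V E s t X u"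
    and "is_cone A V E s t X u l \<pi>"
  shows "\<exists>l0 \<pi>0. is_limit A V E s t X u l0 \<pi>0 \<and>
    is_limit A' V E s t (FOb F \<circ> X) (FAr F \<circ> u) (FOb F l0) (FAr F \<circ> \<pi>0)"
  using assms(2-)
proof (induction E rule: finite_induct)
  case empty
  then have "finite V" by (simp add: finite_diagram_def)
  then show ?case using empty
  \<comment> \<open>Discrete diagrams are the base case of the induction over edges: vertices enter
    through products, edges only afterwards through equalizers.\<close>
  proof (induction V rule: finite_induct)
    case empty
    have "terminal_ob A' (FOb F (one_ob A))"
      using pt A.terminal_one unfolding preserves_terminal_def by blast
    then show ?case
      using A.terminal_one by (auto simp: A.limit_empty A'.limit_empty)
  next
    case (insert v V)
    note c = A.coneD[OF insert.prems(2)]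
    have d: "finite_diagram A V {} s t X u" and "is_cone A V {} s t X u l \<pi>"
      using insert.prems unfolding finite_diagram_def is_cone_def by auto
    with insert.IH obtain l0 \<pi>0 where l0: "is_limit A V {} s t X u l0 \<pi>0"
      and Fl0: "is_limit A' V {} s t (FOb F \<circ> X) (FAr F \<circ> u) (FOb F l0) (FAr F \<circ> \<pi>0)"
      by blast
    obtain h where h: "h \<in> Ar A" "Dom A h = l" "Cod A h = l0"
      using A.limitE[OF l0 \<open>is_cone A V {} s t X u l \<pi>\<close>] by blast
    \<comment> \<open>The apex of the given cone is the source of a span to \<open>l0\<close> and
      \<open>X v\<close>, which forces their product to exist.\<close>
    have hp: "has_product A l0 (X v)"
      using A.span_product[of h "\<pi> v"] h c by simp
    note P = A.product_pr[OF hp]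
    let ?\<pi> = "\<lambda>w. if w = v then pr2 A l0 (X v) else \<pi>0 w \<cdot>\<^bsub>A\<^esub> pr1 A l0 (X v)"
    have L: "is_limit A (insert v V) {} s t X u (Dom A (pr1 A l0 (X v))) ?\<pi>"
      by (rule A.limit_insert_vertex[OF d l0 P insert(2)]) (use insert(2) in auto)
    have L': "is_limit A' (insert v V) {} s t (FOb F \<circ> X) (FAr F \<circ> u)
        (Dom A' (FAr F (pr1 A l0 (X v)))) (FAr F \<circ> ?\<pi>)"
      by (rule A'.limit_insert_vertex[OF F_diagram[OF d] Fl0 _ insert(2)])
         (use insert(2) F_product[OF pt P] hp A.coneD[OF A.limit_cone[OF l0]] in auto)
    have "Dom A' (FAr F (pr1 A l0 (X v))) = FOb F (Dom A (pr1 A l0 (X v)))"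
      using hp by simp
    then show ?case by - (intro exI conjI, rule L, use L' in \<open>simp only:\<close>)
  qed
next
  case (insert e E)
  note c = A.coneD[OF insert.prems(2)]
  note [simp] = A.diagramD[OF insert.prems(1)]
  have d: "finite_diagram A V E s t X u" and cE: "is_cone A V E s t X u l \<pi>"
    using insert.prems unfolding finite_diagram_def is_cone_def by auto
  with insert.IH obtain l0 \<pi>0 where l0: "is_limit A V E s t X u l0 \<pi>0"
    and Fl0: "is_limit A' V E s t (FOb F \<circ> X) (FAr F \<circ> u) (FOb F l0) (FAr F \<circ> \<pi>0)"
    by blast
  note [simp] = A.coneD(1-4)[OF A.limit_cone[OF l0]]
  obtain h where h: "h \<in> Ar A" "Dom A h = l" "Cod A h = l0" "\<And>v. v \<in> V \<Longrightarrow> \<pi>0 v \<cdot>\<^bsub>A\<^esub> h = \<pi> v"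
    using A.limitE[OF l0 cE] by blast
  have hp: "has_product A l0 (X (t e))"
    using A.span_product[of "Idn A l0" "\<pi>0 (t e)"] by simp
  note P = A.product_pr[OF hp]
  let ?i = "pair A (Idn A l0) (u e \<cdot>\<^bsub>A\<^esub> \<pi>0 (s e))" and ?j = "pair A (Idn A l0) (\<pi>0 (t e))"
  \<comment> \<open>The arrow \<open>h\<close> induced by the given cone equalises the two sections,
    so it completes the cospan to a square and regularity yields the pullback.\<close>
  have "has_pullback A ?i ?j"
    by (rule A.square_has_pullback[of ?i ?j h h]) (use h c in simp_all)
  then obtain m n where pb: "is_pullback A ?i ?j m n" unfolding has_pullback_def by blast
  note m = A.pullback_comm(3,7)[OF pb]
  let ?\<pi> = "\<lambda>v. \<pi>0 v \<cdot>\<^bsub>A\<^esub> m"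
  have L: "is_limit A V (insert e E) s t X u (Dom A m) ?\<pi>"
    by (rule A.limit_insert_edge[OF insert.prems(1) l0 P _ _ _ _ _ _ _ _ _ _ pb]) (use hp in simp_all)
  have FP: "is_product A' (FOb F l0) ((FOb F \<circ> X) (t e))
      (FAr F (pr1 A l0 (X (t e)))) (FAr F (pr2 A l0 (X (t e))))"
    using F_product[OF pt P] by simp
  have L': "is_limit A' V (insert e E) s t (FOb F \<circ> X) (FAr F \<circ> u) (Dom A' (FAr F m)) (FAr F \<circ> ?\<pi>)"
    by (rule A'.limit_insert_edge[OF F_diagram[OF insert.prems(1)] Fl0 FP _ _ _ _ _ _ _ _ _ _ F_pullback[OF pb]])
       (use hp m in simp_all)
  have "Dom A' (FAr F m) = FOb F (Dom A m)" using m by simp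
  then show ?case by - (intro exI conjI, rule L, use L' in \<open>simp only:\<close>)
qed

text \<open>The given limit is isomorphic to the one built step by step, whose image is a limit; the
  image of the isomorphism transports this property.\<close>

lemma preserves_finite_limits_if_terminal:
  assumes pt: "preserves_terminal A A' F" shows "preserves_finite_limits A A' F"
  unfolding preserves_finite_limits_def
proof (intro allI impI, elim conjE)
  fix V E s t X u l \<pi>
  assume d: "finite_diagram A V E s t X u" and l: "is_limit A V E s t X u l \<pi>"
  then have "finite E" by (simp add: finite_diagram_def)
  then obtain l0 \<pi>0 where l0: "is_limit A V E s t X u l0 \<pi>0"
    and Fl0: "is_limit A' V E s t (FOb F \<circ> X) (FAr F \<circ> u) (FOb F l0) (FAr F \<circ> \<pi>0)"
    using limit_exists_and_preserved[OF pt _ d A.limit_cone[OF l]] by blast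
  obtain h where h: "iso_ar A h" "Dom A h = l" "Cod A h = l0" "\<And>v. v \<in> V \<Longrightarrow> \<pi>0 v \<cdot>\<^bsub>A\<^esub> h = \<pi> v"
    using A.limit_iso_apex[OF d l0 l] by blast
  have "is_limit A' V E s t (FOb F \<circ> X) (FAr F \<circ> u) (Dom A' (FAr F h)) (FAr F \<circ> \<pi>)"
    by (rule A'.limit_iso[OF F_diagram[OF d] Fl0 F_iso[OF h(1)]])
       (use h A.iso_in_Ar[OF h(1)] A.coneD[OF A.limit_cone[OF l0]] in \<open>simp_all add: F_comp_eq\<close>)
  then show "is_limit A' V E s t (FOb F \<circ> X) (FAr F \<circ> u) (FOb F l) (FAr F \<circ> \<pi>)"
    using h A.iso_in_Ar[OF h(1)] by simp
qed

end

section \<open>The monoidal structure\<close>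

context regular_cat_degree
begin

lemma T0_structure_simps [simp]:
  "Assoc (T0 C \<delta>) x y z = graph_ar C (pair C (pr1 C x y \<cdot> pr1 C (prod_ob C x y) z)
      (pair C (pr2 C x y \<cdot> pr1 C (prod_ob C x y) z) (pr2 C (prod_ob C x y) z)))"
  "LUnit (T0 C \<delta>) x = graph_ar C (pr2 C (one_ob C) x)"
  "RUnit (T0 C \<delta>) x = graph_ar C (pr1 C x (one_ob C))"
  "Braid (T0 C \<delta>) x y = graph_ar C (pair C (pr2 C x y) (pr1 C x y))"
  by (simp_all add: T0_def Let_def)

end

section \<open>Compatibility with the tensor product\<close>

locale cartesian_regular_functor = regular_functor A \<delta> A' \<delta>' F
  for A :: "('o, 'm, 'x) cat_scheme" and \<delta> :: "'m \<Rightarrow> 'k::field"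
    and A' :: "('p, 'n, 'y) cat_scheme" and \<delta>' :: "'n \<Rightarrow> 'k" and F :: "('o, 'm, 'p, 'n) ftor" +
  assumes products: "has_binary_products A" and products': "has_binary_products A'"
    and terminal_preserved: "preserves_terminal A A' F"
begin

lemma has_products [simp]:
  "x \<in> Ob A \<Longrightarrow> y \<in> Ob A \<Longrightarrow> has_product A x y"
  "x' \<in> Ob A' \<Longrightarrow> y' \<in> Ob A' \<Longrightarrow> has_product A' x' y'"
  using products products' unfolding has_binary_products_def by blast+

lemma F_pr_product: "x \<in> Ob A \<Longrightarrow> y \<in> Ob A \<Longrightarrow>
    is_product A' (FOb F x) (FOb F y) (FAr F (pr1 A x y)) (FAr F (pr2 A x y))"
  by (intro F_product[OF terminal_preserved] A.product_pr) simp

text \<open>The inverse of the comparison arrow, in the direction a monoidal functor asks for. It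
  exists because the image of a product and the chosen product in \<open>A'\<close> are products of
  the same two objects, and it is used only through its effect on the projections.\<close>

definition phi :: "'o \<Rightarrow> 'o \<Rightarrow> 'n" where
  "phi x y = (SOME t. iso_ar A' t \<and> Dom A' t = prod_ob A' (FOb F x) (FOb F y) \<and>
     Cod A' t = FOb F (prod_ob A x y) \<and>
     FAr F (pr1 A x y) \<cdot>\<^bsub>A'\<^esub> t = pr1 A' (FOb F x) (FOb F y) \<and>
     FAr F (pr2 A x y) \<cdot>\<^bsub>A'\<^esub> t = pr2 A' (FOb F x) (FOb F y))"

lemma phi:
  assumes "x \<in> Ob A" "y \<in> Ob A"
  shows "iso_ar A' (phi x y)"
    and [simp]: "phi x y \<in> Ar A'" "Dom A' (phi x y) = prod_ob A' (FOb F x) (FOb F y)"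
    "Cod A' (phi x y) = FOb F (prod_ob A x y)"
    "FAr F (pr1 A x y) \<cdot>\<^bsub>A'\<^esub> phi x y = pr1 A' (FOb F x) (FOb F y)"
    "FAr F (pr2 A x y) \<cdot>\<^bsub>A'\<^esub> phi x y = pr2 A' (FOb F x) (FOb F y)"
proof -
  have "is_product A' (FOb F x) (FOb F y) (pr1 A' (FOb F x) (FOb F y)) (pr2 A' (FOb F x) (FOb F y))"
    using assms by (intro A'.product_pr) simp
  then obtain t where "iso_ar A' t" "Dom A' t = Dom A' (pr1 A' (FOb F x) (FOb F y))"
    "Cod A' t = Dom A' (FAr F (pr1 A x y))"
    "FAr F (pr1 A x y) \<cdot>\<^bsub>A'\<^esub> t = pr1 A' (FOb F x) (FOb F y)"
    "FAr F (pr2 A x y) \<cdot>\<^bsub>A'\<^esub> t = pr2 A' (FOb F x) (FOb F y)"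
    by (rule A'.product_iso_apex[OF F_pr_product[OF assms]])
  then have "\<exists>t. iso_ar A' t \<and> Dom A' t = prod_ob A' (FOb F x) (FOb F y) \<and>
     Cod A' t = FOb F (prod_ob A x y) \<and>
     FAr F (pr1 A x y) \<cdot>\<^bsub>A'\<^esub> t = pr1 A' (FOb F x) (FOb F y) \<and>
     FAr F (pr2 A x y) \<cdot>\<^bsub>A'\<^esub> t = pr2 A' (FOb F x) (FOb F y)"
    using assms by (intro exI[of _ t]) simp
  from someI_ex[OF this, folded phi_def]
  show "iso_ar A' (phi x y)" "phi x y \<in> Ar A'" "Dom A' (phi x y) = prod_ob A' (FOb F x) (FOb F y)"
    "Cod A' (phi x y) = FOb F (prod_ob A x y)"
    "FAr F (pr1 A x y) \<cdot>\<^bsub>A'\<^esub> phi x y = pr1 A' (FOb F x) (FOb F y)"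
    "FAr F (pr2 A x y) \<cdot>\<^bsub>A'\<^esub> phi x y = pr2 A' (FOb F x) (FOb F y)"
    by (simp_all add: A'.iso_in_Ar)
qed

lemma F_pr_phi_comp [simp]:
  assumes "x \<in> Ob A" "y \<in> Ob A" "h \<in> Ar A'" "Cod A' h = prod_ob A' (FOb F x) (FOb F y)"
  shows "FAr F (pr1 A x y) \<cdot>\<^bsub>A'\<^esub> (phi x y \<cdot>\<^bsub>A'\<^esub> h) = pr1 A' (FOb F x) (FOb F y) \<cdot>\<^bsub>A'\<^esub> h"
    "FAr F (pr2 A x y) \<cdot>\<^bsub>A'\<^esub> (phi x y \<cdot>\<^bsub>A'\<^esub> h) = pr2 A' (FOb F x) (FOb F y) \<cdot>\<^bsub>A'\<^esub> h"
  using assms by (auto intro!: A'.comp_eq_comp)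

lemma F_pr_pair_comp [simp]:
  assumes "a \<in> Ar A" "b \<in> Ar A" "Dom A a = Dom A b" "Cod A a = x" "Cod A b = y"
    "h \<in> Ar A'" "Cod A' h = FOb F (Dom A b)"
  shows "FAr F (pr1 A x y) \<cdot>\<^bsub>A'\<^esub> (FAr F (pair A a b) \<cdot>\<^bsub>A'\<^esub> h) = FAr F a \<cdot>\<^bsub>A'\<^esub> h"
    "FAr F (pr2 A x y) \<cdot>\<^bsub>A'\<^esub> (FAr F (pair A a b) \<cdot>\<^bsub>A'\<^esub> h) = FAr F b \<cdot>\<^bsub>A'\<^esub> h"
  by (rule A'.comp_eq_comp; use assms in simp)+

text \<open>The images of the projections exhibit a product, so arrows are compared coordinatewise.
  Associativity and braiding are verified this way.\<close>

lemma F_pr_eqI: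
  assumes "x \<in> Ob A" "y \<in> Ob A" "f \<in> Ar A'" "g \<in> Ar A'" "Dom A' f = Dom A' g"
    "Cod A' f = FOb F (prod_ob A x y)" "Cod A' g = FOb F (prod_ob A x y)"
    "FAr F (pr1 A x y) \<cdot>\<^bsub>A'\<^esub> f = FAr F (pr1 A x y) \<cdot>\<^bsub>A'\<^esub> g"
    "FAr F (pr2 A x y) \<cdot>\<^bsub>A'\<^esub> f = FAr F (pr2 A x y) \<cdot>\<^bsub>A'\<^esub> g"
  shows "f = g"
  by (rule A'.jointly_monoD[OF A'.product_jointly_mono[OF F_pr_product[OF assms(1,2)]]])
     (use assms in simp_all)

lemma phi_pair:
  assumes "a \<in> Ar A" "b \<in> Ar A" "Dom A a = Dom A b" "Cod A a = x" "Cod A b = y"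
  shows "phi x y \<cdot>\<^bsub>A'\<^esub> pair A' (FAr F a) (FAr F b) = FAr F (pair A a b)"
proof -
  have "x \<in> Ob A" "y \<in> Ob A" using assms by auto
  then show ?thesis by - (rule F_pr_eqI[of x y], use assms in simp_all)
qed

text \<open>Naturality of \<open>phi\<close> on basis elements. Composing with \<open>phi\<close>
  carries the pairings \<open>?k'\<close> and \<open>?l'\<close> formed in \<open>A'\<close> to the
  images of \<open>?k\<close> and \<open>?l\<close>. On one side the graph of \<open>phi\<close> is
  stripped from the left leg, on the other it is added to the right leg; both sides become the span
  of \<open>?k'\<close> and the image of \<open>?l\<close>.\<close>

lemma rel_map_rel_times:
  assumes "r \<in> relations A x y" "s \<in> relations A x' y'"
  shows "rel_comp A' \<delta>' (prod_ob A' (FOb F x) (FOb F x')) (FOb F (prod_ob A x x')) (FOb F (prod_ob A y y'))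
      (graph A' (phi x x')) (rel_map A A' F (prod_ob A x x') (prod_ob A y y') (rel_times A x y x' y' r s)) =
    rel_comp A' \<delta>' (prod_ob A' (FOb F x) (FOb F x')) (prod_ob A' (FOb F y) (FOb F y')) (FOb F (prod_ob A y y'))
      (rel_times A' (FOb F x) (FOb F y) (FOb F x') (FOb F y') (rel_map A A' F x y r) (rel_map A A' F x' y' s))
      (graph A' (phi y y'))"
proof -
  obtain a b where ab: "jointly_mono A a b" "Cod A a = x" "Cod A b = y" "r = span_rel A a b"
    using assms(1) by (rule A.relationsE)
  obtain c d where cd: "jointly_mono A c d" "Cod A c = x'" "Cod A d = y'" "s = span_rel A c d"
    using assms(2) by (rule A.relationsE)
  note [simp] = A.jointly_mono_ar[OF ab(1)] A.jointly_mono_ar[OF cd(1)]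
  have obs[simp]: "x \<in> Ob A" "y \<in> Ob A" "x' \<in> Ob A" "y' \<in> Ob A"
    using A.cod_ob[of a] A.cod_ob[of b] A.cod_ob[of c] A.cod_ob[of d] ab cd by simp_all
  let ?p = "pr1 A (Dom A b) (Dom A d)" and ?q = "pr2 A (Dom A b) (Dom A d)"
  let ?k = "pair A (a \<cdot>\<^bsub>A\<^esub> ?p) (c \<cdot>\<^bsub>A\<^esub> ?q)" and ?l = "pair A (b \<cdot>\<^bsub>A\<^esub> ?p) (d \<cdot>\<^bsub>A\<^esub> ?q)"
  let ?k' = "pair A' (FAr F (a \<cdot>\<^bsub>A\<^esub> ?p)) (FAr F (c \<cdot>\<^bsub>A\<^esub> ?q))"
    and ?l' = "pair A' (FAr F (b \<cdot>\<^bsub>A\<^esub> ?p)) (FAr F (d \<cdot>\<^bsub>A\<^esub> ?q))"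
  have P: "is_product A (Dom A b) (Dom A d) ?p ?q" by (intro A.product_pr) simp
  note times = A.rel_times_span_rel[OF ab(1) cd(1) P]
  have "is_product A' (Dom A' (FAr F b)) (Dom A' (FAr F d)) (FAr F ?p) (FAr F ?q)"
    using F_product[OF terminal_preserved P] by simp
  note times' = A'.rel_times_span_rel[OF F_jointly_mono[OF ab(1)] F_jointly_mono[OF cd(1)] this]
  have phi_k: "phi x x' \<cdot>\<^bsub>A'\<^esub> ?k' = FAr F ?k" and phi_l: "phi y y' \<cdot>\<^bsub>A'\<^esub> ?l' = FAr F ?l"
    by (rule phi_pair; use ab cd in simp)+
  have jm: "jointly_mono A' (FAr F ?k) (FAr F ?l)" by (rule F_jointly_mono[OF times(2)])
  have jm': "jointly_mono A' ?k' ?l'" using times'(2) by simp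
  have Fk: "FAr F ?k \<in> Ar A'" "Cod A' ?k' = Dom A' (phi x x')" "?k' \<in> Ar A'" using ab cd by simp_all
  have "rel_map A A' F (prod_ob A x x') (prod_ob A y y') (rel_times A x y x' y' r s) =
      span_rel A' (FAr F ?k) (FAr F ?l)"
    using times(1) rel_map_span_rel[OF times(2)] ab cd by simp
  moreover have "rel_comp A' \<delta>' (Dom A' (phi x x')) (Cod A' (phi x x')) (Cod A' (FAr F ?l))
      (graph A' (phi x x')) (span_rel A' (phi x x' \<cdot>\<^bsub>A'\<^esub> ?k') (FAr F ?l)) =
      Poly_Mapping.single (span_rel A' ?k' (FAr F ?l)) 1"
    using Fk jm phi_k by (intro A'.rel_comp_graph_left A'.iso_mono phi(1)) (simp_all only: obs)
  moreover have "rel_times A' (FOb F x) (FOb F y) (FOb F x') (FOb F y')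
      (rel_map A A' F x y r) (rel_map A A' F x' y' s) = span_rel A' ?k' ?l'"
    using times'(1) rel_map_span_rel[OF ab(1)] rel_map_span_rel[OF cd(1)] ab cd by simp
  moreover have "rel_comp A' \<delta>' (Cod A' ?k') (Cod A' ?l') (Cod A' (phi y y'))
      (span_rel A' ?k' ?l') (graph A' (phi y y')) =
      Poly_Mapping.single (span_rel A' ?k' (phi y y' \<cdot>\<^bsub>A'\<^esub> ?l')) 1"
    by (rule A'.rel_comp_graph_right[OF jm'])
       (use ab cd A'.jointly_mono_mono_right[OF jm' A'.iso_mono[OF phi(1)], of y y'] in simp_all)
  ultimately show ?thesis
    using ab cd phi_k phi_l by simp
qed

lemma Fbar_tensor:
  assumes f: "f \<in> Ar (T0 A \<delta>)" and g: "g \<in> Ar (T0 A \<delta>)"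
  shows "FAr Fbar (TensAr (T0 A \<delta>) f g) \<cdot>\<^bsub>T0 A' \<delta>'\<^esub> graph_ar A' (phi (src f) (src g)) =
    graph_ar A' (phi (tgt f) (tgt g)) \<cdot>\<^bsub>T0 A' \<delta>'\<^esub> TensAr (T0 A' \<delta>') (FAr Fbar f) (FAr Fbar g)"
proof -
  obtain x y c where f': "f = (x, y, c)" by (cases f)
  obtain x' y' d where g': "g = (x', y', d)" by (cases g)
  have o: "x \<in> Ob A" "y \<in> Ob A" "x' \<in> Ob A" "y' \<in> Ob A"
    and keys: "Poly_Mapping.keys c \<subseteq> relations A x y" "Poly_Mapping.keys d \<subseteq> relations A x' y'"
    using f g by (auto simp: T0_Ar f' g')
  have "lin_ext (\<lambda>r. lin_ext (\<lambda>s. rel_comp A' \<delta>' (prod_ob A' (FOb F x) (FOb F x'))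
      (FOb F (prod_ob A x x')) (FOb F (prod_ob A y y')) (graph A' (phi x x'))
      (rel_map A A' F (prod_ob A x x') (prod_ob A y y') (rel_times A x y x' y' r s))) d) c =
    lin_ext (\<lambda>r. lin_ext (\<lambda>s. rel_comp A' \<delta>' (prod_ob A' (FOb F x) (FOb F x'))
      (prod_ob A' (FOb F y) (FOb F y')) (FOb F (prod_ob A y y'))
      (rel_times A' (FOb F x) (FOb F y) (FOb F x') (FOb F y') (rel_map A A' F x y r) (rel_map A A' F x' y' s))
      (graph A' (phi y y'))) d) c"
    by (intro lin_ext_cong rel_map_rel_times) (use keys in auto)
  then show ?thesis
    using o by (simp add: f' g' FAr_T0_ftor T0_comp T0_TensAr bilin_lin_ext lin_ext_lin_ext)
qed

lemma Fbar_monoidal: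
  obtains \<epsilon> where "symmetric_monoidal_functor (T0 A \<delta>) (T0 A' \<delta>') Fbar
    (\<lambda>x y. graph_ar A' (phi x y)) (graph_ar A' \<epsilon>)"
proof -
  have t: "terminal_ob A' (FOb F (one_ob A))"
    using terminal_preserved A.terminal_one unfolding preserves_terminal_def by blast
  have [simp]: "one_ob A \<in> Ob A" "one_ob A' \<in> Ob A'"
    using A.terminal_one A'.terminal_one unfolding terminal_ob_def by auto
  \<comment> \<open>Two terminal objects are compared as limits of the empty diagram;
    \<open>undefined\<close> stands in for its objects, arrows and legs, of which there are
    none.\<close>
  obtain \<epsilon> where \<epsilon>: "iso_ar A' \<epsilon>" "Dom A' \<epsilon> = one_ob A'" "Cod A' \<epsilon> = FOb F (one_ob A)"
    using A'.limit_iso_apex[of "{}" "{}" "\<lambda>v. v" "\<lambda>v. v" "\<lambda>_. undefined" "\<lambda>_. undefined"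
        "FOb F (one_ob A)" "\<lambda>_. undefined" "one_ob A'" "\<lambda>_. undefined"] t A'.terminal_one
    by (auto simp: A'.limit_empty finite_diagram_def)
  have [simp]: "\<epsilon> \<in> Ar A'" using \<epsilon> A'.iso_in_Ar by blast
  note [simp] = \<epsilon>(2,3)
  have assoc: "FAr F (pair A (pr1 A x y \<cdot>\<^bsub>A\<^esub> pr1 A (prod_ob A x y) z)
      (pair A (pr2 A x y \<cdot>\<^bsub>A\<^esub> pr1 A (prod_ob A x y) z) (pr2 A (prod_ob A x y) z))) \<cdot>\<^bsub>A'\<^esub>
      (phi (prod_ob A x y) z \<cdot>\<^bsub>A'\<^esub>
        pair A' (phi x y \<cdot>\<^bsub>A'\<^esub> pr1 A' (prod_ob A' (FOb F x) (FOb F y)) (FOb F z))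
          (pr2 A' (prod_ob A' (FOb F x) (FOb F y)) (FOb F z))) =
      phi x (prod_ob A y z) \<cdot>\<^bsub>A'\<^esub>
       (pair A' (pr1 A' (FOb F x) (prod_ob A' (FOb F y) (FOb F z)))
          (phi y z \<cdot>\<^bsub>A'\<^esub> pr2 A' (FOb F x) (prod_ob A' (FOb F y) (FOb F z))) \<cdot>\<^bsub>A'\<^esub>
        pair A' (pr1 A' (FOb F x) (FOb F y) \<cdot>\<^bsub>A'\<^esub> pr1 A' (prod_ob A' (FOb F x) (FOb F y)) (FOb F z))
         (pair A' (pr2 A' (FOb F x) (FOb F y) \<cdot>\<^bsub>A'\<^esub> pr1 A' (prod_ob A' (FOb F x) (FOb F y)) (FOb F z))
           (pr2 A' (prod_ob A' (FOb F x) (FOb F y)) (FOb F z))))"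
    if [simp]: "x \<in> Ob A" "y \<in> Ob A" "z \<in> Ob A" for x y z
    \<comment> \<open>Two rounds of projection separate the triple product, off \<open>x\<close> and
      then \<open>y\<close> from \<open>z\<close>; each coordinate is settled by the projection
      rules.\<close>
    apply (rule F_pr_eqI[of x "prod_ob A y z"])
            apply simp_all
    apply (rule F_pr_eqI[of y z])
            apply simp_all
    done
  \<comment> \<open>Each unit law projects onto the coordinate of \<open>x\<close>, away from the
    one carrying \<open>\<epsilon>\<close>, so the projection rules for \<open>phi\<close> and
    \<open>pair\<close> settle it.\<close>
  have lunit: "FAr F (pr2 A (one_ob A) x) \<cdot>\<^bsub>A'\<^esub> (phi (one_ob A) x \<cdot>\<^bsub>A'\<^esub>
      pair A' (\<epsilon> \<cdot>\<^bsub>A'\<^esub> pr1 A' (one_ob A') (FOb F x)) (pr2 A' (one_ob A') (FOb F x))) =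
      pr2 A' (one_ob A') (FOb F x)"
    and runit: "FAr F (pr1 A x (one_ob A)) \<cdot>\<^bsub>A'\<^esub> (phi x (one_ob A) \<cdot>\<^bsub>A'\<^esub>
      pair A' (pr1 A' (FOb F x) (one_ob A')) (\<epsilon> \<cdot>\<^bsub>A'\<^esub> pr2 A' (FOb F x) (one_ob A'))) =
      pr1 A' (FOb F x) (one_ob A')"
    if "x \<in> Ob A" for x
    using that by simp_all
  have braid: "FAr F (pair A (pr2 A x y) (pr1 A x y)) \<cdot>\<^bsub>A'\<^esub> phi x y =
      phi y x \<cdot>\<^bsub>A'\<^esub> pair A' (pr2 A' (FOb F x) (FOb F y)) (pr1 A' (FOb F x) (FOb F y))"
    if [simp]: "x \<in> Ob A" "y \<in> Ob A" for x y
    by (rule F_pr_eqI[of y x]) simp_all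
  have "symmetric_monoidal_functor (T0 A \<delta>) (T0 A' \<delta>') Fbar
      (\<lambda>x y. graph_ar A' (phi x y)) (graph_ar A' \<epsilon>)"
    unfolding symmetric_monoidal_functor_def
  proof (intro conjI ballI, goal_cases)
    case 1 show ?case by (rule Fbar_functor)
  next
    case 2 show ?case by (simp add: hom_def)
  next
    case 3 show ?case by (rule A'.graph_ar_iso[OF \<epsilon>(1)])
  next
    case (4 x y) then show ?case by (simp add: hom_def)
  next
    case (5 x y) then show ?case by (simp add: A'.graph_ar_iso phi(1))
  next
    case (6 f g) then show ?case using Fbar_tensor[of f g] by simp
  next
    case (7 x y z) then show ?case using assoc[of x y z] by simp
  next
    case (8 x) then show ?case using lunit[of x] by simp
  next
    case (9 x) then show ?case using runit[of x] by simp
  next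
    case (10 x y) then show ?case using braid[of x y] by simp
  qed
  then show thesis by (rule that)
qed

end

theorem lemma4p1p2:
  fixes A :: "('o, 'm) cat" and A' :: "('p, 'n) cat"
    and \<delta> :: "'m \<Rightarrow> 'k::field" and \<delta>' :: "'n \<Rightarrow> 'k"
    and F :: "('o, 'm, 'p, 'n) ftor"
  assumes "regular_category A" and "regular_category A'"
    and "degree_function A \<delta>" and "degree_function A' \<delta>'"
    and "is_functor A A' F"
    and "preserves_degree A \<delta> A' \<delta>' F"
    and "preserves_pullbacks A A' F"
    and "reflects_existence_of_pullbacks A A' F"
  shows "\<exists>Fbar :: ('o, ('o, 'm, 'k) rel_ar, 'p, ('p, 'n, 'k) rel_ar) ftor.
     (is_functor (T0 A \<delta>) (T0 A' \<delta>') Fbar \<and>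
      linear_on_homs A \<delta> Fbar \<and>
      (\<forall>x\<in>Ob A. FOb Fbar x = FOb F x) \<and>
      (\<forall>x\<in>Ob A. \<forall>y\<in>Ob A. \<forall>m. has_product A x y \<and> mono_ar A m \<and> Cod A m = prod_ob A x y \<longrightarrow>
         mono_ar A' (prod_comparison A A' F x y \<cdot>\<^bsub>A'\<^esub> FAr F m) \<and>
         FAr Fbar (bracket x y (sub_class A m)) =
         bracket (FOb F x) (FOb F y)
           (sub_class A' (prod_comparison A A' F x y \<cdot>\<^bsub>A'\<^esub> FAr F m)))) \<and>
     (\<exists>\<eta>. natural_isomorphism A (T0 A' \<delta>')
            (ftor_comp (Gamma_ftor A') F) (ftor_comp Fbar (Gamma_ftor A)) \<eta>) \<and>
     (preserves_terminal A A' F \<longleftrightarrow> preserves_finite_limits A A' F) \<and>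
     (has_binary_products A \<and> has_binary_products A' \<and> preserves_terminal A A' F \<longrightarrow>
        (\<exists>\<phi> \<epsilon>. symmetric_monoidal_functor (T0 A \<delta>) (T0 A' \<delta>') Fbar \<phi> \<epsilon>))"
proof -
  interpret regular_functor A \<delta> A' \<delta>' F
    using assms by unfold_locales
  have "\<exists>\<phi> \<epsilon>. symmetric_monoidal_functor (T0 A \<delta>) (T0 A' \<delta>') Fbar \<phi> \<epsilon>"
    if "has_binary_products A" "has_binary_products A'" "preserves_terminal A A' F"
  proof -
    \<comment> \<open>Binary products and preservation of the terminal object are assumed for the
      monoidal claim alone, hence the local interpretation.\<close>
    interpret cartesian_regular_functor A \<delta> A' \<delta>' F
      using that by unfold_locales
    show ?thesis using Fbar_monoidal by metis
  qed
  then show ?thesis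
    using Fbar_functor Fbar_linear Fbar_bracket Gamma_naturality
      preserves_terminal_if_finite_limits preserves_finite_limits_if_terminal
    by (intro exI[of _ Fbar]) auto
qed

end
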